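(* Let $n\ge1$, $\mathfrak g=\mathfrak{gl}(n+1|n)$ with index set $I=\{1,\dots,2n+1\}$, $p(i)=0$ for $i$ odd and $p(i)=1$ for $i$ even, $f=\sum_{i=1}^{2n}e_{i+1,i}$, and the grading $e_{ij}\in\mathfrak g_{(j-i)/2}$. Let $\mathcal A$ be the $(2n+1)\times(2n+1)$ matrix with entries in $\mathcal V(\bar{\mathfrak p})[D]$ given by $\mathcal A_{ij}=\delta_{ij}D+\bar e^{\,ji}$ for $i\le j$, $\mathcal A_{i+1,i}=-1$, and $\mathcal A_{ij}=0$ for $i>j+1$, where $e^{ji}:=(-1)^{p(j)}e_{ji}$. Write $\operatorname{rdet}(\mathcal A)=\sum_{i=0}^{2n+1}w_{2n+1-i}D^i$ with $w_i\in\mathcal V(\bar{\mathfrak p})$. Then $w_1,\dots,w_{2n+1}\in\mathcal W(\bar{\mathfrak g},f)$ and they freely generate it as a differential algebra: $\mathcal W(\bar{\mathfrak g},f)=\mathbb C[w_i^{(m)}\mid i\in I,\ m\in\mathbb Z_{\ge0}]$.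
   Context: $\mathfrak{gl}$ with parity $p:I\to\{0,1\}$ on the index set is spanned by matrix units $e_{ij}$ of parity $p(i)+p(j)$, with $[e_{ij},e_{kl}]=\delta_{jk}e_{il}-(-1)^{(p(i)+p(j))(p(k)+p(l))}\delta_{il}e_{kj}$, supertrace $\operatorname{str}(\sum a_{ij}e_{ij})=\sum(-1)^{p(i)}a_{ii}$, and bilinear form $(X|Y)=\operatorname{str}(XY)$, i.e. $(e_{ij}|e_{kl})=\delta_{jk}\delta_{il}(-1)^{p(i)}$. For a Lie superalgebra $\mathfrak a$ with even supersymmetric invariant form, $\bar{\mathfrak a}=\{\bar a\}$ is a parity-reversed copy ($p(\bar a)=p(a)+1$), and $\mathcal V(\bar{\mathfrak a})=S(\mathbb C[D]\otimes\bar{\mathfrak a})$ is the free supercommutative algebra on the symbols $D^m\bar a$ with odd derivation $D$, made into a SUSY Poisson vertex algebra (level 1) by $\{\bar a{}_\chi\bar b\}=(-1)^{p(a)(p(b)+1)}\overline{[a,b]}+\chi(a|b)$, extended by sesquilinearity $\{Dx{}_\chi y\}=-\chi\{x{}_\chi y\}$, $\{x{}_\chi Dy\}=(-1)^{p(x)+1}(D+\chi)\{x{}_\chi y\}$ and the Leibniz rule $\{x{}_\chi yz\}=(-1)^{(p(x)+1)p(y)}y\{x{}_\chi z\}+\{x{}_\chi y\}z$ (and skewsymmetry); $\chi$ is odd, supercommutes with $\mathcal V$, and $D\chi+\chi D=-2\chi^2$. Write $x^{(m)}=D^mx$. SUSY classical $W$-algebra: given a grading $\mathfrak g=\bigoplus_{j\in\frac12\mathbb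 Z}\mathfrak g_j$ and odd $f\in\mathfrak g_{-1/2}$, set $\mathfrak n=\bigoplus_{j>0}\mathfrak g_j$, $\mathfrak p=\bigoplus_{j\le0}\mathfrak g_j$, $\mathcal V(\bar{\mathfrak p})=S(\mathbb C[D]\otimes\bar{\mathfrak p})\subset\mathcal V(\bar{\mathfrak g})$, $\mathfrak J$ = differential ideal of $\mathcal V(\bar{\mathfrak g})$ generated by $\{\bar n-(f|n):n\in\mathfrak n\}$, and $\mathcal W(\bar{\mathfrak g},f)=\{w\in\mathcal V(\bar{\mathfrak p}):\{\bar n{}_\chi w\}\in\mathbb C[\chi]\otimes\mathfrak J\ \forall n\in\mathfrak n\}$. "Freely generate" means the $w_i^{(m)}$ are free supercommutative generators of $\mathcal W$. $\mathcal V(\bar{\mathfrak p})[D]$ has product determined by $D\,a=D(a)+(-1)^{p(a)}aD$; coefficients are written to the left of powers of $D$. For an $N\times N$ matrix with entries in an associative algebra, $\operatorname{rdet}(A)=\sum_{\sigma\in S_N}\operatorname{sgn}(\sigma)A_{1\sigma(1)}A_{2\sigma(2)}\cdots A_{N\sigma(N)}$. *)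

theory Defs
  imports Complex_Main "HOL-Library.Product_Lexorder" "HOL-Combinatorics.Permutations"
begin

text \<open>Generators live in a linearly ordered type 'g; od x means that x is odd.
  An element of the free supercommutative algebra is a finitely supported
  function from (standard) monomials to complex coefficients.  A standard
  monomial is a sorted list of generators in which each odd generator occurs
  at most once; it stands for the ordered product of its entries.\<close>

type_synonym 'g sca = "'g list \<Rightarrow> complex"

definition supp :: "'g sca \<Rightarrow> 'g list set" where
  "supp F = {u. F u \<noteq> 0}"

definition is_mono :: "('g::linorder \<Rightarrow> bool) \<Rightarrow> 'g list \<Rightarrow> bool" where
  "is_mono od u \<longleftrightarrow> sorted u \<and> (\<forall>x. od x \<longrightarrow> count_list u x \<le> 1)"

definition valid :: "'g set \<Rightarrow> ('g::linorder \<Rightarrow> bool) \<Rightarrow> 'g sca \<Rightarrow> bool" where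
  "valid Gs od F \<longleftrightarrow> finite (supp F) \<and>
     (\<forall>u\<in>supp F. is_mono od u \<and> set u \<subseteq> Gs)"

definition szero :: "'g sca" where "szero = (\<lambda>u. 0)"
definition sone :: "'g sca" where "sone = (\<lambda>u. if u = [] then 1 else 0)"
definition sgen :: "'g \<Rightarrow> 'g sca" where "sgen x = (\<lambda>u. if u = [x] then 1 else 0)"
definition sadd :: "'g sca \<Rightarrow> 'g sca \<Rightarrow> 'g sca" where "sadd F G = (\<lambda>u. F u + G u)"
definition sscale :: "complex \<Rightarrow> 'g sca \<Rightarrow> 'g sca" where "sscale c F = (\<lambda>u. c * F u)"

definition mono_mult :: "('g::linorder \<Rightarrow> bool) \<Rightarrow> 'g list \<Rightarrow> 'g list \<Rightarrow> complex \<times> 'g list" where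
  "mono_mult od u v =
    (if \<exists>x. od x \<and> x \<in> set u \<and> x \<in> set v then (0, [])
     else ((-1) ^ card {(i, j). i < length u \<and> j < length v \<and> od (u ! i) \<and> od (v ! j) \<and> v ! j < u ! i},
           sort (u @ v)))"

definition smult :: "('g::linorder \<Rightarrow> bool) \<Rightarrow> 'g sca \<Rightarrow> 'g sca \<Rightarrow> 'g sca" where
  "smult od F G = (\<lambda>w. \<Sum>u\<in>supp F. \<Sum>v\<in>supp G.
      (if snd (mono_mult od u v) = w then fst (mono_mult od u v) * F u * G v else 0))"

definition sprod :: "('g::linorder \<Rightarrow> bool) \<Rightarrow> 'g sca list \<Rightarrow> 'g sca" where
  "sprod od Fs = foldr (smult od) Fs sone"

definition spar :: "('g \<Rightarrow> bool) \<Rightarrow> 'g sca \<Rightarrow> 'g sca" where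
  "spar od F = (\<lambda>u. (-1) ^ length (filter od u) * F u)"

definition slin :: "('g list \<Rightarrow> 'h sca) \<Rightarrow> 'g sca \<Rightarrow> 'h sca" where
  "slin h F = (\<lambda>w. \<Sum>u\<in>supp F. F u * h u w)"

text \<open>odd derivation extending a map d on generators (super Leibniz rule)\<close>
definition sder_mono :: "('g::linorder \<Rightarrow> bool) \<Rightarrow> ('g \<Rightarrow> 'g) \<Rightarrow> 'g list \<Rightarrow> 'g sca" where
  "sder_mono od d u = (\<lambda>w. \<Sum>i<length u.
      (-1) ^ length (filter od (take i u)) *
      sprod od (map sgen (u[i := d (u ! i)])) w)"

definition sder :: "('g::linorder \<Rightarrow> bool) \<Rightarrow> ('g \<Rightarrow> 'g) \<Rightarrow> 'g sca \<Rightarrow> 'g sca" where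
  "sder od d F = slin (sder_mono od d) F"

text \<open>N = 2n+1; index set I = {1..N}; p(i) = 1 iff i even.
  The generator (i, j, m) stands for D^m (bar e_ij).\<close>

type_synonym gen = "nat \<times> nat \<times> nat"
type_synonym V = "gen sca"

definition pp :: "nat \<Rightarrow> nat" where "pp i = (if even i then 1 else 0)"

definition Iset :: "nat \<Rightarrow> nat set" where "Iset n = {1..2*n+1}"

definition godd :: "gen \<Rightarrow> bool" where
  "godd x = (case x of (i, j, m) \<Rightarrow> odd (pp i + pp j + 1 + m))"

definition gens :: "nat \<Rightarrow> gen set" where
  "gens n = {(i, j, m). i \<in> Iset n \<and> j \<in> Iset n}"

text \<open>generators of V(bar p): p = sum of g_k with k \<le> 0, e_ij has degree (j-i)/2\<close>
definition pgens :: "nat \<Rightarrow> gen set" where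
  "pgens n = {(i, j, m). i \<in> Iset n \<and> j \<in> Iset n \<and> j \<le> i}"

definition Vg :: "nat \<Rightarrow> V set" where "Vg n = {F. valid (gens n) godd F}"
definition Vp :: "nat \<Rightarrow> V set" where "Vp n = {F. valid (pgens n) godd F}"

definition vmult :: "V \<Rightarrow> V \<Rightarrow> V" where "vmult = smult godd"
definition vD :: "V \<Rightarrow> V" where
  "vD = sder godd (\<lambda>(i, j, m). (i, j, Suc m))"
definition ebar :: "nat \<Rightarrow> nat \<Rightarrow> V" where "ebar i j = sgen (i, j, 0)"

text \<open>matrices of gl are functions nat => nat => complex (entries outside I ignored)\<close>
definition str_form :: "nat \<Rightarrow> (nat \<Rightarrow> nat \<Rightarrow> complex) \<Rightarrow> (nat \<Rightarrow> nat \<Rightarrow> complex) \<Rightarrow> complex" where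
  "str_form n X Y = (\<Sum>i\<in>Iset n. (-1) ^ pp i * (\<Sum>k\<in>Iset n. X i k * Y k i))"

definition barof :: "nat \<Rightarrow> (nat \<Rightarrow> nat \<Rightarrow> complex) \<Rightarrow> V" where
  "barof n X = (\<lambda>w. \<Sum>i\<in>Iset n. \<Sum>j\<in>Iset n. X i j * ebar i j w)"

definition fmat :: "nat \<Rightarrow> nat \<Rightarrow> nat \<Rightarrow> complex" where
  "fmat n a b = (if 1 \<le> b \<and> b \<le> 2*n \<and> a = b + 1 then 1 else 0)"

text \<open>n = sum of g_k with k > 0: matrices supported on i < j\<close>
definition nmats :: "nat \<Rightarrow> (nat \<Rightarrow> nat \<Rightarrow> complex) set" where
  "nmats n = {X. \<forall>i j. X i j \<noteq> 0 \<longrightarrow> i \<in> Iset n \<and> j \<in> Iset n \<and> i < j}"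

definition Jideal :: "nat \<Rightarrow> V set" where
  "Jideal n = \<Inter> {S. szero \<in> S \<and>
      (\<forall>x\<in>S. \<forall>y\<in>S. sadd x y \<in> S) \<and>
      (\<forall>x\<in>S. \<forall>r\<in>Vg n. vmult r x \<in> S \<and> vmult x r \<in> S) \<and>
      (\<forall>x\<in>S. vD x \<in> S) \<and>
      (\<forall>X\<in>nmats n. sadd (barof n X) (sscale (- str_form n (fmat n) X) sone) \<in> S)}"

text \<open>C[chi] (x) V: the function P represents sum_k chi^k P(k) (chi odd,
  powers of chi written to the left)\<close>
type_synonym CV = "nat \<Rightarrow> V"

definition cvzero :: CV where "cvzero = (\<lambda>k. szero)"
definition cvadd :: "CV \<Rightarrow> CV \<Rightarrow> CV" where "cvadd P Q = (\<lambda>k. sadd (P k) (Q k))"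
definition cvscale :: "complex \<Rightarrow> CV \<Rightarrow> CV" where "cvscale c P = (\<lambda>k. sscale c (P k))"
definition cvchi :: "CV \<Rightarrow> CV" where
  "cvchi P = (\<lambda>k. if k = 0 then szero else P (k - 1))"
text \<open>action of D, using D chi + chi D = -2 chi^2:
  D (chi^k a) = (-1)^k chi^k D(a) - 2 [k odd] chi^(k+1) a\<close>
definition cvD :: "CV \<Rightarrow> CV" where
  "cvD P = (\<lambda>k. sadd (sscale ((-1) ^ k) (vD (P k)))
                     (if k = 0 \<or> even (k - 1) then szero else sscale (-2) (P (k - 1))))"
text \<open>left multiplication by a homogeneous y of parity py:
  y chi^k a = (-1)^(py k) chi^k y a\<close>
definition cvlmult :: "bool \<Rightarrow> V \<Rightarrow> CV \<Rightarrow> CV" where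
  "cvlmult py y P = (\<lambda>k. sscale ((-1) ^ (if py then k else 0)) (vmult y (P k)))"
definition cvrmult :: "CV \<Rightarrow> V \<Rightarrow> CV" where
  "cvrmult P z = (\<lambda>k. vmult (P k) z)"

definition glpar :: "nat \<Rightarrow> nat \<Rightarrow> nat" where "glpar a b = pp a + pp b"

text \<open>{bar e_ab _chi bar e_kl} = (-1)^(p(e_ab)(p(e_kl)+1)) bar [e_ab, e_kl] + chi (e_ab|e_kl)\<close>
definition brk_base :: "nat \<Rightarrow> nat \<Rightarrow> nat \<Rightarrow> nat \<Rightarrow> CV" where
  "brk_base a b k l = (\<lambda>d.
     if d = 0 then
       sscale ((-1) ^ (glpar a b * (glpar k l + 1)))
         (sadd (if b = k then ebar a l else szero)
               (if a = l then sscale (- ((-1) ^ (glpar a b * glpar k l))) (ebar k b) else szero))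
     else if d = 1 then
       (if b = k \<and> a = l then sscale ((-1) ^ pp a) sone else szero)
     else szero)"

text \<open>x = bar e_ab has V-parity p(e_ab)+1.
  {x _chi D^m y} = ((-1)^(p(x)+1) (D + chi))^m {x _chi y}\<close>
definition brk_gen :: "nat \<Rightarrow> nat \<Rightarrow> gen \<Rightarrow> CV" where
  "brk_gen a b y = (case y of (k, l, m) \<Rightarrow>
     ((\<lambda>P. cvscale ((-1) ^ (glpar a b + 1 + 1)) (cvadd (cvD P) (cvchi P))) ^^ m)
       (brk_base a b k l))"

text \<open>Leibniz rule: {x _chi y z} = (-1)^((p(x)+1) p(y)) y {x _chi z} + {x _chi y} z\<close>
fun brk_mono :: "nat \<Rightarrow> nat \<Rightarrow> gen list \<Rightarrow> CV" where
  "brk_mono a b [] = cvzero"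
| "brk_mono a b (y # u) =
     cvadd (cvscale ((-1) ^ ((glpar a b + 1 + 1) * (if godd y then 1 else 0)))
                    (cvlmult (godd y) (sgen y) (brk_mono a b u)))
           (cvrmult (brk_gen a b y) (sprod godd (map sgen u)))"

definition brk :: "nat \<Rightarrow> nat \<Rightarrow> V \<Rightarrow> CV" where
  "brk a b F = (\<lambda>k. slin (\<lambda>u. brk_mono a b u k) F)"

definition brk_el :: "nat \<Rightarrow> (nat \<Rightarrow> nat \<Rightarrow> complex) \<Rightarrow> V \<Rightarrow> CV" where
  "brk_el n X F = (\<lambda>k w. \<Sum>a\<in>Iset n. \<Sum>b\<in>Iset n. X a b * brk a b F k w)"

definition Walg :: "nat \<Rightarrow> V set" where
  "Walg n = {w \<in> Vp n. \<forall>X\<in>nmats n. \<forall>k. brk_el n X w k \<in> Jideal n}"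

text \<open>P represents sum_i P(i) D^i (coefficients on the left)\<close>
type_synonym Op = "nat \<Rightarrow> V"

definition opone :: Op where "opone = (\<lambda>i. if i = 0 then sone else szero)"
definition opadd :: "Op \<Rightarrow> Op \<Rightarrow> Op" where "opadd P Q = (\<lambda>i. sadd (P i) (Q i))"
text \<open>left multiplication by D: D b = D(b) + (-1)^p(b) b D\<close>
definition opDleft :: "Op \<Rightarrow> Op" where
  "opDleft Q = (\<lambda>i. sadd (vD (Q i)) (if i = 0 then szero else spar godd (Q (i - 1))))"
definition opmult :: "Op \<Rightarrow> Op \<Rightarrow> Op" where
  "opmult P Q = (\<lambda>k w. \<Sum>i\<in>{i. P i \<noteq> szero}. vmult (P i) ((opDleft ^^ i) Q k) w)"

definition rdet :: "nat \<Rightarrow> (nat \<Rightarrow> nat \<Rightarrow> Op) \<Rightarrow> Op" where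
  "rdet N A = (\<lambda>k w. \<Sum>\<sigma>\<in>{\<sigma>. \<sigma> permutes {1..N}}.
      of_int (sign \<sigma>) * foldr opmult (map (\<lambda>i. A i (\<sigma> i)) [1..<N+1]) opone k w)"

definition Amat :: "nat \<Rightarrow> nat \<Rightarrow> nat \<Rightarrow> Op" where
  "Amat n i j =
     (if i \<le> j then
        (\<lambda>d. if d = 0 then sscale ((-1) ^ pp j) (ebar j i)
             else if d = 1 \<and> i = j then sone else szero)
      else if i = j + 1 then (\<lambda>d. if d = 0 then sscale (-1) sone else szero)
      else (\<lambda>d. szero))"

definition wgen :: "nat \<Rightarrow> nat \<Rightarrow> V" where
  "wgen n k = rdet (2*n+1) (Amat n) (2*n+1 - k)"

text \<open>Symbols (k, m) stand for w_k^(m), of parity k + m (w_k has parity k mod 2).\<close>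
definition wodd :: "nat \<times> nat \<Rightarrow> bool" where "wodd s = odd (fst s + snd s)"
definition wsyms :: "nat \<Rightarrow> (nat \<times> nat) set" where
  "wsyms n = {(k, m). k \<in> Iset n}"

definition weval :: "nat \<Rightarrow> (nat \<times> nat) sca \<Rightarrow> V" where
  "weval n F = slin (\<lambda>u. sprod godd (map (\<lambda>(k, m). (vD ^^ m) (wgen n k)) u)) F"

end

theory Submission
  imports Defs
begin

text \<open>Modulo the ideal, an upper triangular unit e_ab acts on functions of p, once chi is traded for
  derivatives of a test field of the parity of e_ab, by an even derivation delta commuting with D; the
  algebra W is the common kernel of these derivations. On the matrix of the theorem delta is the
  infinitesimal gauge transformation given by the commutator with the test field times E_ab. As the
  matrix is Hessenberg with -1 below the diagonal, its leading minors satisfy a linear recursion, by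
  which the transformation of the minors telescopes and the full row determinant is invariant.

  Setting all generators outside the first column to zero maps w_k to plus or minus the generator of
  entry (k, 1), whence the w_k are differentially independent. This restriction is injective on W: in a
  nonzero invariant take a monomial of least length and then of least sum of column indices. If it
  contained a derivative of a generator of row k and column l > 1, the derivation for e_ab with
  a = l - 1, b = k would replace this letter by a derivative of the test field, and by minimality no
  other monomial can cancel the result. Hence the w_k generate W.\<close>

text \<open>The bracket has values in polynomials in the odd variable chi, and membership in the
  ideal is demanded of every coefficient. Substituting for chi^k the k-th derivative of a field of
  the parity of e_ab absorbs both the sign of chi and that of e_ab, at the price of signs
  \<open>chs k\<close> fixed by a recursion. Nothing is lost: the derivatives of the field are free
  symbols. They are realised by spare letters with first index 0, which precede every letter of V(g)
  lexicographically, so that a coefficient is read off by looking at words beginning with such a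
  letter. The same device supplies an indeterminate on which differential operators act, so that
  composition of operators replaces multiplication of their coefficients. In the injectivity
  argument a bracket term either adds one letter to a word or trades a letter for a bare derivative
  of the field. Length isolates the second kind; but several kinds of letters can be traded, and
  since all competitors lie in column l - 1, the sum of the column indices decides between
  them.\<close>

section \<open>Signs for sorting words in even and odd letters\<close>

definition gsign :: "('g::linorder \<Rightarrow> bool) \<Rightarrow> 'g \<Rightarrow> 'g \<Rightarrow> complex" where
  "gsign od x y = (if od x \<and> od y then (if x = y then 0 else if y < x then -1 else 1) else 1)"

definition cross :: "('g::linorder \<Rightarrow> bool) \<Rightarrow> 'g list \<Rightarrow> 'g list \<Rightarrow> complex" where
  "cross od u v = (\<Prod>x\<leftarrow>u. \<Prod>y\<leftarrow>v. gsign od x y)"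

text \<open>The scalar relating the product of the letters of a word to its sorted monomial: -1 to
  the number of inversions among odd letters, and 0 if an odd letter repeats. It allows all later
  arguments to run over arbitrary words, not only standard monomials.\<close>

fun kap :: "('g::linorder \<Rightarrow> bool) \<Rightarrow> 'g list \<Rightarrow> complex" where
  "kap od [] = 1"
| "kap od (x # w) = cross od [x] w * kap od w"

lemma cross_Nil [simp]: "cross od [] v = 1" "cross od u [] = 1"
proof -
  show "cross od [] v = 1" by (simp add: cross_def)
  show "cross od u [] = 1" by (induction u) (auto simp: cross_def)
qed

lemma cross_Cons_left: "cross od (x # u) v = cross od [x] v * cross od u v"
  by (simp add: cross_def)

lemma cross_append_right: "cross od u (v @ w) = cross od u v * cross od u w"
  by (induction u) (simp_all add: cross_def)

lemma cross_mset:
  assumes "mset u = mset u'" "mset v = mset v'"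
  shows "cross od u v = cross od u' v'"
proof -
  have *: "cross od u v = prod_mset (image_mset (\<lambda>x. prod_mset (image_mset (gsign od x) (mset v))) (mset u))"
    for u v :: "'a list"
    by (simp add: cross_def flip: prod_mset_prod_list mset_map)
  show ?thesis using assms by (simp add: *)
qed

lemma cross_sort [simp]:
  "cross od (sort u) v = cross od u v" "cross od u (sort v) = cross od u v"
  by (auto intro!: cross_mset)

lemma kap_append: "kap od (u @ v) = kap od u * kap od v * cross od u v"
proof (induction u)
  case (Cons x u)
  then show ?case using cross_Cons_left[of od x u v]
    by (simp add: cross_append_right)
qed simp

lemma cross_single_mono:
  assumes "is_mono od (x # w)"
  shows "cross od [x] w = 1"
proof -
  have "gsign od x y = 1" if "y \<in> set w" for y
  proof -
    have "x \<le> y" using assms that by (auto simp: is_mono_def)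
    moreover have "x \<noteq> y" if "od x"
    proof
      assume "x = y"
      then have "count_list w x > 0" using \<open>y \<in> set w\<close> by (simp add: count_list_0_iff zero_less_iff_neq_zero)
      then show False using assms that by (auto simp: is_mono_def)
    qed
    ultimately show ?thesis by (auto simp: gsign_def)
  qed
  then have "map (gsign od x) w = map (\<lambda>_. 1) w" by (intro map_cong) auto
  then show ?thesis by (simp add: cross_def map_replicate_const)
qed

lemma is_mono_tl: "is_mono od (x # w) \<Longrightarrow> is_mono od w"
  by (fastforce simp: is_mono_def split: if_splits)

lemma kap_mono: "is_mono od w \<Longrightarrow> kap od w = 1"
  by (induction w) (auto dest: is_mono_tl simp: cross_single_mono)

lemma kap_repeat:
  assumes "od x" "count_list w x > 1"
  shows "kap od w = 0"
  using assms(2)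
proof (induction w)
  case (Cons y w)
  show ?case
  proof (cases "x = y")
    case True
    then have "x \<in> set w" using Cons.prems by (auto simp: count_list_0_iff zero_less_iff_neq_zero)
    then have "0 \<in> set (map (gsign od x) w)" using assms(1) by (force simp: gsign_def)
    then have "cross od [x] w = 0" by (auto simp: cross_def prod_list_zero_iff)
    then show ?thesis using True by simp
  next
    case False
    then show ?thesis using Cons by simp
  qed
qed simp

lemma count_list_sort [simp]: "count_list (sort w) x = count_list w x"
  by (metis count_mset mset_sort)

lemma is_mono_sort: "kap od w \<noteq> 0 \<Longrightarrow> is_mono od (sort w)"
  using kap_repeat[of od _ w] by (force simp: is_mono_def not_le)

text \<open>As a product over pairs of positions, \<open>cross\<close> has the factor -1 exactly at
  the inversions that \<open>mono_mult\<close> counts, and a factor 0 exactly when an odd letter is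
  shared.\<close>

lemma cross_eq_mono_mult:
  "cross od u v = fst (mono_mult od u v)"
proof (cases "\<exists>x. od x \<and> x \<in> set u \<and> x \<in> set v")
  case True
  then obtain x where x: "od x" "x \<in> set u" "x \<in> set v" by blast
  then have "0 \<in> set (map (gsign od x) v)" by (force simp: gsign_def)
  then have "0 = (\<Prod>y\<leftarrow>v. gsign od x y)" by (metis prod_list_zero_iff)
  then have "0 \<in> set (map (\<lambda>x. \<Prod>y\<leftarrow>v. gsign od x y) u)" using x(2) by force
  then have "cross od u v = 0" unfolding cross_def by (metis prod_list_zero_iff)
  then show ?thesis using True by (simp add: mono_mult_def)
next
  case False
  let ?A = "{0..<length u} \<times> {0..<length v}"
  let ?P = "\<lambda>p. od (u ! fst p) \<and> od (v ! snd p) \<and> v ! snd p < u ! fst p"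
  have "cross od u v = (\<Prod>i=0..<length u. \<Prod>j=0..<length v. gsign od (u ! i) (v ! j))"
    by (simp add: cross_def prod.list_conv_set_nth)
  also have "\<dots> = (\<Prod>p\<in>?A. gsign od (u ! fst p) (v ! snd p))"
    by (simp add: prod.cartesian_product case_prod_beta)
  also have "\<dots> = (\<Prod>p\<in>?A. if ?P p then -1 else 1)"
  proof (rule prod.cong[OF refl])
    fix p assume "p \<in> ?A"
    then have "u ! fst p \<in> set u" "v ! snd p \<in> set v" by auto
    then show "gsign od (u ! fst p) (v ! snd p) = (if ?P p then -1 else 1)"
      using False by (auto simp: gsign_def)
  qed
  also have "\<dots> = (-1) ^ card (?A \<inter> {p. ?P p})"
    by (simp add: prod.If_cases)
  also have "?A \<inter> {p. ?P p} = {(i, j). i < length u \<and> j < length v \<and> od (u ! i) \<and> od (v ! j) \<and> v ! j < u ! i}"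
    by auto
  finally show ?thesis using False by (simp add: mono_mult_def)
qed

lemma snd_mono_mult: "cross od u v \<noteq> 0 \<Longrightarrow> snd (mono_mult od u v) = sort (u @ v)"
  unfolding cross_eq_mono_mult by (auto simp: mono_mult_def split: if_splits)

lemma gsign_swap: "gsign od x y = (if od x \<and> od y then -1 else 1) * gsign od y x"
  by (auto simp: gsign_def)

definition swsign :: "('g \<Rightarrow> bool) \<Rightarrow> 'g \<Rightarrow> 'g \<Rightarrow> complex" where
  "swsign od x y = (if od x \<and> od y then -1 else 1)"

text \<open>Since \<open>cross\<close> depends only on the multisets of its arguments, only the pair
  x, y itself can change the value. For equal odd letters both sides are 0.\<close>

lemma kap_swap: "kap od (u @ x # y # v) = swsign od x y * kap od (u @ y # x # v)"
proof -
  have "cross od u (x # y # v) = cross od u (y # x # v)" by (rule cross_mset) auto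
  moreover have "kap od (x # y # v) = swsign od x y * kap od (y # x # v)"
    using gsign_swap[of od x y] by (simp add: cross_def swsign_def)
  ultimately show ?thesis by (simp only: kap_append mult_ac)
qed

section \<open>The algebra as a ring\<close>

typedef sV = "{F :: V. valid UNIV godd F}" morphisms coef Abs_sV
  by (rule exI[of _ "\<lambda>_. 0"]) (simp add: valid_def supp_def)

setup_lifting type_definition_sV

abbreviation monom :: "gen list \<Rightarrow> bool" where "monom \<equiv> is_mono godd"

lemma finite_supp_coef [simp]: "finite (supp (coef x))"
  using coef[of x] by (simp add: valid_def)

lemma monom_supp_coef: "u \<in> supp (coef x) \<Longrightarrow> monom u"
  using coef[of x] by (simp add: valid_def)

lemma coef_eq_0: "\<not> monom u \<Longrightarrow> coef x u = 0"
  using monom_supp_coef[of u x] by (auto simp: supp_def)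

lemma sV_eqI: "(\<And>u. monom u \<Longrightarrow> coef x u = coef y u) \<Longrightarrow> x = y"
  by (metis coef_eq_0 coef_inject ext)

lemma valid_coef: "valid UNIV godd (coef x)"
  using coef[of x] by simp

instantiation sV :: ab_group_add
begin

lift_definition zero_sV :: sV is "\<lambda>_. 0"
  by (simp add: valid_def supp_def)

lift_definition plus_sV :: "sV \<Rightarrow> sV \<Rightarrow> sV" is "\<lambda>F G u. F u + G u"
  subgoal for F G
    unfolding valid_def
    by (rule conjI, rule finite_subset[of _ "supp F \<union> supp G"]) (auto simp: supp_def, metis add_0)
  done

lift_definition uminus_sV :: "sV \<Rightarrow> sV" is "\<lambda>F u. - F u"
  by (simp add: valid_def supp_def)

lift_definition minus_sV :: "sV \<Rightarrow> sV \<Rightarrow> sV" is "\<lambda>F G u. F u - G u"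
  subgoal for F G
    unfolding valid_def
    by (rule conjI, rule finite_subset[of _ "supp F \<union> supp G"]) (auto simp: supp_def, metis)
  done

instance by standard (transfer; auto simp: fun_eq_iff)+

end

lift_definition scl :: "complex \<Rightarrow> sV \<Rightarrow> sV" (infixr "*c" 75) is "\<lambda>c F u. c * F u"
  unfolding valid_def by (auto intro: finite_subset[of _ "supp _"] simp: supp_def)

interpretation sV: vector_space scl
  by standard (transfer; auto simp: fun_eq_iff algebra_simps)+

lemma coef_simps [simp]:
  "coef 0 u = 0" "coef (x + y) u = coef x u + coef y u" "coef (- x) u = - coef x u"
  "coef (x - y) u = coef x u - coef y u" "coef (c *c x) u = c * coef x u"
  by (simp_all add: zero_sV.rep_eq plus_sV.rep_eq uminus_sV.rep_eq minus_sV.rep_eq scl.rep_eq)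

lemma coef_sum [simp]: "coef (sum f A) u = (\<Sum>a\<in>A. coef (f a) u)"
  by (induction A rule: infinite_finite_induct) auto

lift_definition mon :: "gen list \<Rightarrow> sV" is "\<lambda>u w. if monom u \<and> w = u then 1 else 0"
  unfolding valid_def by (auto simp: supp_def)

lemma coef_mon: "coef (mon u) w = (if monom u \<and> w = u then 1 else 0)"
  by (rule mon.rep_eq[THEN fun_cong])

text \<open>The product of the letters of an arbitrary word, already reduced to normal form.\<close>

definition wd :: "gen list \<Rightarrow> sV" where "wd w = kap godd w *c mon (sort w)"

lemma mon_wd: "mon u = (if monom u then wd u else 0)"
proof -
  have "sort u = u" if "monom u" using that by (simp add: is_mono_def sorted_sort_id)
  moreover have "mon u = 0" if "\<not> monom u" using that by (intro sV_eqI) (simp add: coef_mon)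
  ultimately show ?thesis by (simp add: wd_def kap_mono)
qed

lemma coef_wd: "coef (wd w) u = (if u = sort w then kap godd w else 0)"
  using is_mono_sort[of godd w] by (auto simp: wd_def coef_mon)

lemma coef_wd_mono: "monom w \<Longrightarrow> coef (wd w) u = (if u = w then 1 else 0)"
  using mon_wd[of w] coef_mon[of w u] by simp

lemma sV_expand:
  assumes "finite S" "supp (coef x) \<subseteq> S"
  shows "x = (\<Sum>u\<in>S. coef x u *c mon u)"
proof (rule sV_eqI)
  fix w assume w: "monom w"
  have "coef (\<Sum>u\<in>S. coef x u *c mon u) w = (\<Sum>u\<in>S. if u = w then coef x w else 0)"
    unfolding coef_sum by (rule sum.cong) (auto simp: coef_mon w)
  also have "\<dots> = coef x w" using assms by (auto simp: supp_def)
  finally show "coef x w = coef (\<Sum>u\<in>S. coef x u *c mon u) w" by simp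
qed

lemma sV_induct [case_names zero step]:
  assumes "P 0" and "\<And>c u y. monom u \<Longrightarrow> P y \<Longrightarrow> P (c *c wd u + y)"
  shows "P (x::sV)"
proof -
  have "P (\<Sum>u\<in>S. coef x u *c mon u)" if "finite S" "S \<subseteq> supp (coef x)" for S
    using that
  proof (induction S)
    case (insert u S)
    then have "monom u" using monom_supp_coef by blast
    then show ?case using insert assms(2)[of u] by (simp add: mon_wd)
  qed (use assms in simp)
  from this[of "supp (coef x)"] show ?thesis by (simp flip: sV_expand)
qed

definition lin :: "(gen list \<Rightarrow> sV) \<Rightarrow> sV \<Rightarrow> sV" where
  "lin h x = (\<Sum>u\<in>supp (coef x). coef x u *c h u)"

lemma lin_superset:
  assumes "finite S" "supp (coef x) \<subseteq> S"
  shows "lin h x = (\<Sum>u\<in>S. coef x u *c h u)"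
  unfolding lin_def by (rule sum.mono_neutral_left) (use assms in \<open>auto simp: supp_def\<close>)

lemma lin_add: "lin h (x + y) = lin h x + lin h y"
proof -
  let ?S = "supp (coef x) \<union> supp (coef y)"
  have *: "supp (coef (x + y)) \<subseteq> ?S" by (auto simp: supp_def)
  have "lin h (x + y) = (\<Sum>u\<in>?S. coef (x + y) u *c h u)"
    "lin h x = (\<Sum>u\<in>?S. coef x u *c h u)" "lin h y = (\<Sum>u\<in>?S. coef y u *c h u)"
    by (rule lin_superset; use * in simp)+
  then show ?thesis by (simp add: sV.scale_left_distrib sum.distrib)
qed

lemma lin_scale: "lin h (c *c x) = c *c lin h x"
proof -
  have *: "supp (coef (c *c x)) \<subseteq> supp (coef x)" by (auto simp: supp_def)
  have "lin h (c *c x) = (\<Sum>u\<in>supp (coef x). coef (c *c x) u *c h u)"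
    using * by (rule lin_superset[OF finite_supp_coef])
  then show ?thesis by (simp add: lin_def sV.scale_sum_right)
qed

lemma lin_0 [simp]: "lin h 0 = 0"
  by (simp add: lin_def supp_def)

lemma lin_mon: "lin h (mon u) = (if monom u then h u else 0)"
proof -
  have "supp (coef (mon u)) = (if monom u then {u} else {})"
    by (auto simp: supp_def coef_mon)
  then show ?thesis by (simp add: lin_def coef_mon)
qed

lemma lin_fun_add: "lin (\<lambda>u. f u + g u) x = lin f x + lin g x"
  by (simp add: lin_def sV.scale_right_distrib sum.distrib)

lemma lin_fun_scale: "lin (\<lambda>u. c *c g u) x = c *c lin g x"
  by (simp add: lin_def sV.scale_sum_right mult.commute)

lemma coef_lin: "coef (lin h x) = slin (\<lambda>u. coef (h u)) (coef x)"
  by (simp add: lin_def slin_def fun_eq_iff)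

locale slinear =
  fixes f :: "sV \<Rightarrow> sV"
  assumes add: "f (x + y) = f x + f y" and scale: "f (c *c x) = c *c f x"
begin

lemma zero [simp]: "f 0 = 0"
  using scale[of 0 0] by simp

lemma uminus: "f (- x) = - f x"
  using scale[of "-1" x] by simp

lemma diff: "f (x - y) = f x - f y"
  using add[of x "- y"] by (simp add: uminus)

lemma sum: "f (sum g A) = (\<Sum>a\<in>A. f (g a))"
  by (induction A rule: infinite_finite_induct) (auto simp: add)

lemmas lin_simps = add scale zero uminus diff sum

end

lemma slinear_lin: "slinear (lin h)"
  by standard (simp_all add: lin_add lin_scale)

definition mul :: "sV \<Rightarrow> sV \<Rightarrow> sV" where
  "mul x y = lin (\<lambda>u. lin (\<lambda>v. cross godd u v *c mon (sort (u @ v))) y) x"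

lemma mul_bilinear:
  "mul (x + y) z = mul x z + mul y z" "mul x (y + z) = mul x y + mul x z"
  "mul (c *c x) y = c *c mul x y" "mul x (c *c y) = c *c mul x y"
  "mul 0 x = 0" "mul x 0 = 0"
  by (simp_all add: mul_def lin_add lin_scale lin_fun_add lin_fun_scale)
    (simp add: lin_def)

text \<open>Concatenation matches multiplication because \<open>kap\<close> of a concatenation is
  the product of both values of \<open>kap\<close> with \<open>cross\<close>, the very sign in
  \<open>mul\<close>. Associativity of the ring thereby reduces to that of appending lists.\<close>

lemma mul_wd: "mul (wd u) (wd v) = wd (u @ v)"
proof (cases "kap godd u = 0 \<or> kap godd v = 0")
  case True
  then show ?thesis by (auto simp: wd_def kap_append mul_bilinear)
next
  case False
  then have "monom (sort u)" "monom (sort v)" using is_mono_sort by auto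
  moreover have "sort (sort u @ sort v) = sort (u @ v)"
    by (rule properties_for_sort) simp_all
  ultimately have "mul (mon (sort u)) (mon (sort v)) = cross godd u v *c mon (sort (u @ v))"
    by (simp add: mul_def lin_mon)
  then show ?thesis by (simp add: wd_def mul_bilinear kap_append mult_ac)
qed

instantiation sV :: ring_1
begin

definition times_sV :: "sV \<Rightarrow> sV \<Rightarrow> sV" where "times_sV = mul"
definition one_sV :: sV where "one_sV = wd []"

instance
proof
  fix a b c :: sV
  show "a * b * c = a * (b * c)"
    unfolding times_sV_def
  proof (induction a rule: sV_induct)
    case (step k u y)
    have "mul (mul (wd u) b) c = mul (wd u) (mul b c)"
    proof (induction b rule: sV_induct)
      case (step k v y)
      have "mul (mul (wd u) (wd v)) c = mul (wd u) (mul (wd v) c)"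
        by (induction c rule: sV_induct) (simp_all add: mul_bilinear mul_wd)
      then show ?case using step by (simp add: mul_bilinear)
    qed (simp add: mul_bilinear)
    then show ?case using step by (simp add: mul_bilinear)
  qed (simp add: mul_bilinear)
  show "1 * a = a" unfolding times_sV_def one_sV_def
    by (induction a rule: sV_induct) (simp_all add: mul_bilinear mul_wd)
  show "a * 1 = a" unfolding times_sV_def one_sV_def
    by (induction a rule: sV_induct) (simp_all add: mul_bilinear mul_wd)
  show "(0::sV) \<noteq> 1"
  proof
    assume "(0::sV) = 1"
    then have "coef 0 [] = coef (wd []) []" by (simp add: one_sV_def)
    then show False by (simp add: coef_wd)
  qed
qed (simp_all add: times_sV_def mul_bilinear)

end

lemma scl_mult [simp]: "(c *c x) * y = c *c (x * y)" "x * (c *c y) = c *c (x * y)"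
  by (simp_all add: times_sV_def mul_bilinear)

lemma wd_append: "wd (u @ v) = wd u * wd v"
  by (simp add: times_sV_def mul_wd)

lemma wd_Nil [simp]: "wd [] = 1"
  by (simp add: one_sV_def)

definition gn :: "gen \<Rightarrow> sV" where "gn x = wd [x]"

lemma wd_Cons: "wd (x # u) = gn x * wd u"
  using wd_append[of "[x]" u] by (simp add: gn_def)

lemma wd_prod_list: "wd u = prod_list (map gn u)"
  by (induction u) (simp_all add: wd_Cons)

lemma coef_mult: "coef (x * y) = smult godd (coef x) (coef y)"
proof
  fix w
  have "coef (x * y) w = (\<Sum>u\<in>supp (coef x). \<Sum>v\<in>supp (coef y).
      coef x u * (coef y v * (cross godd u v * coef (mon (sort (u @ v))) w)))"
    by (simp add: times_sV_def mul_def lin_def sum_distrib_left mult.assoc)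
  also have "\<dots> = smult godd (coef x) (coef y) w"
    unfolding smult_def
  proof (intro sum.cong refl)
    fix u v assume uv: "u \<in> supp (coef x)" "v \<in> supp (coef y)"
    show "coef x u * (coef y v * (cross godd u v * coef (mon (sort (u @ v))) w)) =
      (if snd (mono_mult godd u v) = w then fst (mono_mult godd u v) * coef x u * coef y v else 0)"
    proof (cases "cross godd u v = 0")
      case True then show ?thesis by (simp add: cross_eq_mono_mult[symmetric])
    next
      case False
      have "monom (sort (u @ v))"
      proof (rule is_mono_sort)
        show "kap godd (u @ v) \<noteq> 0" using uv False
          by (simp add: kap_append kap_mono monom_supp_coef)
      qed
      then show ?thesis using False
        by (simp add: cross_eq_mono_mult[symmetric] snd_mono_mult coef_mon)
    qed
  qed
  finally show "coef (x * y) w = smult godd (coef x) (coef y) w" .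
qed

lemma coef_one: "coef 1 = sone"
  by (simp add: fun_eq_iff sone_def coef_wd flip: wd_Nil)

lemma coef_gn: "coef (gn x) = sgen x"
  by (simp add: fun_eq_iff sgen_def gn_def coef_wd)

lemma coef_prod_list: "sprod godd (map coef xs) = coef (prod_list xs)"
  by (induction xs) (simp_all add: sprod_def coef_one coef_mult)

lemma coef_wd_sprod: "sprod godd (map sgen u) = coef (wd u)"
  using coef_prod_list[of "map gn u"] by (simp add: wd_prod_list coef_gn comp_def)

lemma coef_raw:
  "szero = coef 0" "sadd (coef x) (coef y) = coef (x + y)" "sscale c (coef x) = coef (c *c x)"
  by (simp_all add: szero_def sadd_def sscale_def fun_eq_iff)

text \<open>A function on words respecting the super-commutation of adjacent letters descends to the
  algebra; odd letters may not repeat because 2 is invertible.\<close>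

lemma word_swap_sort:
  assumes swap: "\<And>u x y v. \<Psi> (u @ x # y # v) = swsign godd x y *c \<Psi> (u @ y # x # v)"
  shows "\<Psi> w = kap godd w *c \<Psi> (sort w)"
proof -
  \<comment> \<open>Insertion sort: moving one letter to its place in a sorted word costs the factor
    \<open>cross\<close>, and these factors multiply up to \<open>kap\<close>.\<close>
  have ins: "\<Psi> (u @ x # w) = cross godd [x] w *c \<Psi> (u @ insort x w)" if "sorted w" for u x w
    using that
  proof (induction w arbitrary: u)
    case (Cons y w)
    consider "y < x" | "x = y" "godd x" | "x \<le> y" "x = y \<longrightarrow> \<not> godd x" by force
    then show ?case
    proof cases
      case 1
      have "\<Psi> (u @ x # y # w) = swsign godd x y *c \<Psi> ((u @ [y]) @ x # w)"
        using swap[of u x y w] by simp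
      also have "\<Psi> ((u @ [y]) @ x # w) = cross godd [x] w *c \<Psi> ((u @ [y]) @ insort x w)"
        using Cons.IH[of "u @ [y]"] Cons.prems by simp
      finally have "\<Psi> (u @ x # y # w) = (swsign godd x y * cross godd [x] w) *c \<Psi> (u @ y # insort x w)"
        by simp
      moreover have "cross godd [x] (y # w) = swsign godd x y * cross godd [x] w"
        using 1 by (auto simp: cross_def gsign_def swsign_def)
      moreover have "insort x (y # w) = y # insort x w" using 1 by auto
      ultimately show ?thesis by presburger
    next
      case 2
      have "\<Psi> (u @ x # x # w) = - \<Psi> (u @ x # x # w)"
        using swap[of u x x w] 2 by (simp add: swsign_def)
      then have "\<Psi> (u @ x # x # w) + \<Psi> (u @ x # x # w) = 0"
        by (metis add.right_inverse)
      then have "2 *c \<Psi> (u @ x # x # w) = 0"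
        using sV.scale_left_distrib[of 1 1] by simp
      then have "\<Psi> (u @ x # x # w) = 0" by (metis sV.scale_eq_0_iff zero_neq_numeral)
      then show ?thesis using 2 by (simp add: cross_def gsign_def)
    next
      case 3
      then have "gsign godd x z = 1" if "z \<in> set (y # w)" for z
        using that Cons.prems
      proof -
        have "x \<le> z" using that 3 Cons.prems by auto
        moreover have "x = z \<longrightarrow> \<not> godd x" using that 3 Cons.prems \<open>x \<le> z\<close> by auto
        ultimately show ?thesis by (auto simp: gsign_def)
      qed
      then have "map (gsign godd x) (y # w) = map (\<lambda>_. 1) (y # w)" by (intro map_cong) auto
      then have "cross godd [x] (y # w) = 1"
        by (simp only: cross_def map_replicate_const prod_list_replicate list.map prod_list.Cons
            prod_list.Nil) simp
      then show ?thesis using 3 by simp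
    qed
  qed simp
  have "\<Psi> (u @ w) = kap godd w *c \<Psi> (u @ sort w)" for u
  proof (induction w arbitrary: u)
    case (Cons x w)
    have "\<Psi> (u @ x # w) = kap godd w *c \<Psi> (u @ x # sort w)"
      using Cons[of "u @ [x]"] by simp
    also have "\<Psi> (u @ x # sort w) = cross godd [x] w *c \<Psi> (u @ sort (x # w))"
      using ins[of "sort w" u x] by simp
    finally show ?case by (simp add: mult.commute)
  qed simp
  from this[of "[]"] show ?thesis by simp
qed

text \<open>The device behind the parity automorphism, homomorphisms and derivations alike: each is
  prescribed on words, and one check on neighbouring letters makes the prescription valid on
  unsorted words too.\<close>

lemma lin_wd:
  assumes "\<And>u x y v. \<Psi> (u @ x # y # v) = swsign godd x y *c \<Psi> (u @ y # x # v)"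
  shows "lin \<Psi> (wd w) = \<Psi> w"
proof -
  have "lin \<Psi> (wd w) = kap godd w *c \<Psi> (sort w)"
    using is_mono_sort[of godd w] by (auto simp: wd_def lin_scale lin_mon)
  then show ?thesis using word_swap_sort[of \<Psi> w, OF assms] by simp
qed

section \<open>Parity, homomorphisms and derivations\<close>

definition psign :: "gen \<Rightarrow> complex" where "psign x = (if godd x then -1 else 1)"

lemma psign_mult [simp]: "psign x * psign x = 1" "psign x * (psign x * c) = c"
  by (simp_all add: psign_def)

definition wsign :: "gen list \<Rightarrow> complex" where "wsign u = (-1) ^ length (filter godd u)"

lemma wsign_simps [simp]: "wsign [] = 1" "wsign (x # u) = psign x * wsign u"
  by (simp_all add: wsign_def psign_def)

lemma wsign_append: "wsign (u @ v) = wsign u * wsign v"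
  by (induction u) simp_all

lemma wsign_square [simp]: "wsign u * wsign u = 1"
  by (induction u) (simp_all add: mult_ac)

lemma gn_swap: "gn x * gn y = swsign godd x y *c (gn y * gn x)"
proof -
  have "sort [x, y] = sort [y, x]" by (rule properties_for_sort) auto
  then have "wd [x, y] = swsign godd x y *c wd [y, x]"
    using kap_swap[of godd "[]" x y "[]"] by (simp only: append_Nil wd_def sV.scale_scale)
  then show ?thesis by (simp add: wd_Cons)
qed

lemma wd_swap: "wd (u @ x # y # v) = swsign godd x y *c wd (u @ y # x # v)"
  using gn_swap[of x y] by (simp add: wd_append wd_Cons flip: mult.assoc)

text \<open>The parity automorphism. It turns the sign (-1)^p(a) into an operator that also makes
  sense on inhomogeneous a; being even or odd becomes being an eigenvector for 1 or -1.\<close>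

definition sg :: "sV \<Rightarrow> sV" where "sg = lin (\<lambda>u. wsign u *c wd u)"

interpretation sg: slinear sg
  unfolding sg_def by (rule slinear_lin)

lemma sg_wd: "sg (wd u) = wsign u *c wd u"
  unfolding sg_def
proof (rule lin_wd)
  show "wsign (u @ x # y # v) *c wd (u @ x # y # v) =
    swsign godd x y *c wsign (u @ y # x # v) *c wd (u @ y # x # v)" for u x y v
    using wd_swap[of u x y v] by (simp add: wsign_append mult_ac)
qed

lemma sg_gn: "sg (gn x) = psign x *c gn x"
  using sg_wd[of "[x]"] by (simp add: gn_def)

lemma sg_one [simp]: "sg 1 = 1"
  using sg_wd[of "[]"] by simp

lemma sg_mult: "sg (a * b) = sg a * sg b"
proof (induction a rule: sV_induct)
  case (step c u y)
  have "sg (wd u * b) = sg (wd u) * sg b"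
    by (induction b rule: sV_induct)
      (simp_all add: algebra_simps sg.add sg.scale sg_wd wsign_append flip: wd_append)
  then show ?case using step by (simp add: algebra_simps sg.add sg.scale)
qed simp

lemma sg_sg [simp]: "sg (sg a) = a"
  by (induction a rule: sV_induct) (simp_all add: sg.add sg.scale sg_wd)

lemma coef_sg: "coef (sg x) = spar godd (coef x)"
proof
  fix u
  show "coef (sg x) u = spar godd (coef x) u"
    by (induction x rule: sV_induct)
      (simp_all add: sg.add sg.scale sg_wd coef_wd_mono spar_def wsign_def algebra_simps)
qed

lemma comm_gn: "a * gn y = gn y * (if godd y then sg a else a)"
proof (induction a rule: sV_induct)
  case (step c u z)
  have "wd u * gn y = gn y * (if godd y then sg (wd u) else wd u)"
  proof (induction u)
    case (Cons x u)
    have "gn x * (gn y * b) = swsign godd x y *c (gn y * (gn x * b))" for b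
      using gn_swap[of x y] by (simp flip: mult.assoc)
    then show ?case using Cons
      by (simp add: wd_Cons sg_mult sg_gn psign_def swsign_def mult.assoc)
  qed simp
  then show ?case using step by (simp add: algebra_simps sg.add sg.scale)
qed simp

lemma even_comm:
  assumes "sg a = a"
  shows "a * b = b * a"
proof (induction b rule: sV_induct)
  case (step c u z)
  have "a * wd u = wd u * a"
  proof (induction u)
    case (Cons x u)
    have "a * gn x = gn x * a" using comm_gn[of a x] assms by simp
    then have "a * (gn x * wd u) = gn x * (a * wd u)" by (simp flip: mult.assoc)
    then show ?case using Cons by (simp add: wd_Cons mult.assoc)
  qed simp
  then show ?case using step by (simp add: algebra_simps)
qed simp

lemma odd_comm:
  assumes "sg a = - a"
  shows "a * b = sg b * a"
proof (induction b rule: sV_induct)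
  case (step c u z)
  have "a * wd u = sg (wd u) * a"
  proof (induction u)
    case (Cons x u)
    have "a * gn x = psign x *c (gn x * a)" using comm_gn[of a x] assms by (simp add: psign_def)
    then have "a * (gn x * wd u) = psign x *c (gn x * (a * wd u))"
      by (simp flip: mult.assoc)
    then show ?case using Cons by (simp add: wd_Cons mult.assoc sg_mult sg_gn)
  qed simp
  then show ?case using step by (simp add: algebra_simps sg.add sg.scale)
qed simp

lemma hom_comm:
  assumes "sg a = (if p then -1 else 1) *c a" "sg b = (if q then -1 else 1) *c b"
  shows "a * b = (if p \<and> q then -1 else 1) *c (b * a)"
  using assms even_comm[of a b] even_comm[of b a] odd_comm[of a b] by (auto split: if_splits)

definition hm :: "(gen \<Rightarrow> sV) \<Rightarrow> sV \<Rightarrow> sV" where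
  "hm \<phi> = lin (\<lambda>w. prod_list (map \<phi> w))"

locale superhom =
  fixes \<phi> :: "gen \<Rightarrow> sV"
  assumes parity: "sg (\<phi> x) = psign x *c \<phi> x"
begin

sublocale slinear "hm \<phi>"
  unfolding hm_def by (rule slinear_lin)

lemma hm_wd: "hm \<phi> (wd w) = prod_list (map \<phi> w)"
  unfolding hm_def
proof (rule lin_wd)
  fix u x y v
  have "\<phi> x * \<phi> y = swsign godd x y *c (\<phi> y * \<phi> x)"
    using hom_comm[of "\<phi> x" "godd x" "\<phi> y" "godd y"] parity[of x] parity[of y]
    by (simp add: psign_def swsign_def)
  then show "prod_list (map \<phi> (u @ x # y # v)) = swsign godd x y *c prod_list (map \<phi> (u @ y # x # v))"
    by (simp flip: mult.assoc)
qed

lemma hm_gn [simp]: "hm \<phi> (gn x) = \<phi> x"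
  by (simp add: gn_def hm_wd)

lemma hm_one [simp]: "hm \<phi> 1 = 1"
  using hm_wd[of "[]"] by simp

lemma hm_mult: "hm \<phi> (a * b) = hm \<phi> a * hm \<phi> b"
proof (induction a rule: sV_induct)
  case (step c u y)
  have "hm \<phi> (wd u * b) = hm \<phi> (wd u) * hm \<phi> b"
    by (induction b rule: sV_induct)
      (simp_all add: algebra_simps add scale hm_wd flip: wd_append)
  then show ?case using step by (simp add: algebra_simps add scale)
qed simp

end

text \<open>The flag t is the parity of a derivation, and \<open>tw t\<close> is the sign that the
  derivation incurs when it passes a factor on its left. Both the odd D and the even derivations of
  the later sections are instances.\<close>

definition tw :: "bool \<Rightarrow> sV \<Rightarrow> sV" where "tw t a = (if t then sg a else a)"

fun derw :: "bool \<Rightarrow> (gen \<Rightarrow> sV) \<Rightarrow> gen list \<Rightarrow> sV" where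
  "derw t \<phi> [] = 0"
| "derw t \<phi> (x # w) = \<phi> x * wd w + tw t (gn x) * derw t \<phi> w"

definition der :: "bool \<Rightarrow> (gen \<Rightarrow> sV) \<Rightarrow> sV \<Rightarrow> sV" where "der t \<phi> = lin (derw t \<phi>)"

locale superder =
  fixes t :: bool and \<phi> :: "gen \<Rightarrow> sV"
  assumes parity: "sg (\<phi> x) = ((if t then -1 else 1) * psign x) *c \<phi> x"
begin

sublocale slinear "der t \<phi>"
  unfolding der_def by (rule slinear_lin)

lemma derw_append: "derw t \<phi> (u @ v) = derw t \<phi> u * wd v + tw t (wd u) * derw t \<phi> v"
proof (induction u)
  case (Cons x u)
  then show ?case
    by (simp add: algebra_simps wd_append) (simp add: tw_def wd_Cons sg_mult mult.assoc)
qed (simp add: tw_def)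

lemma derw_swap:
  "derw t \<phi> (u @ x # y # v) = swsign godd x y *c derw t \<phi> (u @ y # x # v)"
proof -
  \<comment> \<open>The image of a letter a has parity t + p(a). Moving it past b therefore gives
    the usual sign of a and b together with the sign of t and b, which is the twist.\<close>
  have comm: "\<phi> a * gn b = swsign godd a b *c (tw t (gn b) * \<phi> a)" for a b
  proof -
    have "\<phi> a * gn b = (if (t \<noteq> godd a) \<and> godd b then -1 else 1) *c (gn b * \<phi> a)"
      by (rule hom_comm) (simp_all add: parity sg_gn psign_def)
    then show ?thesis by (auto simp: tw_def sg_gn psign_def swsign_def)
  qed
  have "tw t (gn x) * \<phi> y = swsign godd x y *c (\<phi> y * gn x)"
    using comm[of y x] by (simp add: swsign_def)
  then have 1: "derw t \<phi> [x, y] = swsign godd x y *c derw t \<phi> [y, x]"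
    using comm[of x y] by (simp add: gn_def[symmetric] sV.scale_right_distrib add.commute
        flip: wd_Cons)
  have 2: "wd [x, y] = swsign godd x y *c wd [y, x]"
    using wd_swap[of "[]" x y "[]"] by simp
  have "derw t \<phi> ([x, y] @ v) = swsign godd x y *c derw t \<phi> ([y, x] @ v)"
    unfolding derw_append 1 2
    by (simp add: tw_def sV.scale_right_distrib sg.scale del: derw.simps)
  then have 3: "derw t \<phi> (x # y # v) = swsign godd x y *c derw t \<phi> (y # x # v)"
    by (simp del: derw.simps)
  have 4: "wd (x # y # v) = swsign godd x y *c wd (y # x # v)"
    using wd_swap[of "[]" x y v] by simp
  show ?thesis
    unfolding derw_append[of u] 3 4 by (simp add: sV.scale_right_distrib del: derw.simps)
qed

lemma der_wd: "der t \<phi> (wd w) = derw t \<phi> w"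
  unfolding der_def by (rule lin_wd) (rule derw_swap)

lemma der_gn [simp]: "der t \<phi> (gn x) = \<phi> x"
  unfolding gn_def der_wd by simp

lemma der_one [simp]: "der t \<phi> 1 = 0"
  using der_wd[of "[]"] by simp

lemma der_mult: "der t \<phi> (a * b) = der t \<phi> a * b + tw t a * der t \<phi> b"
proof (induction a rule: sV_induct)
  case (step c u y)
  have "der t \<phi> (wd u * b) = der t \<phi> (wd u) * b + tw t (wd u) * der t \<phi> b"
    by (induction b rule: sV_induct)
      (simp_all add: algebra_simps add scale der_wd derw_append sV.scale_right_distrib flip: wd_append)
  then show ?case using step
    by (simp add: algebra_simps add scale tw_def sg.add sg.scale sV.scale_right_distrib)
qed (simp add: tw_def)

lemma der_sg: "der t \<phi> (sg a) = (if t then -1 else 1) *c sg (der t \<phi> a)"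
proof (induction a rule: sV_induct)
  case (step c u y)
  have "der t \<phi> (sg (wd u)) = (if t then -1 else 1) *c sg (der t \<phi> (wd u))"
  proof (induction u)
    case (Cons x u)
    then show ?case
      by (auto simp: wd_Cons sg_mult sg_gn parity scale der_mult tw_def sg.scale
          sg.add sg.uminus uminus sV.scale_right_distrib)
  qed simp
  then show ?case using step by (simp add: add scale sg.add sg.scale sg.uminus sV.scale_right_distrib mult.commute)
qed simp

end

definition dgen :: "gen \<Rightarrow> gen" where "dgen = (\<lambda>(i, j, m). (i, j, Suc m))"

lemma dgen_simp [simp]: "dgen (i, j, m) = (i, j, Suc m)"
  by (simp add: dgen_def)

lemma godd_dgen: "godd (dgen x) \<longleftrightarrow> \<not> godd x"
  by (cases x) (simp add: godd_def)

definition DD :: "sV \<Rightarrow> sV" where "DD = der True (\<lambda>x. gn (dgen x))"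

interpretation D: superder True "\<lambda>x. gn (dgen x)"
  rewrites "der True (\<lambda>x. gn (dgen x)) \<equiv> DD"
  by unfold_locales (auto simp: sg_gn psign_def godd_dgen DD_def)

lemma D_mult: "DD (a * b) = DD a * b + sg a * DD b"
  using D.der_mult by (simp add: tw_def)

lemma D_sg: "DD (sg a) = - sg (DD a)"
  using D.der_sg by simp

lemma D_pow_gn: "(DD ^^ m) (gn (i, j, k)) = gn (i, j, k + m)"
  by (induction m) simp_all

lemma sg_D_pow: "sg ((DD ^^ m) a) = (-1) ^ m *c (DD ^^ m) (sg a)"
proof (induction m)
  case (Suc m)
  then show ?case using D_sg[of "(DD ^^ m) a"] by (simp add: D.scale minus_equation_iff)
qed simp

lemma D_pow_linear:
  "(DD ^^ m) (a + b) = (DD ^^ m) a + (DD ^^ m) b" "(DD ^^ m) (c *c a) = c *c (DD ^^ m) a"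
  "(DD ^^ m) 0 = 0"
  by (induction m) (simp_all add: D.add D.scale)

context superhom
begin

lemma hm_D:
  assumes "\<And>x. \<phi> (dgen x) = DD (\<phi> x)"
  shows "hm \<phi> (DD a) = DD (hm \<phi> a)"
proof (induction a rule: sV_induct)
  case (step c u y)
  have "hm \<phi> (DD (wd u)) = DD (hm \<phi> (wd u))"
    by (induction u) (simp_all add: wd_Cons D_mult hm_mult add assms sg_gn scale parity)
  then show ?case using step by (simp add: add scale D.add D.scale)
qed simp

lemma hm_D_pow:
  assumes "\<And>x. \<phi> (dgen x) = DD (\<phi> x)"
  shows "hm \<phi> ((DD ^^ m) a) = (DD ^^ m) (hm \<phi> a)"
  by (induction m) (simp_all add: hm_D[OF assms])

end

text \<open>The commutator of an even derivation with D is again a derivation, so it vanishes once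
  it vanishes on letters. Evenness makes the twist in the rule for D agree on a letter and on its
  image.\<close>

lemma even_der_D:
  assumes "superder False \<phi>" "\<And>x. \<phi> (dgen x) = DD (\<phi> x)"
  shows "der False \<phi> (DD a) = DD (der False \<phi> a)"
proof -
  interpret superder False \<phi> by fact
  have mult: "der False \<phi> (a * b) = der False \<phi> a * b + a * der False \<phi> b" for a b
    using der_mult by (simp add: tw_def)
  show ?thesis
  proof (induction a rule: sV_induct)
    case (step c u y)
    have "der False \<phi> (DD (wd u)) = DD (der False \<phi> (wd u))"
    proof (induction u)
      case (Cons x u)
      then show ?case using parity[of x]
        by (simp add: wd_Cons D_mult mult add assms sg_gn scale D.add
            sV.scale_right_distrib)
    qed simp
    then show ?case using step by (simp add: add scale D.add D.scale)
  qed simp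
qed

section \<open>Subalgebras generated by sets of symbols\<close>

definition alg :: "gen set \<Rightarrow> sV set" where
  "alg G = {x. \<forall>u. coef x u \<noteq> 0 \<longrightarrow> set u \<subseteq> G}"

lemma alg_closed:
  "0 \<in> alg G" "x \<in> alg G \<Longrightarrow> y \<in> alg G \<Longrightarrow> x + y \<in> alg G" "x \<in> alg G \<Longrightarrow> c *c x \<in> alg G"
  by (force simp: alg_def)+

lemma alg_sum: "(\<And>a. a \<in> A \<Longrightarrow> f a \<in> alg G) \<Longrightarrow> sum f A \<in> alg G"
  by (induction A rule: infinite_finite_induct) (auto intro: alg_closed)

lemma alg_wd: "set u \<subseteq> G \<Longrightarrow> wd u \<in> alg G"
  by (auto simp: alg_def coef_wd split: if_splits)

lemma alg_gn: "x \<in> G \<Longrightarrow> gn x \<in> alg G"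
  unfolding gn_def by (rule alg_wd) simp

lemma alg_one: "1 \<in> alg G"
  using alg_wd[of "[]"] by simp

lemma alg_uminus: "x \<in> alg G \<Longrightarrow> - x \<in> alg G"
  using alg_closed(3)[of x G "-1"] by simp

lemma alg_diff: "x \<in> alg G \<Longrightarrow> y \<in> alg G \<Longrightarrow> x - y \<in> alg G"
  using alg_closed(2)[of x G "- y"] alg_uminus by simp

lemma alg_induct [consumes 1, case_names zero step]:
  assumes "x \<in> alg G" "P 0"
    and "\<And>c u y. monom u \<Longrightarrow> set u \<subseteq> G \<Longrightarrow> y \<in> alg G \<Longrightarrow> P y \<Longrightarrow> P (c *c wd u + y)"
  shows "P x"
proof -
  have "P (\<Sum>u\<in>S. coef x u *c mon u) \<and> (\<Sum>u\<in>S. coef x u *c mon u) \<in> alg G"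
    if "finite S" "S \<subseteq> supp (coef x)" for S
    using that
  proof (induction S)
    case (insert u S)
    then have "monom u" using monom_supp_coef by blast
    moreover have "set u \<subseteq> G" using insert.prems assms(1) by (auto simp: alg_def supp_def)
    ultimately show ?case using insert assms(3)[of u]
      by (simp add: mon_wd alg_closed alg_wd)
  qed (use assms in \<open>simp add: alg_closed\<close>)
  from this[of "supp (coef x)"] show ?thesis by (simp flip: sV_expand)
qed

lemma alg_mult:
  assumes "x \<in> alg G" "y \<in> alg G"
  shows "x * y \<in> alg G"
  using assms(1)
proof (induction x rule: alg_induct)
  case (step c u z)
  have "wd u * y \<in> alg G" using assms(2)
    by (induction y rule: alg_induct)
      (use step in \<open>simp_all add: algebra_simps alg_closed alg_wd flip: wd_append\<close>)
  then show ?case using step by (simp add: algebra_simps alg_closed)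
qed (simp add: alg_closed)

lemma slinear_alg:
  assumes "slinear f" "x \<in> alg G" "\<And>u. monom u \<Longrightarrow> set u \<subseteq> G \<Longrightarrow> f (wd u) \<in> alg H"
  shows "f x \<in> alg H"
  using assms(2)
proof (induction x rule: alg_induct)
  case zero then show ?case using slinear.zero[OF assms(1)] by (simp add: alg_closed)
next
  case (step c u y)
  then show ?case using slinear.add[OF assms(1)] slinear.scale[OF assms(1)] assms(3)[of u]
    by (simp add: alg_closed)
qed

lemma alg_prod_list: "(\<And>x. x \<in> set xs \<Longrightarrow> x \<in> alg G) \<Longrightarrow> prod_list xs \<in> alg G"
  by (induction xs) (auto intro: alg_one alg_mult)

lemma sg_alg: "x \<in> alg G \<Longrightarrow> sg x \<in> alg G"
  by (rule slinear_alg[OF sg.slinear_axioms]) (auto simp: sg_wd intro: alg_closed alg_wd)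

lemma (in superhom) hm_alg:
  assumes "x \<in> alg G" "\<And>g. g \<in> G \<Longrightarrow> \<phi> g \<in> alg H"
  shows "hm \<phi> x \<in> alg H"
  using slinear_axioms assms(1)
proof (rule slinear_alg)
  fix u assume "set u \<subseteq> G"
  then have "\<And>y. y \<in> set (map \<phi> u) \<Longrightarrow> y \<in> alg H"
    using assms(2) unfolding set_map by blast
  then show "hm \<phi> (wd u) \<in> alg H" unfolding hm_wd by (rule alg_prod_list)
qed

lemma (in superhom) hm_id:
  assumes "x \<in> alg G" "\<And>g. g \<in> G \<Longrightarrow> \<phi> g = gn g"
  shows "hm \<phi> x = x"
  using assms(1)
proof (induction x rule: alg_induct)
  case (step c u y)
  have "map \<phi> u = map gn u" using step(2) assms(2) by (intro map_cong) (blast, metis subsetD)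
  then have "hm \<phi> (wd u) = wd u" unfolding hm_wd by (simp add: wd_prod_list del: map_eq_conv)
  then show ?case using step by (simp add: add scale)
qed simp

lemma (in superder) der_alg:
  assumes "x \<in> alg G" "\<And>g. g \<in> G \<Longrightarrow> \<phi> g \<in> alg H" "G \<subseteq> H"
  shows "der t \<phi> x \<in> alg H"
  using slinear_axioms assms(1)
proof (rule slinear_alg)
  fix u assume "set u \<subseteq> G"
  then have "derw t \<phi> u \<in> alg H"
  proof (induction u)
    case (Cons x u)
    moreover have "tw t (gn x) \<in> alg H" using Cons assms(3) by (auto simp: tw_def intro!: sg_alg alg_gn)
    moreover have "wd u \<in> alg H" using Cons assms(3) by (intro alg_wd) auto
    moreover have "\<phi> x \<in> alg H" using Cons.prems by (intro assms(2)) simp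
    ultimately show ?case by (simp add: alg_closed alg_mult)
  qed (simp add: alg_closed)
  then show "der t \<phi> (wd u) \<in> alg H" by (simp add: der_wd)
qed

lemma D_alg: "x \<in> alg G \<Longrightarrow> (\<And>g. g \<in> G \<Longrightarrow> dgen g \<in> G) \<Longrightarrow> DD x \<in> alg G"
  by (rule D.der_alg) (auto intro: alg_gn)

lemma D_pow_alg: "x \<in> alg G \<Longrightarrow> (\<And>g. g \<in> G \<Longrightarrow> dgen g \<in> G) \<Longrightarrow> (DD ^^ m) x \<in> alg G"
  by (induction m) (auto intro: D_alg)

section \<open>Comparison with the raw functions, and reading off coefficients\<close>

lemma valid_alg: "valid G godd (coef x) \<longleftrightarrow> x \<in> alg G"
  using valid_coef[of x] by (auto simp: valid_def alg_def supp_def)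

lemma valid_imp_coef:
  assumes "valid G godd F"
  obtains x where "x \<in> alg G" "F = coef x"
proof -
  have "valid UNIV godd F" using assms by (auto simp: valid_def)
  then have "coef (Abs_sV F) = F" by (simp add: Abs_sV_inverse)
  then show ?thesis using that[of "Abs_sV F"] assms by (metis valid_alg)
qed

lemma coef_D: "vD (coef x) = coef (DD x)"
proof -
  have *: "sder_mono godd dgen u = coef (\<Sum>i<length u. wsign (take i u) *c wd (u[i := dgen (u ! i)]))"
    for u by (simp add: sder_mono_def coef_wd_sprod wsign_def fun_eq_iff)
  have "(\<Sum>i<length u. wsign (take i u) *c wd (u[i := dgen (u ! i)])) = derw True (\<lambda>x. gn (dgen x)) u" for u
  proof (induction u)
    case (Cons x u)
    have "(\<Sum>i<length (x # u). wsign (take i (x # u)) *c wd ((x # u)[i := dgen ((x # u) ! i)])) =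
      wd (dgen x # u) + psign x *c (gn x * (\<Sum>i<length u. wsign (take i u) *c wd (u[i := dgen (u ! i)])))"
      unfolding list.size add_0_right add_Suc_right sum.lessThan_Suc_shift
      by (simp add: wd_Cons sV.scale_sum_right sum_distrib_left)
    also have "\<dots> = derw True (\<lambda>x. gn (dgen x)) (x # u)"
      unfolding Cons by (simp add: wd_Cons tw_def sg_gn)
    finally show ?case .
  qed simp
  then have "sder_mono godd (\<lambda>(i, j, m). (i, j, Suc m)) u = coef (derw True (\<lambda>x. gn (dgen x)) u)" for u
    using *[of u] by (simp add: dgen_def)
  then show ?thesis unfolding vD_def sder_def coef_lin DD_def der_def by metis
qed

lemma coef_D_pow: "(vD ^^ m) (coef x) = coef ((DD ^^ m) x)"
  by (induction m) (simp_all add: coef_D)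

text \<open>A letter below all letters of G can be put in front of a standard word without
  disturbing the order, so multiplication by it merely prepends it. The set S holds all such small
  letters that compete with each other.\<close>

lemma coef_gn_mult:
  assumes "q \<in> alg G" "\<And>h. h \<in> G \<Longrightarrow> g < h" "g0 \<in> S" "g \<in> S" "\<And>h s. h \<in> G \<Longrightarrow> s \<in> S \<Longrightarrow> s < h"
    "set u \<subseteq> G"
  shows "coef (gn g0 * q) (g # u) = (if g0 = g then coef q u else 0)"
  using assms(1)
proof (induction q rule: alg_induct)
  case (step c v y)
  have "coef (gn g0 * wd v) (g # u) = (if g0 = g then coef (wd v) u else 0)"
  proof -
    have "monom (g0 # v)"
    proof -
      have "g0 < h" if "h \<in> set v" for h using assms(3,5) step that by blast
      then show ?thesis using step(1)
        by (auto simp: is_mono_def count_list_0_iff less_le)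
    qed
    then have "coef (wd (g0 # v)) (g # u) = (if g # u = g0 # v then 1 else 0)"
      by (simp only: coef_wd_mono)
    then show ?thesis using step(1) by (auto simp: wd_Cons coef_wd_mono)
  qed
  then show ?case using step by (simp add: algebra_simps)
qed simp

section \<open>Reduction modulo the ideal\<close>

text \<open>Distinct letters below all of G are independent over the subalgebra on G: the words
  beginning with \<open>g k\<close> see no summand except the k-th.\<close>

lemma sum_extract:
  assumes "finite A" "inj_on g A" "\<And>k. k \<in> A \<Longrightarrow> Q k \<in> alg G"
    "\<And>k h. k \<in> A \<Longrightarrow> h \<in> G \<Longrightarrow> g k < h" "(\<Sum>k\<in>A. gn (g k) * Q k) = 0" "k \<in> A"
  shows "Q k = 0"
proof (rule sV_eqI)
  fix u
  show "coef (Q k) u = coef 0 u"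
  proof (cases "set u \<subseteq> G")
    case True
    have "coef (\<Sum>k'\<in>A. gn (g k') * Q k') (g k # u) = (\<Sum>k'\<in>A. if k' = k then coef (Q k) u else 0)"
      unfolding coef_sum
    proof (rule sum.cong)
      fix k' assume k': "k' \<in> A"
      have "coef (gn (g k') * Q k') (g k # u) = (if g k' = g k then coef (Q k') u else 0)"
        by (rule coef_gn_mult[where G = G and S = "g ` A"]) (use assms k' True in auto)
      then show "coef (gn (g k') * Q k') (g k # u) = (if k' = k then coef (Q k) u else 0)"
        using assms(2,6) k' by (auto simp: inj_on_def)
    qed simp
    then show ?thesis using assms by simp
  next
    case False
    then show ?thesis using assms(3)[OF assms(6)] by (auto simp: alg_def)
  qed
qed

text \<open>The quotient map modulo the ideal, with values in V(p): bar n goes to (f|n), which on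
  e_ij with i < j is nonzero only for j = i + 1 and there equals str(e_jj) = (-1)^p(j). Derivatives
  of this constant vanish, hence the test m = 0. Letters with first index 0 are fixed so that
  auxiliary symbols pass through.\<close>

definition rhog :: "gen \<Rightarrow> sV" where
  "rhog x = (case x of (i, j, m) \<Rightarrow> if i = 0 \<or> j \<le> i then gn x
     else if m = 0 \<and> j = Suc i then (-1) ^ pp j *c 1 else 0)"

abbreviation rho :: "sV \<Rightarrow> sV" where "rho \<equiv> hm rhog"

text \<open>A nonzero scalar is an admissible image of bar e_{i,i+1} because this letter is even:
  p(i) and p(i+1) differ and the bar reverses parity.\<close>

interpretation rho: superhom rhog
proof
  fix x :: gen
  show "sg (rhog x) = psign x *c rhog x"
    by (cases x) (auto simp: rhog_def sg_gn sg.scale psign_def godd_def pp_def)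
qed

lemma rhog_dgen: "rhog (dgen x) = DD (rhog x)"
  by (cases x) (auto simp: rhog_def D.scale)

lemmas rho_D = rho.hm_D[OF rhog_dgen]
lemma Iset_pos: "i \<in> Iset n \<Longrightarrow> 0 < i"
  by (simp add: Iset_def)

lemma rho_alg: "x \<in> alg (gens n) \<Longrightarrow> rho x \<in> alg (pgens n)"
  by (erule rho.hm_alg)
    (auto simp: rhog_def gens_def pgens_def intro!: alg_gn alg_closed alg_one dest: Iset_pos)

lemma rho_id: "x \<in> alg (pgens n) \<Longrightarrow> rho x = x"
  by (erule rho.hm_id) (auto simp: rhog_def pgens_def)

lemma dgen_gens: "g \<in> gens n \<Longrightarrow> dgen g \<in> gens n"
  and dgen_pgens: "g \<in> pgens n \<Longrightarrow> dgen g \<in> pgens n"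
  by (auto simp: gens_def pgens_def)

lemma alg_mono: "G \<subseteq> H \<Longrightarrow> x \<in> alg G \<Longrightarrow> x \<in> alg H"
  by (auto simp: alg_def)

lemma pgens_alg_gens: "x \<in> alg (pgens n) \<Longrightarrow> x \<in> alg (gens n)"
  by (erule alg_mono[rotated]) (auto simp: gens_def pgens_def)

lemma Vg_iff: "F \<in> Vg n \<longleftrightarrow> (\<exists>x\<in>alg (gens n). F = coef x)"
  unfolding Vg_def by (auto elim: valid_imp_coef simp: valid_alg)

lemma Vp_iff: "F \<in> Vp n \<longleftrightarrow> (\<exists>x\<in>alg (pgens n). F = coef x)"
  unfolding Vp_def by (auto elim: valid_imp_coef simp: valid_alg)

lemmas raw = coef_raw coef_D coef_mult[symmetric] vmult_def coef_one[symmetric] coef_gn[symmetric]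
  ebar_def

definition bX :: "nat \<Rightarrow> (nat \<Rightarrow> nat \<Rightarrow> complex) \<Rightarrow> sV" where
  "bX n X = (\<Sum>i\<in>Iset n. \<Sum>j\<in>Iset n. X i j *c gn (i, j, 0))"

lemma barof_bX: "barof n X = coef (bX n X)"
  by (simp add: barof_def bX_def ebar_def coef_gn fun_eq_iff)

lemma bX_alg: "bX n X \<in> alg (gens n)"
  unfolding bX_def by (intro alg_sum alg_closed alg_gn) (auto simp: gens_def)

lemma scale_sum_one: "(\<Sum>a\<in>A. f a *c (1::sV)) = (\<Sum>a\<in>A. f a) *c 1"
  by (simp add: sV.scale_sum_left)

lemma rho_bX:
  assumes "X \<in> nmats n"
  shows "rho (bX n X) = str_form n (fmat n) X *c 1"
proof -
  have *: "X k i *c rhog (k, i, 0) = ((-1) ^ pp i * (fmat n i k * X k i)) *c 1"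
    if "i \<in> Iset n" "k \<in> Iset n" for i k
  proof (cases "k < i")
    case True
    then show ?thesis using that by (auto simp: rhog_def fmat_def Iset_def mult.commute)
  next
    case False
    then have "X k i = 0" using assms by (auto simp: nmats_def)
    then show ?thesis by simp
  qed
  have "rho (bX n X) = (\<Sum>k\<in>Iset n. \<Sum>i\<in>Iset n. X k i *c rhog (k, i, 0))"
    by (simp add: bX_def rho.sum rho.scale)
  also have "\<dots> = (\<Sum>k\<in>Iset n. \<Sum>i\<in>Iset n. ((-1) ^ pp i * (fmat n i k * X k i)) *c 1)"
    by (intro sum.cong refl) (simp add: *)
  also have "\<dots> = (\<Sum>k\<in>Iset n. \<Sum>i\<in>Iset n. ((-1) ^ pp i * (fmat n i k * X k i))) *c 1"
    by (simp add: scale_sum_one)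
  also have "(\<Sum>k\<in>Iset n. \<Sum>i\<in>Iset n. ((-1) ^ pp i * (fmat n i k * X k i))) = str_form n (fmat n) X"
    unfolding str_form_def by (subst sum.swap) (simp add: sum_distrib_left)
  finally show ?thesis .
qed

definition Emat :: "nat \<Rightarrow> nat \<Rightarrow> nat \<Rightarrow> nat \<Rightarrow> complex" where
  "Emat a b i j = (if i = a \<and> j = b then 1 else 0)"

lemma Emat_nmats: "a \<in> Iset n \<Longrightarrow> b \<in> Iset n \<Longrightarrow> a < b \<Longrightarrow> Emat a b \<in> nmats n"
  by (auto simp: nmats_def Emat_def)

lemma finite_Iset [simp]: "finite (Iset n)"
  by (simp add: Iset_def)

lemma sum_Emat:
  assumes "a \<in> Iset n" "b \<in> Iset n"
  shows "(\<Sum>i\<in>Iset n. \<Sum>j\<in>Iset n. Emat a b i j *c f i j) = f a b"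
proof -
  have "(\<Sum>i\<in>Iset n. \<Sum>j\<in>Iset n. Emat a b i j *c f i j) =
      (\<Sum>i\<in>Iset n. if i = a then f a b else 0)"
  proof (rule sum.cong)
    fix i assume "i \<in> Iset n"
    have "(\<Sum>j\<in>Iset n. Emat a b i j *c f i j) = (\<Sum>j\<in>Iset n. if j = b then (if i = a then f a b else 0) else 0)"
      by (rule sum.cong) (auto simp: Emat_def)
    then show "(\<Sum>j\<in>Iset n. Emat a b i j *c f i j) = (if i = a then f a b else 0)"
      using assms by simp
  qed simp
  then show ?thesis using assms by simp
qed

text \<open>The kernel of \<open>rho\<close> on V(g) is itself one of the sets in the intersection,
  which gives one direction. For the other, y - \<open>rho y\<close> lies in every such set: this
  holds for letters, extends to words, and then linearly to y.\<close>

lemma Jideal_iff: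
  assumes "y \<in> alg (gens n)"
  shows "coef y \<in> Jideal n \<longleftrightarrow> rho y = 0"
proof
  assume y: "coef y \<in> Jideal n"
  let ?S = "coef ` {x \<in> alg (gens n). rho x = 0}"
  have "?S \<in> {S. szero \<in> S \<and> (\<forall>x\<in>S. \<forall>y\<in>S. sadd x y \<in> S) \<and>
      (\<forall>x\<in>S. \<forall>r\<in>Vg n. vmult r x \<in> S \<and> vmult x r \<in> S) \<and> (\<forall>x\<in>S. vD x \<in> S) \<and>
      (\<forall>X\<in>nmats n. sadd (barof n X) (sscale (- str_form n (fmat n) X) sone) \<in> S)}"
  proof (intro CollectI conjI ballI)
    show "szero \<in> ?S" unfolding raw by (intro imageI) (simp add: alg_closed)
  next
    fix x y assume "x \<in> ?S" "y \<in> ?S"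
    then show "sadd x y \<in> ?S" by (auto simp: raw rho.add alg_closed intro!: imageI)
  next
    fix x r assume "x \<in> ?S" "r \<in> Vg n"
    then show "vmult r x \<in> ?S" "vmult x r \<in> ?S"
      by (auto simp: raw Vg_iff rho.hm_mult intro!: imageI alg_mult)
  next
    fix x assume "x \<in> ?S"
    then show "vD x \<in> ?S" by (auto simp: raw rho_D intro!: imageI D_alg dgen_gens)
  next
    fix X assume "X \<in> nmats n"
    then show "sadd (barof n X) (sscale (- str_form n (fmat n) X) sone) \<in> ?S"
      unfolding raw barof_bX
      by (intro imageI) (simp add: alg_closed alg_diff bX_alg alg_one rho.add rho_bX rho.uminus rho.scale rho.diff)
  qed
  then have "coef y \<in> ?S" by (rule InterD[OF y[unfolded Jideal_def]])
  then show "rho y = 0" using coef_inject by auto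
next
  assume rho0: "rho y = 0"
  show "coef y \<in> Jideal n"
    unfolding Jideal_def
  proof (rule InterI, clarify)
    fix S
    assume S: "szero \<in> S" "\<forall>x\<in>S. \<forall>y\<in>S. sadd x y \<in> S"
      "\<forall>x\<in>S. \<forall>r\<in>Vg n. vmult r x \<in> S \<and> vmult x r \<in> S" "\<forall>x\<in>S. vD x \<in> S"
      "\<forall>X\<in>nmats n. sadd (barof n X) (sscale (- str_form n (fmat n) X) sone) \<in> S"
    define T where "T = {x. coef x \<in> S}"
    have r: "coef r \<in> Vg n" if "r \<in> alg (gens n)" for r using that Vg_iff by blast
    have T: "0 \<in> T" "x \<in> T \<Longrightarrow> x' \<in> T \<Longrightarrow> x + x' \<in> T"
      "x \<in> T \<Longrightarrow> r \<in> alg (gens n) \<Longrightarrow> r * x \<in> T"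
      "x \<in> T \<Longrightarrow> r \<in> alg (gens n) \<Longrightarrow> x * r \<in> T" "x \<in> T \<Longrightarrow> DD x \<in> T" for x x' r
      using S(1) S(2)[rule_format, of "coef x" "coef x'"] S(3)[rule_format, of "coef x" "coef r", OF _ r]
        S(4)[rule_format, of "coef x"]
      unfolding T_def raw by simp_all
    have Ts: "c *c x \<in> T" if "x \<in> T" for c x
      using T(3)[OF that, of "c *c 1"] by (simp add: alg_closed alg_one)
    \<comment> \<open>For m = 0 the difference is the defining generator belonging to a matrix unit;
      applying D raises m.\<close>
    have Tg: "gn g - rhog g \<in> T" if "g \<in> gens n" for g
    proof -
      obtain i j m where g: "g = (i, j, m)" by (cases g)
      have ij: "i \<in> Iset n" "j \<in> Iset n" using that by (auto simp: g gens_def)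
      have "gn (i, j, m) - rhog (i, j, m) \<in> T"
      proof (induction m)
        case 0
        show ?case
        proof (cases "i < j")
          case True
          let ?X = "Emat i j"
          have X: "?X \<in> nmats n" using True ij by (simp add: Emat_nmats)
          have b: "bX n ?X = gn (i, j, 0)" unfolding bX_def using ij by (rule sum_Emat)
          have "bX n ?X + (- str_form n (fmat n) ?X) *c 1 \<in> T"
            using S(5) X unfolding T_def by (simp add: raw barof_bX del: coef_simps)
          then show ?thesis using rho_bX[OF X] by (simp add: b)
        next
          case False
          then show ?thesis using T(1) by (simp add: rhog_def)
        qed
      next
        case (Suc m)
        then show ?case using T(5)[OF Suc] rhog_dgen[of "(i, j, m)"] by (simp add: D.diff)
      qed
      then show ?thesis by (simp add: g)
    qed
    have Tw: "wd u - rho (wd u) \<in> T" if "set u \<subseteq> gens n" for u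
      using that
    proof (induction u)
      case (Cons x u)
      \<comment> \<open>A difference of two products is exchanged one factor at a time, so each
        summand contains a factor already known to lie in the ideal.\<close>
      have "wd (x # u) - rho (wd (x # u)) =
          (gn x - rhog x) * wd u + rhog x * (wd u - rho (wd u))"
        by (simp add: wd_Cons rho.hm_mult algebra_simps)
      moreover have "rhog x \<in> alg (gens n)"
        using Cons.prems rho_alg[of "gn x" n] by (simp add: alg_gn pgens_alg_gens)
      ultimately show ?case using Cons Tg by (simp add: T alg_wd)
    qed (simp add: T)
    have "y - rho y \<in> T" using assms
    proof (induction y rule: alg_induct)
      case (step c u y)
      have "c *c wd u + y - rho (c *c wd u + y) = c *c (wd u - rho (wd u)) + (y - rho y)"
        by (simp add: rho.add rho.scale sV.scale_right_diff_distrib)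
      then show ?case using T(2)[OF Ts[OF Tw[OF step(2)]] step(4), of c] by (simp only:)
    qed (simp add: T)
    then show "coef y \<in> S" using rho0 by (simp add: T_def)
  qed
qed

section \<open>The bracket as an even derivation\<close>

text \<open>The extra symbols (0, 1, k) and (0, 2, k) serve as derivatives of a test field of parity
  p(e_ab); with it the odd bracket becomes an even derivation commuting with D.\<close>

definition ep :: "nat \<Rightarrow> nat \<Rightarrow> nat \<Rightarrow> sV" where
  "ep a b k = gn (0, 1 + glpar a b mod 2, k)"

lemma godd_ep: "godd (0, Suc (glpar a b mod 2), k) \<longleftrightarrow> odd (glpar a b + k)"
  by (auto simp: godd_def glpar_def pp_def)

lemma sg_ep: "sg (ep a b k) = (-1) ^ (glpar a b + k) *c ep a b k"
  by (simp add: ep_def sg_gn psign_def godd_ep)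

lemma D_ep: "DD (ep a b k) = ep a b (Suc k)"
  by (simp add: ep_def)

text \<open>The base bracket reduced by \<open>rhog\<close>, with 1 replaced by the test field and
  chi by its first derivative. The extra sign (-1)^p(e_ab) in the last summand is \<open>chs\<close>
  at 1.\<close>

definition dbase :: "nat \<Rightarrow> nat \<Rightarrow> nat \<Rightarrow> nat \<Rightarrow> sV" where
  "dbase a b k l = (-1) ^ (glpar a b * (glpar k l + 1)) *c (ep a b 0 *
       ((if b = k then rhog (a, l, 0) else 0) -
        (if a = l then (-1) ^ (glpar a b * glpar k l) *c rhog (k, b, 0) else 0)) )
     + (if b = k \<and> a = l then ((-1) ^ pp a * (-1) ^ glpar a b) *c ep a b 1 else 0)"

text \<open>The side condition singles out the letters of p. The auxiliary symbols with first index
  0 fail it, so the test field and the indeterminate used later are constants for the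
  derivation.\<close>

definition deltag :: "nat \<Rightarrow> nat \<Rightarrow> gen \<Rightarrow> sV" where
  "deltag a b x = (case x of (k, l, m) \<Rightarrow> if 1 \<le> l \<and> l \<le> k then (DD ^^ m) (dbase a b k l) else 0)"

abbreviation delta :: "nat \<Rightarrow> nat \<Rightarrow> sV \<Rightarrow> sV" where "delta a b \<equiv> der False (deltag a b)"

lemma sg_rhog: "sg (rhog x) = psign x *c rhog x"
  by (rule rho.parity)

lemma psign_gen: "psign (i, j, m) = (-1) ^ (pp i + pp j + 1 + m)"
  by (simp add: psign_def godd_def)

lemma sg_dbase: "sg (dbase a b k l) = psign (k, l, 0) *c dbase a b k l"
proof -
  have 1: "(-1::complex) ^ pp i * (-1) ^ pp i = 1" "(-1::complex) ^ pp i * ((-1) ^ pp i * x) = x" for i x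
    by (simp_all add: pp_def)
  show ?thesis
    by (auto simp: dbase_def sg.lin_simps sg_mult sg_ep sg_rhog psign_gen glpar_def power_add 1
        sV.scale_right_distrib algebra_simps)
qed

lemma D_pow_uminus: "(DD ^^ m) (- a) = - (DD ^^ m) a"
  by (induction m) (simp_all add: D.uminus)

interpretation delta: superder False "deltag a b" for a b
proof
  fix x :: gen
  show "sg (deltag a b x) = ((if False then -1 else 1) * psign x) *c deltag a b x"
    by (cases x) (auto simp: deltag_def sg_D_pow sg_dbase D_pow_linear D_pow_uminus psign_gen power_add mult_ac)
qed

lemma delta_mult: "delta a b (x * y) = delta a b x * y + x * delta a b y"
  using delta.der_mult by (simp add: tw_def)

lemma delta_D: "delta a b (DD x) = DD (delta a b x)"
  by (rule even_der_D) (auto intro: delta.superder_axioms simp: deltag_def)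

lemma delta_D_pow: "delta a b ((DD ^^ m) x) = (DD ^^ m) (delta a b x)"
  by (induction m) (simp_all add: delta_D)

text \<open>The signs make multiplication by D + chi (up to the sign of sesquilinearity) correspond to D
  when chi to the k is replaced by the k-th derivative of the test field.\<close>

primrec chs :: "nat \<Rightarrow> nat \<Rightarrow> complex" where
  "chs q 0 = 1"
| "chs q (Suc k) = (-1) ^ (q + k) * chs q k"

lemma chs_nz: "chs q k \<noteq> 0"
  by (induction k) auto

text \<open>The dictionary between polynomials in chi and elements containing the test field, with
  coefficients reduced modulo the ideal. Asking for the expansion at every large bound K lets two
  expansions be added without matching their degrees.\<close>

definition chrel :: "nat \<Rightarrow> nat \<Rightarrow> nat \<Rightarrow> CV \<Rightarrow> sV \<Rightarrow> bool" where
  "chrel n a b C x \<longleftrightarrow> (\<exists>P. (\<forall>k. C k = coef (P k) \<and> P k \<in> alg (gens n)) \<and>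
     (\<exists>N. \<forall>K\<ge>N. P K = 0 \<and> x = (\<Sum>k<K. chs (glpar a b) k *c (ep a b k * rho (P k)))))"

lemma chrelI:
  assumes "\<And>k. C k = coef (P k)" "\<And>k. P k \<in> alg (gens n)"
    "\<And>K. K \<ge> N \<Longrightarrow> P K = 0 \<and> x = (\<Sum>k<K. chs (glpar a b) k *c (ep a b k * rho (P k)))"
  shows "chrel n a b C x"
  unfolding chrel_def using assms by blast

lemma chrelE:
  assumes "chrel n a b C x"
  obtains P N where "\<And>k. C k = coef (P k)" "\<And>k. P k \<in> alg (gens n)"
    "\<And>K. K \<ge> N \<Longrightarrow> P K = 0" "\<And>K. K \<ge> N \<Longrightarrow> x = (\<Sum>k<K. chs (glpar a b) k *c (ep a b k * rho (P k)))"
  using assms unfolding chrel_def by blast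

lemma chrel_zero: "chrel n a b cvzero 0"
  by (rule chrelI[of _ "\<lambda>_. 0" _ 0]) (simp_all add: cvzero_def raw alg_closed)

lemma chrel_add:
  assumes "chrel n a b C x" "chrel n a b C' y"
  shows "chrel n a b (cvadd C C') (x + y)"
proof -
  obtain P N where P: "\<And>k. C k = coef (P k)" "\<And>k. P k \<in> alg (gens n)"
    "\<And>K. K \<ge> N \<Longrightarrow> P K = 0" "\<And>K. K \<ge> N \<Longrightarrow> x = (\<Sum>k<K. chs (glpar a b) k *c (ep a b k * rho (P k)))"
    by (rule chrelE[OF assms(1)]) (rule that)
  obtain P' N' where P': "\<And>k. C' k = coef (P' k)" "\<And>k. P' k \<in> alg (gens n)"
    "\<And>K. K \<ge> N' \<Longrightarrow> P' K = 0" "\<And>K. K \<ge> N' \<Longrightarrow> y = (\<Sum>k<K. chs (glpar a b) k *c (ep a b k * rho (P' k)))"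
    by (rule chrelE[OF assms(2)]) (rule that)
  show ?thesis
  proof (rule chrelI[of _ "\<lambda>k. P k + P' k" _ "max N N'"])
    fix K assume K: "K \<ge> max N N'"
    show "P K + P' K = 0 \<and> x + y = (\<Sum>k<K. chs (glpar a b) k *c (ep a b k * rho (P k + P' k)))"
      using P(3,4)[of K] P'(3,4)[of K] K
      by (simp add: rho.add distrib_left sV.scale_right_distrib sum.distrib)
  qed (simp_all add: cvadd_def P(1,2) P'(1,2) raw alg_closed)
qed

lemma chrel_scale:
  assumes "chrel n a b C x"
  shows "chrel n a b (cvscale c C) (c *c x)"
  using assms
proof (rule chrelE)
  fix P N
  assume P: "\<And>k. C k = coef (P k)" "\<And>k. P k \<in> alg (gens n)"
    "\<And>K. K \<ge> N \<Longrightarrow> P K = 0" "\<And>K. K \<ge> N \<Longrightarrow> x = (\<Sum>k<K. chs (glpar a b) k *c (ep a b k * rho (P k)))"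
  show ?thesis
  proof (rule chrelI[of _ "\<lambda>k. c *c P k" _ "N"])
    fix K assume K: "K \<ge> N"
    show "c *c P K = 0 \<and> c *c x = (\<Sum>k<K. chs (glpar a b) k *c (ep a b k * rho (c *c P k)))"
      using P(3,4)[of K] K by (simp add: rho.scale sV.scale_sum_right mult.commute)
  qed (simp_all add: cvscale_def P(1,2) raw alg_closed)
qed

text \<open>In (D + chi) applied to chi^k P, the term chi^(k+1) P carries the sign (-1)^k by the
  relation of D and chi. On the other side D differentiates the k-th derivative of the test field
  without sign and picks up (-1)^(q+k) when it passes it, where q is the parity of e_ab. The
  recursion for \<open>chs\<close> is the one that reconciles the two.\<close>

lemma chrel_D:
  assumes "chrel n a b C x"
  shows "chrel n a b (cvscale ((-1) ^ (glpar a b + 1 + 1)) (cvadd (cvD C) (cvchi C))) (DD x)"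
  using assms
proof (rule chrelE)
  let ?q = "glpar a b"
  fix P N
  assume P: "\<And>k. C k = coef (P k)" "\<And>k. P k \<in> alg (gens n)"
    "\<And>K. K \<ge> N \<Longrightarrow> P K = 0" "\<And>K. K \<ge> N \<Longrightarrow> x = (\<Sum>k<K. chs ?q k *c (ep a b k * rho (P k)))"
  define P' where "P' k = (-1) ^ ?q *c ((-1) ^ k *c DD (P k) +
    (case k of 0 \<Rightarrow> 0 | Suc k' \<Rightarrow> (-1) ^ k' *c P k'))" for k
  show ?thesis
  proof (rule chrelI[of _ P' _ "Suc N"])
    fix k
    show "cvscale ((-1) ^ (?q + 1 + 1)) (cvadd (cvD C) (cvchi C)) k = coef (P' k)"
    proof (cases k)
      case 0
      then show ?thesis by (simp add: cvscale_def cvadd_def cvD_def cvchi_def P(1) raw P'_def)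
    next
      case (Suc k')
      \<comment> \<open>For odd k' the -2 from D chi = - chi D - 2 chi^2 and the 1 from
        multiplication by chi add up to -1; for even k' only the 1 is present.\<close>
      have "(if even k' then 0 else - 2 *c P k') + P k' = (-1) ^ k' *c P k'"
        using sV.scale_left_distrib[of "-2" 1 "P k'"] by simp
      then have *: "((-1) ^ Suc k' *c DD (P (Suc k')) + (if even k' then 0 else - 2 *c P k')) + P k' =
        (-1) ^ Suc k' *c DD (P (Suc k')) + (-1) ^ k' *c P k'"
        by (simp only: add.assoc)
      have "cvscale ((-1) ^ (?q + 1 + 1)) (cvadd (cvD C) (cvchi C)) k = coef ((-1) ^ (?q + 1 + 1) *c
          (((-1) ^ Suc k' *c DD (P (Suc k')) + (if even k' then 0 else - 2 *c P k')) + P k'))"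
        using Suc by (simp add: cvscale_def cvadd_def cvD_def cvchi_def P(1) raw)
      also have "\<dots> = coef (P' k)" unfolding * using Suc by (simp add: P'_def)
      finally show ?thesis .
    qed
    show "P' k \<in> alg (gens n)"
      using P(2) by (auto simp: P'_def alg_closed D_alg dgen_gens split: nat.split)
  next
    fix K assume "K \<ge> Suc N"
    then obtain K' where K: "K = Suc K'" "K' \<ge> N" by (cases K) auto
    have 0: "P K' = 0" "P K = 0" using P(3) K by auto
    have cs: "chs ?q k = chs ?q (Suc k) * (-1) ^ (?q + k)" for k
      by (cases "even (?q + k)") simp_all
    have "DD x = (\<Sum>k<K'. DD (chs ?q k *c (ep a b k * rho (P k))))"
      using P(4)[OF K(2)] by (simp add: D.sum)
    also have "\<dots> = (\<Sum>k<K'. chs ?q (Suc k) *c ((-1) ^ (?q + k) *c (ep a b (Suc k) * rho (P k)))) +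
        (\<Sum>k<K'. chs ?q k *c ((-1) ^ (?q + k) *c (ep a b k * rho (DD (P k)))))"
      by (simp add: D.scale D_mult D_ep sg_ep rho_D sum.distrib sV.scale_right_distrib
          flip: cs del: chs.simps)
    also have "\<dots> = (\<Sum>k<K. chs ?q k *c (ep a b k * rho (P' k)))"
    proof -
      have "(\<Sum>k<K. chs ?q k *c (ep a b k * rho (P' k))) =
        (\<Sum>k<K. chs ?q k *c (ep a b k * ((-1) ^ (?q + k) *c rho (DD (P k))))) +
        (\<Sum>k<K. chs ?q k *c (ep a b k * (case k of 0 \<Rightarrow> 0 | Suc k' \<Rightarrow> (-1) ^ (?q + k') *c rho (P k'))))"
        unfolding sum.distrib[symmetric]
      proof (rule sum.cong[OF refl])
        fix k
        have "rho (P' k) = (-1) ^ (?q + k) *c rho (DD (P k)) +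
           (case k of 0 \<Rightarrow> 0 | Suc k' \<Rightarrow> (-1) ^ (?q + k') *c rho (P k'))"
          by (cases k) (simp_all add: P'_def rho.lin_simps power_add sV.scale_right_distrib
              sV.scale_right_diff_distrib)
        then show "chs ?q k *c (ep a b k * rho (P' k)) =
          chs ?q k *c (ep a b k * ((-1) ^ (?q + k) *c rho (DD (P k)))) +
          chs ?q k *c (ep a b k * (case k of 0 \<Rightarrow> 0 | Suc k' \<Rightarrow> (-1) ^ (?q + k') *c rho (P k')))"
          by (simp add: distrib_left sV.scale_right_distrib)
      qed
      also have "(\<Sum>k<K. chs ?q k *c (ep a b k * ((-1) ^ (?q + k) *c rho (DD (P k))))) =
        (\<Sum>k<K'. chs ?q k *c ((-1) ^ (?q + k) *c (ep a b k * rho (DD (P k)))))"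
        using 0 by (simp add: K)
      also have "(\<Sum>k<K. chs ?q k *c (ep a b k * (case k of 0 \<Rightarrow> 0 | Suc k' \<Rightarrow> (-1) ^ (?q + k') *c rho (P k')))) =
        (\<Sum>k<K'. chs ?q (Suc k) *c ((-1) ^ (?q + k) *c (ep a b (Suc k) * rho (P k))))"
        unfolding K sum.lessThan_Suc_shift by (simp del: chs.simps)
      finally show ?thesis by (simp add: add.commute)
    qed
    finally show "P' K = 0 \<and> DD x = (\<Sum>k<K. chs ?q k *c (ep a b k * rho (P' k)))"
      using 0 by (simp add: P'_def K)
  qed
qed

text \<open>The sign of the Leibniz rule and the sign of y passing chi^k combine to
  (-1)^(p(y)(q+k)), with q the parity of e_ab. This is exactly the sign of y passing the k-th
  derivative of the test field, so no sign is left over.\<close>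

lemma chrel_lmult:
  assumes "chrel n a b C x" "y \<in> pgens n"
  shows "chrel n a b (cvscale ((-1) ^ ((glpar a b + 1 + 1) * (if godd y then 1 else 0)))
     (cvlmult (godd y) (sgen y) C)) (gn y * x)"
  using assms(1)
proof (rule chrelE)
  let ?q = "glpar a b"
  let ?s = "\<lambda>k. if godd y then (-1) ^ (?q + k) else (1::complex)"
  fix P N
  assume P: "\<And>k. C k = coef (P k)" "\<And>k. P k \<in> alg (gens n)"
    "\<And>K. K \<ge> N \<Longrightarrow> P K = 0" "\<And>K. K \<ge> N \<Longrightarrow> x = (\<Sum>k<K. chs ?q k *c (ep a b k * rho (P k)))"
  have y: "y \<in> gens n" "rhog y = gn y"
    using assms(2) by (auto simp: gens_def pgens_def rhog_def)
  have comm: "ep a b k * gn y = ?s k *c (gn y * ep a b k)" for k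
    using comm_gn[of "ep a b k" y] by (simp add: sg_ep)
  have comm': "ep a b k * (gn y * z) = ?s k *c (gn y * (ep a b k * z))" for k z
    by (simp add: comm flip: mult.assoc)
  have ss: "?s k * ?s k = 1" for k
    by (simp flip: power_mult_distrib)
  show ?thesis
  proof (rule chrelI[of _ "\<lambda>k. ?s k *c (gn y * P k)" _ N])
    fix k
    show "cvscale ((-1) ^ ((?q + 1 + 1) * (if godd y then 1 else 0)))
     (cvlmult (godd y) (sgen y) C) k = coef (?s k *c (gn y * P k))"
      by (auto simp: cvscale_def cvlmult_def P(1) raw power_add)
    show "?s k *c (gn y * P k) \<in> alg (gens n)"
      using P(2) y by (intro alg_closed alg_mult alg_gn)
  next
    fix K assume K: "K \<ge> N"
    show "?s K *c (gn y * P K) = 0 \<and>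
      gn y * x = (\<Sum>k<K. chs ?q k *c (ep a b k * rho (?s k *c (gn y * P k))))"
      using P(3,4)[OF K] by (simp add: rho.scale rho.hm_mult y comm' sum_distrib_left ss)
  qed
qed

lemma chrel_rmult:
  assumes "chrel n a b C x" "z \<in> alg (pgens n)"
  shows "chrel n a b (cvrmult C (coef z)) (x * z)"
  using assms(1)
proof (rule chrelE)
  let ?q = "glpar a b"
  fix P N
  assume P: "\<And>k. C k = coef (P k)" "\<And>k. P k \<in> alg (gens n)"
    "\<And>K. K \<ge> N \<Longrightarrow> P K = 0" "\<And>K. K \<ge> N \<Longrightarrow> x = (\<Sum>k<K. chs ?q k *c (ep a b k * rho (P k)))"
  show ?thesis
  proof (rule chrelI[of _ "\<lambda>k. P k * z" _ N])
    fix K assume K: "K \<ge> N"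
    show "P K * z = 0 \<and> x * z = (\<Sum>k<K. chs ?q k *c (ep a b k * rho (P k * z)))"
      using P(3)[OF K] P(4)[OF K] rho_id[OF assms(2)]
      by (simp add: rho.hm_mult sum_distrib_right mult.assoc)
  qed (use P assms(2) in \<open>auto simp: cvrmult_def raw intro: alg_mult pgens_alg_gens\<close>)
qed

lemma chrel_base:
  assumes "a \<in> Iset n" "b \<in> Iset n" "k \<in> Iset n" "l \<in> Iset n"
  shows "chrel n a b (brk_base a b k l) (dbase a b k l)"
proof -
  let ?q = "glpar a b"
  define P where "P d = (if d = 0 then (-1) ^ (?q * (glpar k l + 1)) *c
      ((if b = k then gn (a, l, 0) else 0) -
       (if a = l then (-1) ^ (?q * glpar k l) *c gn (k, b, 0) else 0))
    else if d = 1 \<and> b = k \<and> a = l then (-1) ^ pp a *c 1 else 0)" for d :: nat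
  show ?thesis
  proof (rule chrelI[of _ P _ 2])
    show "brk_base a b k l d = coef (P d)" for d
      by (auto simp: brk_base_def P_def raw)
    show "P d \<in> alg (gens n)" for d
      using assms by (auto simp: P_def gens_def intro!: alg_closed alg_diff alg_uminus alg_gn alg_one)
    fix K :: nat assume K: "K \<ge> 2"
    have "(\<Sum>k<K. chs ?q k *c (ep a b k * rho (P k))) = (\<Sum>k\<in>{0,1}. chs ?q k *c (ep a b k * rho (P k)))"
      by (rule sum.mono_neutral_right) (use K in \<open>auto simp: P_def\<close>)
    also have "\<dots> = dbase a b k l"
      by (auto simp: P_def dbase_def rho.lin_simps mult.commute)
    finally show "P K = 0 \<and> dbase a b k l = (\<Sum>k<K. chs ?q k *c (ep a b k * rho (P k)))"
      using K by (simp add: P_def)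
  qed
qed

lemma chrel_gen:
  assumes "a \<in> Iset n" "b \<in> Iset n" "y \<in> pgens n"
  shows "chrel n a b (brk_gen a b y) (deltag a b y)"
proof -
  obtain k l m where y: "y = (k, l, m)" by (cases y)
  have kl: "k \<in> Iset n" "l \<in> Iset n" "l \<le> k" using assms(3) by (auto simp: y pgens_def)
  then have "1 \<le> l" by (simp add: Iset_def)
  have "chrel n a b (brk_gen a b (k, l, m)) ((DD ^^ m) (dbase a b k l))"
  proof (induction m)
    case 0
    then show ?case using chrel_base assms kl by (simp add: brk_gen_def)
  next
    case (Suc m)
    then show ?case using chrel_D[OF Suc] by (simp add: brk_gen_def)
  qed
  then show ?thesis using kl \<open>1 \<le> l\<close> by (simp add: y deltag_def)
qed

lemma chrel_mono:
  assumes "a \<in> Iset n" "b \<in> Iset n" "set u \<subseteq> pgens n"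
  shows "chrel n a b (brk_mono a b u) (delta a b (wd u))"
  using assms(3)
proof (induction u)
  case Nil
  then show ?case using chrel_zero by simp
next
  case (Cons y u)
  have y: "y \<in> pgens n" and u: "wd u \<in> alg (pgens n)" using Cons.prems by (auto intro: alg_wd)
  have IH: "chrel n a b (brk_mono a b u) (delta a b (wd u))" using Cons by simp
  have "chrel n a b (brk_mono a b (y # u)) (gn y * delta a b (wd u) + deltag a b y * wd u)"
    unfolding brk_mono.simps coef_wd_sprod
    by (intro chrel_add chrel_lmult chrel_rmult chrel_gen IH y u assms)
  then show ?case by (simp add: wd_Cons delta_mult add.commute)
qed

lemma chrel_brk:
  assumes "a \<in> Iset n" "b \<in> Iset n" "x \<in> alg (pgens n)"
  shows "chrel n a b (brk a b (coef x)) (delta a b x)"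
proof -
  have *: "chrel n a b (\<lambda>k w. \<Sum>u\<in>S. coef x u * brk_mono a b u k w) (\<Sum>u\<in>S. coef x u *c delta a b (wd u))"
    if "finite S" "S \<subseteq> supp (coef x)" for S
    using that
  proof (induction S)
    case empty
    then show ?case using chrel_zero by (simp add: cvzero_def szero_def)
  next
    case (insert u S)
    have "set u \<subseteq> pgens n" using assms(3) insert.prems by (auto simp: alg_def supp_def)
    then have "chrel n a b (cvadd (cvscale (coef x u) (brk_mono a b u))
        (\<lambda>k w. \<Sum>u\<in>S. coef x u * brk_mono a b u k w))
      (coef x u *c delta a b (wd u) + (\<Sum>u\<in>S. coef x u *c delta a b (wd u)))"
      using insert assms by (intro chrel_add chrel_scale chrel_mono) auto
    then show ?case using insert by (simp add: cvadd_def cvscale_def sadd_def sscale_def)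
  qed
  have "(\<Sum>u\<in>supp (coef x). coef x u *c delta a b (wd u)) =
      delta a b (\<Sum>u\<in>supp (coef x). coef x u *c wd u)"
    by (simp add: delta.lin_simps)
  also have "(\<Sum>u\<in>supp (coef x). coef x u *c wd u) = (\<Sum>u\<in>supp (coef x). coef x u *c mon u)"
    by (rule sum.cong) (auto simp: mon_wd dest: monom_supp_coef)
  also have "\<dots> = x" by (rule sV_expand[symmetric]) auto
  finally show ?thesis using *[of "supp (coef x)"] by (simp add: brk_def slin_def)
qed

text \<open>The derivatives of the test field precede all letters of p and are independent over
  V(p), so the single equation x = 0 contains the vanishing of every coefficient modulo the
  ideal.\<close>

lemma chrel_Jideal:
  assumes "chrel n a b C x"
  shows "(\<forall>k. C k \<in> Jideal n) \<longleftrightarrow> x = 0"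
  using assms
proof (rule chrelE)
  let ?q = "glpar a b"
  fix P N
  assume P: "\<And>k. C k = coef (P k)" "\<And>k. P k \<in> alg (gens n)"
    "\<And>K. K \<ge> N \<Longrightarrow> P K = 0" "\<And>K. K \<ge> N \<Longrightarrow> x = (\<Sum>k<K. chs ?q k *c (ep a b k * rho (P k)))"
  have J: "C k \<in> Jideal n \<longleftrightarrow> rho (P k) = 0" for k using P(1,2) Jideal_iff by simp
  show ?thesis
  proof
    assume "\<forall>k. C k \<in> Jideal n"
    then show "x = 0" using P(4)[of N] by (simp add: J)
  next
    assume x: "x = 0"
    show "\<forall>k. C k \<in> Jideal n"
    proof
      fix k
      \<comment> \<open>Large enough for the expansion to be valid and for the index k to occur in
        it.\<close>
      let ?K = "max N (Suc k)"
      have "chs ?q k *c rho (P k) = 0"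
      proof (rule sum_extract[where A = "{..<?K}" and G = "pgens n"
            and g = "\<lambda>k. (0, 1 + ?q mod 2, k)" and Q = "\<lambda>k. chs ?q k *c rho (P k)"])
        show "(\<Sum>k<?K. gn (0, 1 + ?q mod 2, k) * chs ?q k *c rho (P k)) = 0"
          using x P(4)[of ?K] by (simp add: ep_def)
        show "chs ?q k' *c rho (P k') \<in> alg (pgens n)" for k'
          using P(2) by (intro alg_closed rho_alg)
      qed (auto simp: inj_on_def pgens_def less_prod_def dest: Iset_pos)
      then show "C k \<in> Jideal n" using chs_nz by (simp add: J)
    qed
  qed
qed

text \<open>The bracket is linear in the matrix, so strictly upper triangular matrix units suffice;
  for each of them the conditions on all powers of chi merge into one equation.\<close>

lemma Walg_iff:
  "Walg n = coef ` {x \<in> alg (pgens n). \<forall>a\<in>Iset n. \<forall>b\<in>Iset n. a < b \<longrightarrow> delta a b x = 0}"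
proof -
  have "(\<forall>X\<in>nmats n. \<forall>k. brk_el n X (coef x) k \<in> Jideal n) \<longleftrightarrow>
      (\<forall>a\<in>Iset n. \<forall>b\<in>Iset n. a < b \<longrightarrow> delta a b x = 0)" (is "?L \<longleftrightarrow> ?R")
    if x: "x \<in> alg (pgens n)" for x
  proof -
    have "\<exists>P. \<forall>k. brk a b (coef x) k = coef (P k) \<and> P k \<in> alg (gens n)"
      if "a \<in> Iset n" "b \<in> Iset n" for a b
      using chrel_brk[OF that x] unfolding chrel_def by blast
    then obtain P where P: "brk a b (coef x) k = coef (P a b k)" "P a b k \<in> alg (gens n)"
      if "a \<in> Iset n" "b \<in> Iset n" for a b k
      by metis
    have el: "brk_el n X (coef x) k = coef (\<Sum>a\<in>Iset n. \<Sum>b\<in>Iset n. X a b *c P a b k)" for X k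
      by (simp add: brk_el_def P fun_eq_iff)
    have R: "?R \<longleftrightarrow> (\<forall>a\<in>Iset n. \<forall>b\<in>Iset n. a < b \<longrightarrow> (\<forall>k. rho (P a b k) = 0))"
      using chrel_Jideal[OF chrel_brk[OF _ _ x]] Jideal_iff P by metis
    show ?thesis
    proof
      assume L: ?L
      show ?R unfolding R
      proof (intro ballI impI allI)
        fix a b k assume ab: "a \<in> Iset n" "b \<in> Iset n" "a < b"
        then have "brk_el n (Emat a b) (coef x) k \<in> Jideal n" using L Emat_nmats by blast
        then show "rho (P a b k) = 0" using ab by (simp add: el sum_Emat P Jideal_iff)
      qed
    next
      assume ?R
      then have 0: "rho (P a b k) = 0" if "a \<in> Iset n" "b \<in> Iset n" "a < b" for a b k
        using that R by blast
      show ?L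
      proof (intro ballI allI)
        fix X k assume X: "X \<in> nmats n"
        have "X a b *c rho (P a b k) = 0" if "a \<in> Iset n" "b \<in> Iset n" for a b
          using 0[OF that, of k] X by (auto simp: nmats_def)
        then have "rho (\<Sum>a\<in>Iset n. \<Sum>b\<in>Iset n. X a b *c P a b k) = 0"
          unfolding rho.sum rho.scale by (intro sum.neutral ballI)
        moreover have "(\<Sum>a\<in>Iset n. \<Sum>b\<in>Iset n. X a b *c P a b k) \<in> alg (gens n)"
          by (intro alg_sum alg_closed P)
        ultimately show "brk_el n X (coef x) k \<in> Jideal n" by (simp add: el Jideal_iff del: coef_sum)
      qed
    qed
  qed
  then show ?thesis unfolding Walg_def by (auto simp: Vp_iff)
qed

section \<open>Differential operators\<close>

text \<open>Normally ordered operators are replaced by their action on the algebra, where the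
  product is plain composition. The bound N on the order is carried along because the coefficients
  are later recovered from the action on a symbol with independent derivatives.\<close>

definition oprel :: "nat \<Rightarrow> nat \<Rightarrow> Op \<Rightarrow> (sV \<Rightarrow> sV) \<Rightarrow> bool" where
  "oprel n N P f \<longleftrightarrow> (\<exists>p. (\<forall>i. P i = coef (p i) \<and> p i \<in> alg (pgens n)) \<and> (\<forall>i>N. p i = 0) \<and>
     (\<forall>v. f v = (\<Sum>i\<le>N. p i * (DD ^^ i) v)))"

lemma oprelI:
  assumes "\<And>i. P i = coef (p i)" "\<And>i. p i \<in> alg (pgens n)" "\<And>i. i > N \<Longrightarrow> p i = 0"
    "\<And>v. f v = (\<Sum>i\<le>N. p i * (DD ^^ i) v)"
  shows "oprel n N P f"
  unfolding oprel_def using assms by blast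

lemma oprelE:
  assumes "oprel n N P f"
  obtains p where "\<And>i. P i = coef (p i)" "\<And>i. p i \<in> alg (pgens n)" "\<And>i. i > N \<Longrightarrow> p i = 0"
    "\<And>v. f v = (\<Sum>i\<le>N. p i * (DD ^^ i) v)"
  using assms unfolding oprel_def by blast

lemma oprel_opone: "oprel n 0 opone (\<lambda>v. v)"
  by (rule oprelI[of _ "\<lambda>i. if i = 0 then 1 else 0"])
    (auto simp: opone_def raw alg_one alg_closed)

lemma oprel_opDleft:
  assumes "oprel n N Q f"
  shows "oprel n (Suc N) (opDleft Q) (\<lambda>v. DD (f v))"
proof -
  obtain q where q: "\<And>i. Q i = coef (q i)" "\<And>i. q i \<in> alg (pgens n)" "\<And>i. i > N \<Longrightarrow> q i = 0"
    "\<And>v. f v = (\<Sum>i\<le>N. q i * (DD ^^ i) v)"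
    by (rule oprelE[OF assms]) (rule that)
  define q' where "q' i = DD (q i) + (case i of 0 \<Rightarrow> 0 | Suc j \<Rightarrow> sg (q j))" for i
  show ?thesis
  proof (rule oprelI[of _ q'])
    show "opDleft Q i = coef (q' i)" for i
      by (cases i) (simp_all add: opDleft_def q(1) raw q'_def flip: coef_sg)
    show "q' i \<in> alg (pgens n)" for i
      unfolding q'_def using q(2) by (cases i) (auto intro!: alg_closed D_alg dgen_pgens sg_alg)
    show "q' i = 0" if "i > Suc N" for i
      using that q(3) by (cases i) (simp_all add: q'_def)
    fix v
    have "(\<Sum>i\<le>Suc N. q' i * (DD ^^ i) v) = (\<Sum>i\<le>Suc N. DD (q i) * (DD ^^ i) v) +
        (\<Sum>i\<le>Suc N. (case i of 0 \<Rightarrow> 0 | Suc j \<Rightarrow> sg (q j)) * (DD ^^ i) v)"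
      by (simp add: q'_def distrib_right sum.distrib del: sum.atMost_Suc)
    also have "(\<Sum>i\<le>Suc N. DD (q i) * (DD ^^ i) v) = (\<Sum>i\<le>N. DD (q i) * (DD ^^ i) v)"
      by (simp add: q(3))
    also have "(\<Sum>i\<le>Suc N. (case i of 0 \<Rightarrow> 0 | Suc j \<Rightarrow> sg (q j)) * (DD ^^ i) v) =
        (\<Sum>i\<le>N. sg (q i) * DD ((DD ^^ i) v))"
      unfolding sum.atMost_Suc_shift by simp
    finally show "DD (f v) = (\<Sum>i\<le>Suc N. q' i * (DD ^^ i) v)"
      by (simp add: q(4) D.sum D_mult sum.distrib)
  qed
qed

lemma oprel_opDleft_pow:
  assumes "oprel n N Q f"
  shows "oprel n (N + i) ((opDleft ^^ i) Q) (\<lambda>v. (DD ^^ i) (f v))"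
  by (induction i) (use assms oprel_opDleft in \<open>auto\<close>)

lemma oprel_opmult:
  assumes "oprel n M P f" "oprel n N Q g"
  shows "oprel n (M + N) (opmult P Q) (\<lambda>v. f (g v))"
proof -
  obtain p where p: "\<And>i. P i = coef (p i)" "\<And>i. p i \<in> alg (pgens n)" "\<And>i. i > M \<Longrightarrow> p i = 0"
    "\<And>v. f v = (\<Sum>i\<le>M. p i * (DD ^^ i) v)"
    by (rule oprelE[OF assms(1)]) (rule that)
  have "\<forall>i. \<exists>q. (\<forall>k. (opDleft ^^ i) Q k = coef (q k) \<and> q k \<in> alg (pgens n)) \<and> (\<forall>k>N + i. q k = 0) \<and>
     (\<forall>v. (DD ^^ i) (g v) = (\<Sum>k\<le>N + i. q k * (DD ^^ k) v))"
    using oprel_opDleft_pow[OF assms(2)] unfolding oprel_def by blast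
  then obtain q where q: "\<And>i k. (opDleft ^^ i) Q k = coef (q i k)" "\<And>i k. q i k \<in> alg (pgens n)"
    "\<And>i k. k > N + i \<Longrightarrow> q i k = 0" "\<And>i v. (DD ^^ i) (g v) = (\<Sum>k\<le>N + i. q i k * (DD ^^ k) v)"
    by metis
  show ?thesis
  proof (rule oprelI[of _ "\<lambda>k. \<Sum>i\<le>M. p i * q i k"])
    fix k
    show "opmult P Q k = coef (\<Sum>i\<le>M. p i * q i k)"
    proof
      fix w
      have "opmult P Q k w = (\<Sum>i\<in>{i. P i \<noteq> szero}. coef (p i * q i k) w)"
        by (simp add: opmult_def p(1) q(1) raw)
      also have "\<dots> = (\<Sum>i\<le>M. coef (p i * q i k) w)"
      proof (rule sum.mono_neutral_left)
        show "{i. P i \<noteq> szero} \<subseteq> {..M}"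
          using p(1,3) by (force simp: raw not_le[symmetric])
        show "\<forall>i\<in>{..M} - {i. P i \<noteq> szero}. coef (p i * q i k) w = 0"
          by (auto simp: p(1) raw coef_inject)
      qed simp
      finally show "opmult P Q k w = coef (\<Sum>i\<le>M. p i * q i k) w" by simp
    qed
    show "(\<Sum>i\<le>M. p i * q i k) \<in> alg (pgens n)"
      by (intro alg_sum alg_mult p q)
    show "(\<Sum>i\<le>M. p i * q i k) = 0" if "M + N < k"
      by (rule sum.neutral) (use that q(3) in auto)
  next
    fix v
    have "(DD ^^ i) (g v) = (\<Sum>k\<le>M + N. q i k * (DD ^^ k) v)" if "i \<le> M" for i
      unfolding q(4) by (rule sum.mono_neutral_left) (use that q(3) in auto)
    then have "f (g v) = (\<Sum>i\<le>M. \<Sum>k\<le>M + N. p i * q i k * (DD ^^ k) v)"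
      by (simp add: p(4) sum_distrib_left mult.assoc)
    then show "f (g v) = (\<Sum>k\<le>M + N. (\<Sum>i\<le>M. p i * q i k) * (DD ^^ k) v)"
      by (subst (asm) sum.swap) (simp add: sum_distrib_right)
  qed
qed

lemma oprel_sum:
  assumes "finite S" "\<And>s. s \<in> S \<Longrightarrow> oprel n N (P s) (f s)"
  shows "oprel n N (\<lambda>k w. \<Sum>s\<in>S. c s * P s k w) (\<lambda>v. \<Sum>s\<in>S. c s *c f s v)"
proof -
  have "\<forall>s\<in>S. \<exists>p. (\<forall>i. P s i = coef (p i) \<and> p i \<in> alg (pgens n)) \<and> (\<forall>i>N. p i = 0) \<and>
     (\<forall>v. f s v = (\<Sum>i\<le>N. p i * (DD ^^ i) v))"
    using assms(2) unfolding oprel_def by blast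
  then obtain p where p: "\<And>s i. s \<in> S \<Longrightarrow> P s i = coef (p s i)" "\<And>s i. s \<in> S \<Longrightarrow> p s i \<in> alg (pgens n)"
    "\<And>s i. s \<in> S \<Longrightarrow> i > N \<Longrightarrow> p s i = 0"
    "\<And>s v. s \<in> S \<Longrightarrow> f s v = (\<Sum>i\<le>N. p s i * (DD ^^ i) v)"
    by metis
  show ?thesis
  proof (rule oprelI[of _ "\<lambda>i. \<Sum>s\<in>S. c s *c p s i"])
    show "(\<lambda>w. \<Sum>s\<in>S. c s * P s i w) = coef (\<Sum>s\<in>S. c s *c p s i)" for i
      by (simp add: fun_eq_iff p(1))
    show "(\<Sum>s\<in>S. c s *c p s i) \<in> alg (pgens n)" for i
      by (intro alg_sum alg_closed p)
    show "(\<Sum>s\<in>S. c s *c p s i) = 0" if "N < i" for i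
      using that p(3) by simp
    fix v
    have "(\<Sum>s\<in>S. c s *c f s v) = (\<Sum>s\<in>S. \<Sum>i\<le>N. c s *c p s i * (DD ^^ i) v)"
      by (simp add: p(4) sV.scale_sum_right)
    then show "(\<Sum>s\<in>S. c s *c f s v) = (\<Sum>i\<le>N. (\<Sum>s\<in>S. c s *c p s i) * (DD ^^ i) v)"
      by (subst (asm) sum.swap) (simp add: sum_distrib_right)
  qed
qed

section \<open>Row determinants of Hessenberg matrices of operators\<close>

definition rdop :: "nat \<Rightarrow> (nat \<Rightarrow> nat \<Rightarrow> sV \<Rightarrow> sV) \<Rightarrow> sV \<Rightarrow> sV" where
  "rdop N B v = (\<Sum>\<sigma>\<in>{\<sigma>. \<sigma> permutes {1..N}}.
     of_int (sign \<sigma>) *c foldr (\<lambda>i x. B i (\<sigma> i) x) [1..<N+1] v)"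

lemma oprel_rdet:
  assumes "\<And>i j. i \<in> {1..N} \<Longrightarrow> j \<in> {1..N} \<Longrightarrow> oprel n 1 (A i j) (B i j)"
  shows "oprel n N (rdet N A) (rdop N B)"
proof -
  have "oprel n (length xs) (foldr opmult (map (\<lambda>i. A i (\<sigma> i)) xs) opone)
      (\<lambda>v. foldr (\<lambda>i x. B i (\<sigma> i) x) xs v)"
    if "\<sigma> permutes {1..N}" "set xs \<subseteq> {1..N}" for \<sigma> xs
    using that(2)
  proof (induction xs)
    case Nil
    then show ?case using oprel_opone by simp
  next
    case (Cons i xs)
    have "\<sigma> i \<in> {1..N}" using permutes_in_image[OF that(1), of i] Cons.prems by auto
    then have "oprel n 1 (A i (\<sigma> i)) (B i (\<sigma> i))" using assms Cons.prems by auto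
    from oprel_opmult[OF this Cons.IH] Cons.prems show ?case by simp
  qed
  note fold = this
  have "oprel n N (foldr opmult (map (\<lambda>i. A i (\<sigma> i)) [1..<N+1]) opone)
      (\<lambda>v. foldr (\<lambda>i x. B i (\<sigma> i) x) [1..<N+1] v)"
    if "\<sigma> permutes {1..N}" for \<sigma>
    using fold[OF that, of "[1..<N+1]"] by (simp del: upt_Suc add: atLeastLessThanSuc_atLeastAtMost)
  then show ?thesis
    unfolding rdet_def rdop_def by (intro oprel_sum) (auto simp: finite_permutations)
qed

lemma rdop_0 [simp]: "rdop 0 B v = v"
  by (simp add: rdop_def)

lemma rdop_cong:
  assumes "\<And>i k. i \<in> {1..N} \<Longrightarrow> k \<in> {1..N} \<Longrightarrow> B i k = B' i k"
  shows "rdop N B = rdop N B'"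
proof
  fix v
  show "rdop N B v = rdop N B' v"
    unfolding rdop_def
  proof (intro sum.cong refl arg_cong2[where f = scl] foldr_cong ext)
    fix \<sigma> i x assume "\<sigma> \<in> {\<sigma>. \<sigma> permutes {1..N}}" "i \<in> set [1..<N+1]"
    then have "i \<in> {1..N}" "\<sigma> i \<in> {1..N}" using permutes_in_image[of \<sigma> "{1..N}" i] by auto
    then show "B i (\<sigma> i) x = B' i (\<sigma> i) x" using assms by simp
  qed
qed

lemma slinear_rdop:
  assumes "\<And>i k. i \<in> {1..N} \<Longrightarrow> slinear (B i k)"
  shows "slinear (rdop N B)"
proof -
  have fl: "foldr (\<lambda>i x. B i (\<sigma> i) x) xs (x + y) =
        foldr (\<lambda>i x. B i (\<sigma> i) x) xs x + foldr (\<lambda>i x. B i (\<sigma> i) x) xs y \<and>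
      foldr (\<lambda>i x. B i (\<sigma> i) x) xs (c *c x) = c *c foldr (\<lambda>i x. B i (\<sigma> i) x) xs x"
    if "set xs \<subseteq> {1..N}" for \<sigma> xs x y c
    using that by (induction xs) (auto simp: assms slinear.add slinear.scale)
  have "set [1..<N+1] \<subseteq> {1..N}" by auto
  note fl = fl[OF this]
  show ?thesis
  proof
    fix x y c
    show "rdop N B (x + y) = rdop N B x + rdop N B y"
      unfolding rdop_def by (simp only: fl sV.scale_right_distrib sum.distrib)
    show "rdop N B (c *c x) = c *c rdop N B x"
      unfolding rdop_def by (simp only: fl sV.scale_sum_right sV.scale_scale mult.commute)
  qed
qed

text \<open>Only the last two entries of the last row contribute; the second one is moved to the
  diagonal by exchanging the last two columns.\<close>

lemma rdop_split:
  assumes "\<And>i k. slinear (B i k)" "1 \<le> j" "\<And>k v. 1 \<le> k \<Longrightarrow> k < j \<Longrightarrow> B (Suc j) k v = 0"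
  shows "rdop (Suc j) B v = rdop j B (B (Suc j) (Suc j) v) -
     rdop j (\<lambda>i k. B i (if k = j then Suc j else k)) (B (Suc j) j v)"
proof -
  define F where "F \<sigma> v = foldr (\<lambda>i x. B i (\<sigma> i) x) [1..<j+1] v" for \<sigma> v
  have F0: "F \<sigma> 0 = 0" for \<sigma>
  proof -
    have "foldr (\<lambda>i x. B i (\<sigma> i) x) xs 0 = 0" for xs
      by (induction xs) (simp_all add: slinear.zero[OF assms(1)])
    then show ?thesis by (simp add: F_def)
  qed
  let ?P = "{\<sigma>. \<sigma> permutes {1..Suc j}}"
  let ?h = "\<lambda>\<sigma>. of_int (sign \<sigma>) *c F \<sigma> (B (Suc j) (\<sigma> (Suc j)) v)"
  let ?t = "transpose j (Suc j)"
  have fin: "finite ?P" by (simp add: finite_permutations)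
  have perm: "\<sigma> permutes {1..j}" if "\<sigma> permutes {1..Suc j}" "\<sigma> (Suc j) = Suc j" for \<sigma>
    by (rule permutes_superset[OF that(1)]) (use that(2) in \<open>auto simp: le_Suc_eq\<close>)
  have perm': "\<sigma> permutes {1..Suc j}" "\<sigma> (Suc j) = Suc j" if "\<sigma> permutes {1..j}" for \<sigma>
    using that permutes_subset[OF that, of "{1..Suc j}"] permutes_not_in[OF that, of "Suc j"] by auto
  have tperm: "?t permutes {1..Suc j}" using assms(2) by (intro permutes_swap_id) auto
  have "rdop (Suc j) B v = (\<Sum>\<sigma>\<in>?P. ?h \<sigma>)"
    unfolding rdop_def F_def by simp
  also have "\<dots> = (\<Sum>\<sigma>\<in>?P \<inter> {\<sigma>. \<sigma> (Suc j) \<in> {j, Suc j}}. ?h \<sigma>)"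
  proof (rule sum.mono_neutral_right[OF fin])
    show "\<forall>\<sigma>\<in>?P - ?P \<inter> {\<sigma>. \<sigma> (Suc j) \<in> {j, Suc j}}. ?h \<sigma> = 0"
    proof
      fix \<sigma> assume \<sigma>: "\<sigma> \<in> ?P - ?P \<inter> {\<sigma>. \<sigma> (Suc j) \<in> {j, Suc j}}"
      then have "\<sigma> (Suc j) \<in> {1..Suc j}" using permutes_in_image[of \<sigma> "{1..Suc j}" "Suc j"] by auto
      then have "B (Suc j) (\<sigma> (Suc j)) v = 0" using \<sigma> by (intro assms(3)) auto
      then show "?h \<sigma> = 0" by (simp add: F0)
    qed
  qed auto
  also have "?P \<inter> {\<sigma>. \<sigma> (Suc j) \<in> {j, Suc j}} =
      (?P \<inter> {\<sigma>. \<sigma> (Suc j) = Suc j}) \<union> (?P \<inter> {\<sigma>. \<sigma> (Suc j) = j})" by auto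
  also have "(\<Sum>\<sigma>\<in>\<dots>. ?h \<sigma>) =
      (\<Sum>\<sigma>\<in>?P \<inter> {\<sigma>. \<sigma> (Suc j) = Suc j}. ?h \<sigma>) + (\<Sum>\<sigma>\<in>?P \<inter> {\<sigma>. \<sigma> (Suc j) = j}. ?h \<sigma>)"
    by (rule sum.union_disjoint) (use fin in auto)
  also have "?P \<inter> {\<sigma>. \<sigma> (Suc j) = Suc j} = {\<sigma>. \<sigma> permutes {1..j}}"
    using perm perm' by blast
  also have "(\<Sum>\<sigma>\<in>{\<sigma>. \<sigma> permutes {1..j}}. ?h \<sigma>) = rdop j B (B (Suc j) (Suc j) v)"
    unfolding rdop_def F_def
  proof (rule sum.cong[OF refl])
    fix \<sigma> assume "\<sigma> \<in> {\<sigma>. \<sigma> permutes {1..j}}"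
    then have "\<sigma> (Suc j) = Suc j" using perm'(2) by blast
    then show "of_int (sign \<sigma>) *c foldr (\<lambda>i x. B i (\<sigma> i) x) [1..<j+1] (B (Suc j) (\<sigma> (Suc j)) v) =
        of_int (sign \<sigma>) *c foldr (\<lambda>i x. B i (\<sigma> i) x) [1..<j+1] (B (Suc j) (Suc j) v)"
      by (simp only:)
  qed
  \<comment> \<open>Composing with the transposition turns the permutations sending j + 1 to j into
    permutations of 1..j and reverses their sign. Redirecting column j to column j + 1 restores the
    entries originally selected.\<close>
  also have "(\<Sum>\<sigma>\<in>?P \<inter> {\<sigma>. \<sigma> (Suc j) = j}. ?h \<sigma>) =
      (\<Sum>\<tau>\<in>{\<tau>. \<tau> permutes {1..j}}. - (of_int (sign \<tau>) *c
        foldr (\<lambda>i x. B i (if \<tau> i = j then Suc j else \<tau> i) x) [1..<j+1] (B (Suc j) j v)))"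
  proof (rule sum.reindex_bij_witness[of _ "\<lambda>\<tau>. ?t \<circ> \<tau>" "\<lambda>\<sigma>. ?t \<circ> \<sigma>"])
    fix \<sigma> assume \<sigma>: "\<sigma> \<in> ?P \<inter> {\<sigma>. \<sigma> (Suc j) = j}"
    show "?t \<circ> (?t \<circ> \<sigma>) = \<sigma>" by (simp add: fun_eq_iff)
    have "?t \<circ> \<sigma> permutes {1..Suc j}" using \<sigma> tperm by (intro permutes_compose) auto
    then have p: "?t \<circ> \<sigma> permutes {1..j}" using \<sigma> by (intro perm) auto
    then show "?t \<circ> \<sigma> \<in> {\<tau>. \<tau> permutes {1..j}}" by simp
    have "sign (?t \<circ> \<sigma>) = - sign \<sigma>"
    proof -
      have "permutation \<sigma>" using \<sigma> unfolding permutation_permutes by blast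
      then have "sign (?t \<circ> \<sigma>) = sign ?t * sign \<sigma>"
        by (intro sign_compose permutation_swap_id)
      then show ?thesis by (simp add: sign_swap_id)
    qed
    moreover have "F \<sigma> x = foldr (\<lambda>i x. B i (if (?t \<circ> \<sigma>) i = j then Suc j else (?t \<circ> \<sigma>) i) x) [1..<j+1] x" for x
      unfolding F_def
    proof (intro foldr_cong refl ext)
      fix i x assume i: "i \<in> set [1..<j+1]"
      have "(?t \<circ> \<sigma>) i \<noteq> Suc j"
      proof
        assume "(?t \<circ> \<sigma>) i = Suc j"
        then have "(?t \<circ> \<sigma>) i = (?t \<circ> \<sigma>) (Suc j)" using perm'(2)[OF p] by simp
        then have "i = Suc j" by (rule injD[OF permutes_inj[OF p]])
        then show False using i by simp
      qed
      then have "(if (?t \<circ> \<sigma>) i = j then Suc j else (?t \<circ> \<sigma>) i) = \<sigma> i"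
        by (auto simp: transpose_def split: if_splits)
      then show "B i (\<sigma> i) x = B i (if (?t \<circ> \<sigma>) i = j then Suc j else (?t \<circ> \<sigma>) i) x" by simp
    qed
    ultimately show "- (of_int (sign (?t \<circ> \<sigma>)) *c foldr (\<lambda>i x. B i (if (?t \<circ> \<sigma>) i = j then Suc j
        else (?t \<circ> \<sigma>) i) x) [1..<j+1] (B (Suc j) j v)) = ?h \<sigma>"
      using \<sigma> by simp
  next
    fix \<tau> assume \<tau>: "\<tau> \<in> {\<tau>. \<tau> permutes {1..j}}"
    show "?t \<circ> (?t \<circ> \<tau>) = \<tau>" by (simp add: fun_eq_iff)
    show "?t \<circ> \<tau> \<in> ?P \<inter> {\<sigma>. \<sigma> (Suc j) = j}"
      using \<tau> perm'[of \<tau>] tperm by (auto intro: permutes_compose)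
  qed
  also have "\<dots> = - rdop j (\<lambda>i k. B i (if k = j then Suc j else k)) (B (Suc j) j v)"
    unfolding rdop_def by (simp add: sum_negf)
  finally show ?thesis by simp
qed

text \<open>Each column exchange brings a minus sign and each subdiagonal entry is -1; the two
  always meet, so the expansion along the last column has only plus signs.\<close>

lemma rdop_hessenberg:
  assumes lin: "\<And>i k. slinear (B i k)" and sub: "\<And>j v. 1 \<le> j \<Longrightarrow> B (Suc j) j v = - v"
    and zero: "\<And>i k v. 1 \<le> k \<Longrightarrow> Suc k < i \<Longrightarrow> B i k v = 0"
  shows "rdop (Suc j) B v = (\<Sum>i\<le>j. rdop i B (B (Suc i) (Suc j) v))"
proof -
  \<comment> \<open>After an exchange the old last column stands in the place of an earlier one and
    moves further left at the next exchange. The induction therefore needs an arbitrary column c in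
    the last place.\<close>
  have *: "rdop (Suc j) (\<lambda>i k. B i (if k = Suc j then c else k)) v = (\<Sum>i\<le>j. rdop i B (B (Suc i) c v))"
    if "Suc j \<le> c" for j c v
    using that
  proof (induction j)
    case 0
    have "rdop 1 B' v = B' 1 1 v" for B'
      by (simp add: rdop_def)
    then show ?case by simp
  next
    case (Suc j)
    let ?B = "\<lambda>i k. B i (if k = Suc (Suc j) then c else k)"
    have "rdop (Suc (Suc j)) ?B v = rdop (Suc j) ?B (?B (Suc (Suc j)) (Suc (Suc j)) v) -
       rdop (Suc j) (\<lambda>i k. ?B i (if k = Suc j then Suc (Suc j) else k)) (?B (Suc (Suc j)) (Suc j) v)"
      by (rule rdop_split) (use lin zero in auto)
    also have "rdop (Suc j) ?B = rdop (Suc j) B" by (rule rdop_cong) auto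
    also have "rdop (Suc j) (\<lambda>i k. ?B i (if k = Suc j then Suc (Suc j) else k)) =
        rdop (Suc j) (\<lambda>i k. B i (if k = Suc j then c else k))"
      by (rule rdop_cong) auto
    also have "rdop (Suc j) (\<lambda>i k. B i (if k = Suc j then c else k)) (?B (Suc (Suc j)) (Suc j) v) =
        - (\<Sum>i\<le>j. rdop i B (B (Suc i) c v))"
      using Suc lin by (simp add: sub slinear.uminus[OF slinear_rdop])
    finally show ?case by simp
  qed
  have "rdop (Suc j) B = rdop (Suc j) (\<lambda>i k. B i (if k = Suc j then Suc j else k))"
    by (rule rdop_cong) auto
  then show ?thesis using *[of j "Suc j"] by simp
qed

section \<open>The coefficients of the row determinant\<close>

definition alpha :: "nat \<Rightarrow> nat \<Rightarrow> sV \<Rightarrow> sV" where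
  "alpha i j v = (if i \<le> j then (-1) ^ pp j *c (gn (j, i, 0) * v) + (if i = j then DD v else 0)
     else if i = Suc j then - v else 0)"

lemma oprel_Amat:
  assumes "i \<in> Iset n" "j \<in> Iset n"
  shows "oprel n 1 (Amat n i j) (alpha i j)"
proof (rule oprelI)
  let ?p = "\<lambda>d::nat. if i \<le> j then (if d = 0 then (-1) ^ pp j *c gn (j, i, 0)
      else if d = 1 \<and> i = j then 1 else 0)
    else if i = j + 1 \<and> d = 0 then - 1 else (0::sV)"
  show "Amat n i j d = coef (?p d)" for d
    by (auto simp: Amat_def raw)
  show "?p d \<in> alg (pgens n)" for d
    using assms by (auto simp: pgens_def intro!: alg_closed alg_gn alg_one alg_uminus)
  show "?p d = 0" if "d > 1" for d using that by simp
  show "alpha i j v = (\<Sum>d\<le>1. ?p d * (DD ^^ d) v)" for v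
    by (simp add: alpha_def)
qed

lemma slinear_alpha: "slinear (alpha i j)"
  by standard (auto simp: alpha_def distrib_left sV.scale_right_distrib D.add D.scale mult.commute
      sV.scale_left_commute)

definition Emin :: "nat \<Rightarrow> sV \<Rightarrow> sV" where "Emin j = rdop j alpha"

lemma Emin_0 [simp]: "Emin 0 v = v"
  by (simp add: Emin_def)

lemma Emin_Suc: "Emin (Suc j) v = (\<Sum>i\<le>j. Emin i (alpha (Suc i) (Suc j) v))"
  unfolding Emin_def by (rule rdop_hessenberg) (simp_all add: slinear_alpha, simp_all add: alpha_def)

interpretation Emin: slinear "Emin j" for j
  unfolding Emin_def by (rule slinear_rdop) (rule slinear_alpha)

lemma gn_ep_comm: "gn (k, l, 0) * (ep a b m * v) =
    (-1) ^ ((glpar a b + m) * (pp k + pp l + 1)) *c (ep a b m * (gn (k, l, 0) * v))"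
proof -
  have "ep a b m * gn (k, l, 0) = (-1) ^ ((glpar a b + m) * (pp k + pp l + 1)) *c (gn (k, l, 0) * ep a b m)"
  proof (cases "odd (pp k + pp l + 1)")
    case True
    then have "godd (k, l, 0)" by (simp add: godd_def)
    moreover have "(-1::complex) ^ ((glpar a b + m) * (pp k + pp l + 1)) = (-1) ^ (glpar a b + m)"
      using True by (simp add: power_mult minus_one_power_iff)
    ultimately show ?thesis using comm_gn[of "ep a b m" "(k, l, 0)"] by (simp only: sg_ep if_True scl_mult)
  next
    case False
    then have "\<not> godd (k, l, 0)" by (simp add: godd_def)
    moreover have "(-1::complex) ^ ((glpar a b + m) * (pp k + pp l + 1)) = 1"
      using False by (simp add: minus_one_power_iff)
    ultimately show ?thesis using comm_gn[of "ep a b m" "(k, l, 0)"] by (simp only: if_False sV.scale_one)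
  qed
  then have "(-1) ^ ((glpar a b + m) * (pp k + pp l + 1)) *c (ep a b m * gn (k, l, 0)) = gn (k, l, 0) * ep a b m"
    by (simp flip: power_mult_distrib)
  then show ?thesis by (metis mult.assoc scl_mult(1))
qed

text \<open>For j at least 1 all entries have the uniform shape (-1)^p(j)
  \<open>rhog (j, i, 0)\<close>, plus D on the diagonal: the subdiagonal -1 is (-1)^(p(j)+p(j+1)),
  the reduced value of bar e_{j,j+1}. Hence the two parts of the bracket are a column and a row
  operation even where they leave p, and the chi term accounts for D hitting the test field at i =
  a, j = b.\<close>

lemma delta_alpha:
  assumes "1 \<le> a" "a < b" "1 \<le> i" "1 \<le> j"
  shows "delta a b (alpha i j v) = alpha i j (delta a b v) +
     (if j = b then alpha i a (ep a b 0 * v) else 0) -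
     (if i = a then (-1) ^ glpar a b *c (ep a b 0 * alpha b j v) else 0)"
proof (cases "i \<le> j")
  \<comment> \<open>Below the diagonal both corrections vanish: the entries (i, a) with i > b > a
    and (b, j) with b > a > j lie at least two places below it.\<close>
  case False
  then show ?thesis using assms by (auto simp: alpha_def delta.uminus)
next
  case True
  have "delta a b (alpha i j v) = alpha i j (delta a b v) + (-1) ^ pp j *c (dbase a b j i * v)"
    using True assms by (auto simp: alpha_def delta.lin_simps delta_mult delta_D deltag_def
        sV.scale_right_distrib algebra_simps)
  moreover have "(-1) ^ pp j *c (dbase a b j i * v) = (if j = b then alpha i a (ep a b 0 * v) else 0) -
     (if i = a then (-1) ^ glpar a b *c (ep a b 0 * alpha b j v) else 0)"
  proof -
    have D: "DD (ep a b 0 * v) = ep a b 1 * v + (-1) ^ glpar a b *c (ep a b 0 * DD v)"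
      by (simp add: D_mult D_ep sg_ep)
    \<comment> \<open>The column correction uses the entry (i, a) and the row correction the entry
      (b, j). Each can lie above or on the diagonal, on the subdiagonal, or in the zero
      region.\<close>
    consider "j = b" "i = a" | "j = b" "i < a" | "j = b" "i = Suc a" | "j = b" "Suc a < i"
      | "i = a" "b < j" | "i = a" "Suc j = b" | "i = a" "Suc j < b" | "i \<noteq> a" "j \<noteq> b"
      by linarith
    then show ?thesis
    proof cases
      case 1
      then show ?thesis using assms True
        by (simp add: alpha_def D gn_ep_comm dbase_def rhog_def mult.assoc distrib_right left_diff_distrib
            right_diff_distrib distrib_left sV.scale_right_distrib sV.scale_right_diff_distrib)
          (auto simp: glpar_def pp_def)
    next
      case 2
      then show ?thesis using assms True
        by (simp add: alpha_def gn_ep_comm dbase_def rhog_def mult.assoc) (auto simp: glpar_def pp_def)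
    next
      case 3
      then show ?thesis using assms True
        by (simp add: alpha_def dbase_def rhog_def mult.assoc) (auto simp: glpar_def pp_def)
    next
      case 4
      then show ?thesis using assms True by (simp add: alpha_def dbase_def rhog_def)
    next
      case 5
      then show ?thesis using assms True
        by (simp add: alpha_def dbase_def rhog_def mult.assoc) (auto simp: glpar_def pp_def)
    next
      case 6
      then show ?thesis using assms True
        by (simp add: alpha_def dbase_def rhog_def mult.assoc) (auto simp: glpar_def pp_def)
    next
      case 7
      then show ?thesis using assms True by (simp add: alpha_def dbase_def rhog_def)
    next
      case 8
      then show ?thesis by (simp add: dbase_def)
    qed
  qed
  ultimately show ?thesis by simp
qed

text \<open>Only the minor of size b - 1 has a defect: it contains row a, but the row b to be added
  to it, and the column b that would compensate, lie just outside. In larger minors this defect,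
  inherited through the recursion, cancels the row correction.\<close>

lemma delta_Emin:
  assumes "1 \<le> a" "a < b"
  shows "delta a b (Emin j v) = Emin j (delta a b v) +
     (if Suc j = b then (-1) ^ glpar a b *c Emin (a - 1) (ep a b 0 * v) else 0)"
proof (induction j arbitrary: v rule: less_induct)
  case (less j)
  show ?case
  proof (cases j)
    case 0
    then show ?thesis using assms by simp
  next
    case (Suc j')
    let ?s = "(-1::complex) ^ glpar a b" and ?e = "ep a b 0"
    let ?X = "?s *c Emin (a - 1) (?e * alpha b (Suc j') v)"
    have "delta a b (Emin j v) = (\<Sum>i\<le>j'. delta a b (Emin i (alpha (Suc i) (Suc j') v)))"
      by (simp add: Suc Emin_Suc delta.sum)
    also have "\<dots> = (\<Sum>i\<le>j'. Emin i (alpha (Suc i) (Suc j') (delta a b v)) +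
        (if Suc j' = b then Emin i (alpha (Suc i) a (?e * v)) else 0) -
        (if i = a - 1 then ?X else 0) + (if i = b - 1 then ?X else 0))"
    proof (rule sum.cong[OF refl])
      fix i assume "i \<in> {..j'}"
      then have "delta a b (Emin i (alpha (Suc i) (Suc j') v)) =
          Emin i (delta a b (alpha (Suc i) (Suc j') v)) +
          (if Suc i = b then ?s *c Emin (a - 1) (?e * alpha (Suc i) (Suc j') v) else 0)"
        using less[of i] by (simp add: Suc)
      also have "Emin i (delta a b (alpha (Suc i) (Suc j') v)) =
          Emin i (alpha (Suc i) (Suc j') (delta a b v)) +
          (if Suc j' = b then Emin i (alpha (Suc i) a (?e * v)) else 0) -
          (if Suc i = a then Emin i (?s *c (?e * alpha b (Suc j') v)) else 0)"
        using assms by (simp add: delta_alpha Emin.add Emin.diff)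
      finally show "delta a b (Emin i (alpha (Suc i) (Suc j') v)) =
          Emin i (alpha (Suc i) (Suc j') (delta a b v)) +
          (if Suc j' = b then Emin i (alpha (Suc i) a (?e * v)) else 0) -
          (if i = a - 1 then ?X else 0) + (if i = b - 1 then ?X else 0)"
        using assms by (auto simp: Emin.scale)
    qed
    also have "\<dots> = Emin j (delta a b v) +
        (if Suc j' = b then (\<Sum>i\<le>j'. Emin i (alpha (Suc i) a (?e * v))) else 0) -
        (if a - 1 \<le> j' then ?X else 0) + (if b - 1 \<le> j' then ?X else 0)"
      by (simp add: sum.distrib sum_subtractf Suc Emin_Suc)
    \<comment> \<open>Column a ends at its subdiagonal entry, so the sum stops at i = a. The terms
      below a reproduce the recursion for \<open>Emin a\<close>, and the entry -1 contributes its
      negative.\<close>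
    also have "(if Suc j' = b then (\<Sum>i\<le>j'. Emin i (alpha (Suc i) a (?e * v))) else 0) = 0"
    proof -
      have "(\<Sum>i\<le>j'. Emin i (alpha (Suc i) a (?e * v))) = 0" if "Suc j' = b"
      proof -
        obtain a' where a': "a = Suc a'" using assms by (cases a) auto
        have "(\<Sum>i\<le>j'. Emin i (alpha (Suc i) a (?e * v))) = (\<Sum>i\<le>a. Emin i (alpha (Suc i) a (?e * v)))"
          by (rule sum.mono_neutral_right) (use assms that in \<open>auto simp: alpha_def\<close>)
        also have "\<dots> = (\<Sum>i\<le>a'. Emin i (alpha (Suc i) (Suc a') (?e * v))) + Emin a (alpha (Suc a) a (?e * v))"
          by (simp add: a')
        also have "alpha (Suc a) a (?e * v) = - (?e * v)" by (simp add: alpha_def)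
        finally have "(\<Sum>i\<le>j'. Emin i (alpha (Suc i) a (?e * v))) =
            Emin (Suc a') (?e * v) + Emin a (- (?e * v))"
          by (simp only: Emin_Suc)
        also have "\<dots> = 0" by (simp add: a' Emin.uminus)
        finally show ?thesis .
      qed
      then show ?thesis by simp
    qed
    \<comment> \<open>For j at least b the row correction meets the defect of the minor of size b -
      1 with opposite sign. For j = b - 1 it stands alone, and \<open>alpha b j\<close> is the
      subdiagonal -1. For smaller j the entry \<open>alpha b j\<close> is zero.\<close>
    also have "Emin j (delta a b v) + 0 - (if a - 1 \<le> j' then ?X else 0) + (if b - 1 \<le> j' then ?X else 0) =
        Emin j (delta a b v) + (if Suc j = b then ?s *c Emin (a - 1) (?e * v) else 0)"
    proof -
      have "?X = - (?s *c Emin (a - 1) (?e * v))" if "Suc j = b"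
        using that by (auto simp: Suc alpha_def Emin.uminus)
      moreover have "?X = 0" if "Suc j < b"
        using that by (auto simp: Suc alpha_def)
      moreover consider "b - 1 \<le> j'" "a - 1 \<le> j'" "Suc j \<noteq> b" | "Suc j = b" "\<not> b - 1 \<le> j'" "a - 1 \<le> j'"
        | "Suc j < b" "\<not> b - 1 \<le> j'"
        using assms Suc by linarith
      ultimately show ?thesis by cases auto
    qed
    finally show ?thesis .
  qed
qed

lemma sum_extract_right:
  assumes "finite A" "inj_on g A" "\<And>k. k \<in> A \<Longrightarrow> Q k \<in> alg G"
    "\<And>k h. k \<in> A \<Longrightarrow> h \<in> G \<Longrightarrow> g k < h" "(\<Sum>k\<in>A. Q k * gn (g k)) = 0" "k \<in> A"
  shows "Q k = 0"
proof -
  let ?Q = "\<lambda>k. if godd (g k) then sg (Q k) else Q k"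
  have "?Q k = 0"
  proof (rule sum_extract[OF assms(1,2) _ assms(4) _ assms(6), where Q = ?Q])
    show "(\<Sum>k\<in>A. gn (g k) * ?Q k) = 0" using assms(5) by (simp flip: comm_gn)
  qed (use assms(3) sg_alg in auto)
  then show ?thesis by (metis sg_sg sg.zero)
qed

text \<open>All letters except the derivatives of the indeterminate z below.\<close>

definition posgens :: "gen set" where "posgens = {(i, j, m). 0 < i \<or> 0 < j}"

lemma pgens_posgens: "pgens n \<subseteq> posgens"
  by (auto simp: pgens_def posgens_def Iset_def)

lemma deltag_alg:
  assumes "1 \<le> a" "g \<in> posgens"
  shows "deltag a b g \<in> alg posgens"
proof (cases g)
  case (fields k l m)
  have d: "\<And>g. g \<in> posgens \<Longrightarrow> dgen g \<in> posgens" by (auto simp: posgens_def)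
  have r: "rhog (i, j, 0) \<in> alg posgens" if "0 < i" for i j
    using that by (auto simp: rhog_def posgens_def intro!: alg_gn alg_closed alg_one)
  have e: "ep a b i \<in> alg posgens" for a b i
    by (auto simp: ep_def posgens_def intro!: alg_gn)
  have "dbase a b k l \<in> alg posgens" if "1 \<le> l" "l \<le> k"
    unfolding dbase_def using that assms(1)
    by (auto intro!: alg_closed alg_mult alg_diff alg_uminus r e)
  then show ?thesis by (auto simp: fields deltag_def alg_closed intro!: D_pow_alg d)
qed

lemma delta_alg:
  assumes "1 \<le> a" "x \<in> alg (pgens n)"
  shows "delta a b x \<in> alg posgens"
  by (rule delta.der_alg[OF assms(2)])
    (use pgens_posgens assms(1) deltag_alg in \<open>blast intro: deltag_alg\<close>)+

section \<open>Restriction to the slice\<close>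

text \<open>Restriction to the affine slice on which only the first column of letters is free.
  Column index 0 is kept as well, so that the indeterminate z below survives.\<close>

definition pig :: "gen \<Rightarrow> sV" where
  "pig x = (if fst (snd x) \<ge> 2 then 0 else gn x)"

abbreviation slice :: "sV \<Rightarrow> sV" where "slice \<equiv> hm pig"

interpretation slice: superhom pig
  by standard (auto simp: pig_def sg_gn)

lemma pig_dgen: "pig (dgen x) = DD (pig x)"
  by (cases x) (auto simp: pig_def)

lemmas slice_D = slice.hm_D[OF pig_dgen]
lemmas slice_D_pow = slice.hm_D_pow[OF pig_dgen]

lemma slice_alpha:
  assumes "1 \<le> i" "1 \<le> j"
  shows "slice (alpha i j v) = (if i = 1 then (-1) ^ pp j *c (gn (j, 1, 0) * slice v) else 0) +
    (if i = j then DD (slice v) else if i = Suc j then - slice v else 0)"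
  using assms by (auto simp: alpha_def slice.lin_simps slice.hm_mult slice_D pig_def)

text \<open>On the slice the matrix is of companion type: letters in the first row, D on the
  diagonal, -1 below. Its row determinant is the monic operator whose lower coefficients are, up to
  sign, these letters.\<close>

lemma slice_Emin:
  "slice (Emin j v) = (DD ^^ j) (slice v) +
     (\<Sum>i\<in>{1..j}. (-1) ^ pp i *c (gn (i, 1, 0) * (DD ^^ (j - i)) (slice v)))"
proof (induction j arbitrary: v rule: less_induct)
  case (less j)
  show ?case
  proof (cases j)
    case (Suc j')
    let ?A = "\<lambda>i. alpha (Suc i) (Suc j') v"
    have "slice (Emin j v) = (\<Sum>i\<le>j'. slice (Emin i (?A i)))"
      by (simp add: Suc Emin_Suc slice.sum)
    \<comment> \<open>In the last column only the first-row entry (i = 0) and the diagonal entry (i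
      = j') survive; for j' = 0 they are the same entry, which explains the case distinction that
      follows.\<close>
    also have "\<dots> = (\<Sum>i\<in>{0, j'}. slice (Emin i (?A i)))"
    proof (rule sum.mono_neutral_right)
      show "\<forall>i\<in>{..j'} - {0, j'}. slice (Emin i (?A i)) = 0"
      proof
        fix i assume i: "i \<in> {..j'} - {0, j'}"
        then have "slice (?A i) = 0" by (simp add: slice_alpha)
        then show "slice (Emin i (?A i)) = 0" using less[of i "?A i"] i by (simp add: Suc D_pow_linear)
      qed
    qed auto
    also have "\<dots> = (DD ^^ j) (slice v) +
     (\<Sum>i\<in>{1..j}. (-1) ^ pp i *c (gn (i, 1, 0) * (DD ^^ (j - i)) (slice v)))"
    proof (cases "j' = 0")
      case True
      then show ?thesis by (simp add: Suc slice_alpha add.commute)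
    next
      case False
      have D: "(DD ^^ m) (DD x) = (DD ^^ Suc m) x" for m x
        by (simp only: funpow_Suc_right comp_def)
      have "slice (Emin j' (?A j')) = (DD ^^ j') (DD (slice v)) +
          (\<Sum>i\<in>{1..j'}. (-1) ^ pp i *c (gn (i, 1, 0) * (DD ^^ (j' - i)) (DD (slice v))))"
        using less[of j' "?A j'"] False by (simp add: Suc slice_alpha)
      also have "\<dots> = (DD ^^ j) (slice v) +
          (\<Sum>i\<in>{1..j'}. (-1) ^ pp i *c (gn (i, 1, 0) * (DD ^^ (j - i)) (slice v)))"
        unfolding D Suc by (simp add: Suc_diff_le)
      finally show ?thesis using False by (simp add: Suc slice_alpha algebra_simps)
    qed
    finally show ?thesis .
  qed simp
qed

text \<open>The letter (0, 0, k) plays the role of the k-th derivative of an indeterminate z, on which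
  the operator rdet acts; it lets the coefficients be read off.\<close>

lemma wgen_properties:
  obtains w where "\<And>k. wgen n k = coef (w k)" "\<And>k. w k \<in> alg (pgens n)"
    "\<And>a b k. 1 \<le> a \<Longrightarrow> a < b \<Longrightarrow> b \<in> Iset n \<Longrightarrow> k \<in> Iset n \<Longrightarrow> delta a b (w k) = 0"
    "\<And>k. k \<in> Iset n \<Longrightarrow> slice (w k) = (-1) ^ pp k *c gn (k, 1, 0)"
proof -
  define N where "N = 2 * n + 1"
  have rel: "oprel n N (rdet N (Amat n)) (Emin N)"
    unfolding Emin_def
    by (rule oprel_rdet) (rule oprel_Amat; simp add: Iset_def N_def)
  obtain p where p: "\<And>i. rdet N (Amat n) i = coef (p i)" "\<And>i. p i \<in> alg (pgens n)"
    "\<And>i. i > N \<Longrightarrow> p i = 0" "\<And>v. Emin N v = (\<Sum>i\<le>N. p i * (DD ^^ i) v)"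
    by (rule oprelE[OF rel]) (rule that)
  define z where "z k = gn (0, 0, k)" for k
  have Dz: "(DD ^^ i) (z 0) = z i" for i by (simp add: z_def D_pow_gn)
  have Ez: "Emin N (z 0) = (\<Sum>i\<le>N. p i * z i)" unfolding p(4) Dz ..
  have less: "(0, 0, k) < h" if "h \<in> posgens" for h :: gen and k
    using that by (auto simp: posgens_def less_prod_def)
  have 1: "delta a b (p i) = 0" if "1 \<le> a" "a < b" "b \<in> Iset n" "i \<le> N" for a b i
  proof -
    have dz: "delta a b (z k) = 0" for k by (simp add: z_def deltag_def)
    \<comment> \<open>The defective size b - 1 is never N because b is at most N, and z is a
      constant for the derivation.\<close>
    have "delta a b (Emin N (z 0)) = 0"
      using that by (simp add: delta_Emin dz Iset_def Emin.zero N_def)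
    then have "(\<Sum>i\<le>N. delta a b (p i) * gn (0, 0, i)) = 0"
      unfolding Ez by (simp add: delta.sum delta_mult dz) (simp add: z_def)
    then show ?thesis
      by (rule sum_extract_right[where G = posgens, rotated -2])
        (use that in \<open>auto simp: inj_on_def less intro: delta_alg[OF _ p(2)]\<close>)
  qed
  have 2: "slice (p (N - k)) = (-1) ^ pp k *c gn (k, 1, 0)" if k: "k \<in> Iset n" for k
  proof -
    \<comment> \<open>The expected coefficients of the sliced determinant D^N + \<Sum> (-1)^p(k) bar
      e_k1 D^(N-k), indexed by the power of D.\<close>
    define c where "c i = (if i = N then 1 else (-1) ^ pp (N - i) *c gn (N - i, 1, 0))" for i
    have sz: "slice (z i) = z i" for i by (simp add: z_def pig_def)
    have "(\<Sum>i\<le>N. slice (p i) * z i) = slice (Emin N (z 0))"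
      unfolding Ez by (simp add: slice.sum slice.hm_mult sz)
    also have "\<dots> = z N + (\<Sum>i\<in>{1..N}. (-1) ^ pp i *c (gn (i, 1, 0) * z (N - i)))"
      unfolding slice_Emin sz Dz by simp
    also have "(\<Sum>i\<in>{1..N}. (-1) ^ pp i *c (gn (i, 1, 0) * z (N - i))) = (\<Sum>i<N. c i * z i)"
      by (rule sum.reindex_bij_witness[of _ "\<lambda>i. N - i" "\<lambda>i. N - i"]) (auto simp: c_def)
    also have "z N + (\<Sum>i<N. c i * z i) = (\<Sum>i\<le>N. c i * z i)"
      by (simp add: c_def lessThan_Suc_atMost[symmetric] add.commute)
    finally have "(\<Sum>i\<le>N. (slice (p i) - c i) * gn (0, 0, i)) = 0"
      by (simp add: left_diff_distrib sum_subtractf z_def)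
    then have "slice (p (N - k)) - c (N - k) = 0"
    proof (rule sum_extract_right[where G = posgens, rotated -2])
      show "slice (p i) - c i \<in> alg posgens" for i
      proof (rule alg_diff)
        show "slice (p i) \<in> alg posgens"
          by (rule slice.hm_alg[OF p(2)])
            (use pgens_posgens in \<open>auto simp: pig_def alg_closed intro!: alg_gn\<close>)
        show "c i \<in> alg posgens"
          by (auto simp: c_def posgens_def intro!: alg_closed alg_gn alg_one)
      qed
    qed (auto simp: inj_on_def less)
    then show ?thesis using k by (auto simp: c_def Iset_def N_def)
  qed
  \<comment> \<open>For k > N the truncated subtraction gives the coefficient of D^0, both here and
    in \<open>wgen\<close>, so the first two properties hold for all k.\<close>
  show ?thesis
    by (rule that[of "\<lambda>k. p (N - k)"]) (use p 1 2 in \<open>auto simp: wgen_def N_def\<close>)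
qed

section \<open>Invariants vanishing on the slice\<close>

definition len :: "nat \<Rightarrow> sV set" where
  "len L = {x. \<forall>u. coef x u \<noteq> 0 \<longrightarrow> length u = L}"

lemma len_closed:
  "0 \<in> len L" "x \<in> len L \<Longrightarrow> y \<in> len L \<Longrightarrow> x + y \<in> len L" "x \<in> len L \<Longrightarrow> c *c x \<in> len L"
  by (force simp: len_def)+

lemma len_coef: "x \<in> len L \<Longrightarrow> length u \<noteq> L \<Longrightarrow> coef x u = 0"
  by (auto simp: len_def)

lemma len_diff: "x \<in> len L \<Longrightarrow> y \<in> len L \<Longrightarrow> x - y \<in> len L"
  by (force simp: len_def)

lemma len_uminus: "x \<in> len L \<Longrightarrow> - x \<in> len L"
  by (force simp: len_def)

lemma len_wd: "wd u \<in> len (length u)"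
  by (auto simp: len_def coef_wd split: if_splits)

lemma len_gn: "gn x \<in> len 1"
  using len_wd[of "[x]"] by (simp add: gn_def)

lemma len_induct [consumes 1, case_names zero step]:
  assumes "x \<in> len L" "P 0"
    and "\<And>c u y. monom u \<Longrightarrow> length u = L \<Longrightarrow> y \<in> len L \<Longrightarrow> P y \<Longrightarrow> P (c *c wd u + y)"
  shows "P x"
proof -
  have "P (\<Sum>u\<in>S. coef x u *c mon u) \<and> (\<Sum>u\<in>S. coef x u *c mon u) \<in> len L"
    if "finite S" "S \<subseteq> supp (coef x)" for S
    using that
  proof (induction S)
    case (insert u S)
    then have "monom u" using monom_supp_coef by blast
    moreover have "length u = L" using insert.prems assms(1) by (auto simp: len_def supp_def)
    ultimately show ?case using insert assms(3)[of u] len_wd[of u]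
      by (simp add: mon_wd len_closed)
  qed (use assms in \<open>simp add: len_closed\<close>)
  from this[of "supp (coef x)"] show ?thesis by (simp flip: sV_expand)
qed

lemma len_mult:
  assumes "x \<in> len L" "y \<in> len M"
  shows "x * y \<in> len (L + M)"
  using assms(1)
proof (induction x rule: len_induct)
  case (step c u z)
  have "wd u * y \<in> len (L + M)" using assms(2)
  proof (induction y rule: len_induct)
    case (step d v y)
    then show ?case using len_wd[of "u @ v"] \<open>length u = L\<close>
      by (simp add: algebra_simps len_closed flip: wd_append)
  qed (simp add: len_closed)
  then show ?case using step by (simp add: algebra_simps len_closed)
qed (simp add: len_closed)

lemma len_sg: "x \<in> len L \<Longrightarrow> sg x \<in> len L"
  by (induction x rule: len_induct) (simp_all add: sg.add sg.scale sg_wd len_closed, metis len_closed(2,3) len_wd)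

lemma len_D: "x \<in> len L \<Longrightarrow> DD x \<in> len L"
proof (induction x rule: len_induct)
  case (step c u y)
  have "DD (wd u) \<in> len (length u)"
  proof (induction u)
    case (Cons x u)
    then show ?case
      using len_mult[OF len_gn[of "dgen x"] len_wd[of u]] len_mult[OF len_sg[OF len_gn[of x]] Cons]
      by (simp add: wd_Cons D_mult len_closed)
  qed (simp add: len_closed)
  then show ?case using step by (simp add: D.add D.scale len_closed)
qed (simp add: len_closed)

lemma len_D_pow: "x \<in> len L \<Longrightarrow> (DD ^^ m) x \<in> len L"
  by (induction m) (simp_all add: len_D)

text \<open>Only three kinds of generators have a part without a letter of p in their image, and all but
  one of them have second index a.\<close>

lemma dbase_decomp:
  assumes "1 \<le> a" "a < b" "1 \<le> l" "l \<le> k"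
  obtains c i r where "dbase a b k l = c *c ep a b i + r" "r \<in> len 2"
    "c \<noteq> 0 \<Longrightarrow> l = a \<or> (k = b \<and> l = Suc a \<and> i = 0)" "k = b \<Longrightarrow> l = Suc a \<Longrightarrow> c \<noteq> 0"
proof -
  have len2: "ep a b 0 * gn y \<in> len 2" for y
    using len_mult[OF len_gn len_gn, of "(0, 1 + glpar a b mod 2, 0)" y]
    by (simp add: ep_def numeral_2_eq_2)
  \<comment> \<open>A bare derivative of the test field arises from the chi term if (k, l) = (b, a),
    from bar e_{a,a+1} becoming a scalar if (k, l) = (b, a+1), and from bar e_{b-1,b} becoming a
    scalar if (k, l) = (b-1, a).\<close>
  consider "k = b" "l = a" | "k = b" "l < a" | "k = b" "l = Suc a" | "k = b" "l > Suc a"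
    | "l = a" "b < k" | "l = a" "Suc k = b" | "l = a" "Suc k < b" | "k \<noteq> b" "l \<noteq> a"
    by linarith
  then show thesis
  proof cases
    case 1
    then show thesis using assms
      by (intro that[of "(-1) ^ pp a * (-1) ^ glpar a b" 1 "(-1) ^ (glpar a b * (glpar k l + 1)) *c (ep a b 0 *
       (gn (a, l, 0) + (- ((-1) ^ (glpar a b * glpar k l))) *c gn (k, b, 0)))"])
        (simp_all add: dbase_def rhog_def add.commute distrib_left right_diff_distrib len_closed len_diff len2)
  next
    case 2
    then show thesis using assms
      by (intro that[of 0 0 "(-1) ^ (glpar a b * (glpar k l + 1)) *c (ep a b 0 * gn (a, l, 0))"])
        (simp_all add: dbase_def rhog_def len_closed len2)
  next
    case 3
    then show thesis using assms
      by (intro that[of "(-1) ^ (glpar a b * (glpar k l + 1)) * (-1) ^ pp l" 0 0])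
        (simp_all add: dbase_def rhog_def len_closed)
  next
    case 4
    then show thesis using assms
      by (intro that[of 0 0 0]) (simp_all add: dbase_def rhog_def len_closed)
  next
    case 5
    then show thesis using assms
      by (intro that[of 0 0 "(-1) ^ (glpar a b * (glpar k l + 1)) *c (ep a b 0 *
       ((- ((-1) ^ (glpar a b * glpar k l))) *c gn (k, b, 0)))"])
        (simp_all add: dbase_def rhog_def len_closed len_uminus len2)
  next
    case 6
    then show thesis using assms
      by (intro that[of "(-1) ^ (glpar a b * (glpar k l + 1)) * (- ((-1) ^ (glpar a b * glpar k l)) * (-1) ^ pp b)" 0 0])
        (auto simp add: dbase_def rhog_def len_closed)
  next
    case 7
    then show thesis using assms
      by (intro that[of 0 0 0]) (simp_all add: dbase_def rhog_def len_closed)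
  next
    case 8
    then show thesis by (intro that[of 0 0 0]) (simp_all add: dbase_def len_closed)
  qed
qed

lemma derw_sum:
  "derw False \<phi> v = (\<Sum>i<length v. wd (take i v) * \<phi> (v ! i) * wd (drop (Suc i) v))"
proof (induction v)
  case (Cons x v)
  show ?case
    unfolding list.size add_0_right add_Suc_right sum.lessThan_Suc_shift
    by (simp add: Cons tw_def wd_Cons sum_distrib_left mult.assoc)
qed simp

lemma kap_nonzero: "(\<And>x. od x \<Longrightarrow> count_list w x \<le> 1) \<Longrightarrow> kap od w \<noteq> 0"
proof (induction w)
  case (Cons x w)
  have "cross od [x] w \<noteq> 0"
  proof
    assume "cross od [x] w = 0"
    then have "\<exists>y\<in>set w. gsign od x y = 0" by (auto simp: cross_def prod_list_zero_iff)
    then have "od x" "x \<in> set w" by (auto simp: gsign_def split: if_splits)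
    then show False using Cons.prems[of x] by (simp add: count_list_0_iff)
  qed
  moreover have "kap od w \<noteq> 0"
    by (rule Cons.IH) (use Cons.prems in \<open>fastforce split: if_splits\<close>)
  ultimately show ?case by simp
qed simp

lemma is_mono_sublist: "is_mono od (s @ x # t) \<Longrightarrow> is_mono od (s @ t)"
  by (fastforce simp: is_mono_def sorted_append split: if_splits)

lemma kap_insert_even:
  assumes "\<not> od x"
  shows "kap od (s @ x # t) = kap od (s @ t)"
proof -
  have e: "cross od [x] w = 1" for w
    using assms by (induction w) (simp_all add: cross_def gsign_def)
  have e': "cross od w [x] = 1" for w
    using assms by (induction w) (simp_all add: cross_def gsign_def)
  have "kap od (s @ ([x] @ t)) = kap od (s @ t)"
    by (simp only: kap_append cross_append_right e e') (simp add: e)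
  then show ?thesis by simp
qed

lemma is_mono_count: "is_mono od u \<Longrightarrow> od x \<Longrightarrow> count_list u x \<le> 1"
  by (simp add: is_mono_def)

text \<open>Minimal length ensures that the word examined in the image is reached only by trading a
  letter for a bare derivative of the test field. Minimal column sum then rules out that the traded
  letter lay in column a = l - 1, and the only other tradable letters are derivatives of the one in
  row k and column l.\<close>

lemma leading_word:
  assumes y: "y \<in> alg (pgens n)"
    and inv: "\<And>a b. a \<in> Iset n \<Longrightarrow> b \<in> Iset n \<Longrightarrow> a < b \<Longrightarrow> delta a b y = 0"
    and u: "coef y u \<noteq> 0"
    and min: "\<And>v. coef y v \<noteq> 0 \<Longrightarrow> length u \<le> length v"
      "\<And>v. coef y v \<noteq> 0 \<Longrightarrow> length v = length u \<Longrightarrow>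
         sum_list (map (fst \<circ> snd) u) \<le> sum_list (map (fst \<circ> snd) v)"
    and g: "(k, l, m) \<in> set u"
  shows "l \<le> 1"
proof (rule ccontr)
  assume "\<not> l \<le> 1"
  let ?g = "(k, l, m)"
  have gens: "set v \<subseteq> pgens n" if "coef y v \<noteq> 0" for v using y that by (auto simp: alg_def)
  have mono: "monom v" if "coef y v \<noteq> 0" for v using that coef_eq_0 by blast
  have kl: "k \<in> Iset n" "l \<in> Iset n" "l \<le> k" using gens[OF u] g by (auto simp: pgens_def)
  define a b where "a = l - 1" and "b = k"
  have ab: "a \<in> Iset n" "b \<in> Iset n" "a < b" "1 \<le> a" "l = Suc a"
    using kl \<open>\<not> l \<le> 1\<close> by (auto simp: a_def b_def Iset_def)
  define e where "e i = (0::nat, 1 + glpar a b mod 2, i::nat)" for i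
  \<comment> \<open>The word whose coefficient gives the contradiction: one occurrence of
    \<open>?g\<close> is traded for the m-th derivative of the test field, which is placed first as
    the smallest letter.\<close>
  define w0 where "w0 = e m # remove1 ?g u"
  have mset_w0: "mset w0 + {#?g#} = mset u + {#e m#}"
    using g by (simp add: w0_def)
  have len_w0: "length w0 = length u"
    using arg_cong[OF mset_w0, of size] by simp
  have e_notin: "e i \<notin> set v" if "coef y v \<noteq> 0" for i v
    using gens[OF that] by (auto simp: e_def pgens_def Iset_def)
  have summand: "coef (wd s * deltag a b (k', l', m') * wd t) w0 \<noteq> 0 \<Longrightarrow>
      (k', l', m') = ?g \<and> s @ (k', l', m') # t = u"
    (is "?nz \<Longrightarrow> _")
    if v: "coef y (s @ (k', l', m') # t) \<noteq> 0" for s k' l' m' t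
  proof -
    let ?v = "s @ (k', l', m') # t"
    assume nz: ?nz
    have x: "k' \<in> Iset n" "l' \<in> Iset n" "l' \<le> k'" "1 \<le> l'"
      using gens[OF v] by (auto simp: pgens_def Iset_def)
    obtain c i r where r: "dbase a b k' l' = c *c ep a b i + r" "r \<in> len 2"
      "c \<noteq> 0 \<Longrightarrow> l' = a \<or> (k' = b \<and> l' = Suc a \<and> i = 0)"
      using dbase_decomp[OF ab(4,3) x(4,3)] by metis
    have d: "deltag a b (k', l', m') = c *c gn (e (i + m')) + (DD ^^ m') r"
      using x by (simp add: deltag_def r(1) D_pow_linear ep_def D_pow_gn e_def)
    \<comment> \<open>The remainder only produces words with one letter more than \<open>?v\<close>,
      hence longer than \<open>w0\<close>.\<close>
    have "wd s * (DD ^^ m') r * wd t \<in> len (length s + 2 + length t)"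
      by (intro len_mult len_wd len_D_pow r)
    then have "coef (wd s * (DD ^^ m') r * wd t) w0 = 0"
      using min(1)[OF v] len_w0 by (force simp: len_def)
    then have "c * coef (wd (s @ e (i + m') # t)) w0 \<noteq> 0"
      using nz by (simp add: d distrib_left distrib_right wd_append wd_Cons mult.assoc)
    then have c: "c \<noteq> 0" and "w0 = sort (s @ e (i + m') # t)"
      by (auto simp: coef_wd split: if_splits)
    then have ms: "mset w0 = mset (s @ t) + {#e (i + m')#}" by simp
    have "e m \<in># mset w0" by (simp add: w0_def)
    moreover have "e m \<notin> set (s @ t)" using e_notin[OF v, of m] by auto
    ultimately have em: "e m = e (i + m')" using ms by auto
    then have m: "m = i + m'" by (simp add: e_def)
    have "mset u + {#e m#} = mset (s @ t) + {#?g#} + {#e m#}"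
      using mset_w0 ms m by simp
    then have mu: "mset u = mset (s @ t) + {#?g#}" by simp
    have mv: "mset ?v = mset (s @ t) + {#(k', l', m')#}" by simp
    have "length ?v = length u" using arg_cong[OF mu, of size] by simp
    moreover have sums: "sum_list (map (fst \<circ> snd) u) = sum_list (map (fst \<circ> snd) (s @ t)) + l"
      using arg_cong[OF mu, of "\<lambda>M. sum_mset (image_mset (fst \<circ> snd) M)"]
      by (simp flip: sum_mset_sum_list)
    \<comment> \<open>The words u and \<open>?v\<close> differ only by exchanging \<open>?g\<close>
      for (k', l', m'), so comparing column sums compares l with l'. This excludes l' = a.\<close>
    ultimately have "l \<le> l'" using min(2)[OF v] by simp
    then have "k' = k" "l' = l" "i = 0" using r(3)[OF c] ab by (auto simp: b_def)
    then have "(k', l', m') = ?g" using m by simp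
    then have "mset ?v = mset u" using mu mv by simp
    moreover have "sorted ?v" "sorted u" using mono[OF v] mono[OF u] by (auto simp: is_mono_def)
    ultimately have "?v = u" by (metis properties_for_sort)
    then show ?thesis using \<open>(k', l', m') = ?g\<close> by simp
  qed
  have "coef (derw False (deltag a b) v) w0 = 0" if v: "coef y v \<noteq> 0" "v \<noteq> u" for v
    unfolding derw_sum coef_sum
  proof (rule sum.neutral, rule ballI)
    fix i assume i: "i \<in> {..<length v}"
    obtain k' l' m' where x: "v ! i = (k', l', m')" by (cases "v ! i")
    have split: "v = take i v @ (k', l', m') # drop (Suc i) v"
      using id_take_nth_drop[of i v] i x by simp
    then have "coef y (take i v @ (k', l', m') # drop (Suc i) v) \<noteq> 0" using v by simp
    from summand[OF this] split v(2)
    show "coef (wd (take i v) * deltag a b (v ! i) * wd (drop (Suc i) v)) w0 = 0"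
      unfolding x by metis
  qed
  moreover have "coef (derw False (deltag a b) u) w0 \<noteq> 0"
  proof -
    let ?I = "{i. i < length u \<and> u ! i = ?g}"
    obtain c i r where r: "dbase a b k l = c *c ep a b i + r" "r \<in> len 2"
      "c \<noteq> 0 \<Longrightarrow> l = a \<or> (k = b \<and> l = Suc a \<and> i = 0)" "k = b \<Longrightarrow> l = Suc a \<Longrightarrow> c \<noteq> 0"
      using dbase_decomp[OF ab(4,3), of l k] kl ab(5) by (metis le_add1 plus_1_eq_Suc)
    have c: "c \<noteq> 0" "i = 0" using r(3,4) ab(5) by (auto simp: b_def)
    have d: "deltag a b ?g = c *c gn (e m) + (DD ^^ m) r"
      using kl(3) \<open>\<not> l \<le> 1\<close> by (simp add: deltag_def r(1) c D_pow_linear ep_def D_pow_gn e_def)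
    have cardI: "card ?I = count_list u ?g"
      by (simp add: count_list_eq_length_filter length_filter_conv_card eq_commute)
    have "count_list u ?g > 0" using g by (simp add: count_list_0_iff zero_less_iff_neq_zero)
    define \<kappa> where "\<kappa> i = kap godd (take i u @ e m # drop (Suc i) u)" for i
    have split: "u = take i u @ ?g # drop (Suc i) u" if "i \<in> ?I" for i
      using id_take_nth_drop[of i u] that by simp
    \<comment> \<open>With a = l - 1 the parities p(a) and p(l) differ by one, which makes up for
      the bar on the letter traded away.\<close>
    have ge: "godd (e m) = godd ?g"
      using ab(5) by (auto simp: e_def godd_ep b_def godd_def glpar_def pp_def)
    \<comment> \<open>Several occurrences of \<open>?g\<close> must not cancel each other. An odd
      letter occurs only once; if \<open>?g\<close> is even, so is its replacement, which then moves
      freely and always gives sign 1.\<close>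
    have \<kappa>: "\<exists>q. q \<noteq> 0 \<and> (\<forall>i\<in>?I. \<kappa> i = q)"
    proof (cases "godd ?g")
      case True
      then have "card ?I \<le> 1" using mono[OF u] cardI by (simp add: is_mono_def)
      moreover have "card ?I > 0" using cardI \<open>count_list u ?g > 0\<close> by simp
      ultimately have "card ?I = 1" by simp
      then obtain i where i: "?I = {i}" by (rule card_1_singletonE)
      have iI: "i \<in> ?I" unfolding i by simp
      have "\<kappa> i \<noteq> 0" unfolding \<kappa>_def
      proof (rule kap_nonzero)
        fix x assume x: "godd x"
        have "count_list u x \<le> 1" using mono[OF u] x by (rule is_mono_count)
        then have "count_list (take i u @ ?g # drop (Suc i) u) x \<le> 1"
          by (simp only: split[OF iI, symmetric])
        moreover have "e m \<notin> set (take i u)" "e m \<notin> set (drop (Suc i) u)"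
          using e_notin[OF u, of m] by (auto dest: in_set_takeD in_set_dropD)
        ultimately show "count_list (take i u @ e m # drop (Suc i) u) x \<le> 1"
          by (auto simp: count_list_0_iff split: if_splits)
      qed
      then show ?thesis using i by auto
    next
      case False
      have "\<kappa> i = 1" if "i \<in> ?I" for i
      proof -
        have "monom (take i u @ drop (Suc i) u)"
          by (rule is_mono_sublist[of _ _ ?g]) (simp only: split[OF that, symmetric] mono[OF u])
        then show ?thesis using False by (simp add: \<kappa>_def kap_insert_even ge kap_mono)
      qed
      then show ?thesis by (intro exI[of _ 1]) simp
    qed
    then obtain q where q: "q \<noteq> 0" "\<And>i. i \<in> ?I \<Longrightarrow> \<kappa> i = q" by blast
    have val: "coef (wd (take i u) * deltag a b (u ! i) * wd (drop (Suc i) u)) w0 =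
        (if i \<in> ?I then c * q else 0)" if "i < length u" for i
    proof (cases "i \<in> ?I")
      case True
      have L: "length (take i u) + 2 + length (drop (Suc i) u) \<noteq> length w0"
        using that len_w0 by simp
      have "wd (take i u) * (DD ^^ m) r * wd (drop (Suc i) u) \<in>
          len (length (take i u) + 2 + length (drop (Suc i) u))"
        by (intro len_mult len_wd len_D_pow r)
      then have 0: "coef (wd (take i u) * (DD ^^ m) r * wd (drop (Suc i) u)) w0 = 0"
        using L[symmetric] by (rule len_coef)
      have "sort (take i u @ e m # drop (Suc i) u) = w0"
      proof (rule properties_for_sort)
        have swap: "mset w0 = mset (s @ e m # t)" if "mset u = mset (s @ ?g # t)" for s t
        proof -
          have "mset w0 + {#?g#} = mset (s @ e m # t) + {#?g#}"
            unfolding mset_w0 that by simp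
          then show ?thesis by (rule add_right_imp_eq)
        qed
        show "mset w0 = mset (take i u @ e m # drop (Suc i) u)"
          by (rule swap[OF arg_cong[OF split[OF True], of mset]])
        have "sorted (remove1 ?g u)" using mono[OF u] by (simp add: is_mono_def sorted_remove1)
        moreover have "e m \<le> x" if "x \<in> set (remove1 ?g u)" for x
        proof -
          have "x \<in> pgens n" using that gens[OF u] set_remove1_subset by fastforce
          then have "fst x > 0" by (auto simp: pgens_def Iset_def)
          then show ?thesis by (cases x) (simp add: e_def)
        qed
        ultimately show "sorted w0" by (simp add: w0_def)
      qed
      then have "coef (wd (take i u @ e m # drop (Suc i) u)) w0 = q"
        using q(2)[OF True] by (simp add: coef_wd \<kappa>_def)
      then have "coef (wd (take i u) * gn (e m) * wd (drop (Suc i) u)) w0 = q"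
        by (simp add: wd_append wd_Cons mult.assoc)
      then show ?thesis using True 0 by (simp add: d distrib_left distrib_right)
    next
      case False
      obtain k' l' m' where x: "u ! i = (k', l', m')" by (cases "u ! i")
      have eq: "take i u @ (k', l', m') # drop (Suc i) u = u"
        using id_take_nth_drop[OF that] x by (simp only:)
      have "coef y (take i u @ (k', l', m') # drop (Suc i) u) \<noteq> 0" unfolding eq by (rule u)
      note * = summand[OF this]
      have "(k', l', m') \<noteq> ?g" using False that x by simp
      then have "coef (wd (take i u) * deltag a b (u ! i) * wd (drop (Suc i) u)) w0 = 0"
        using * unfolding x by blast
      then show ?thesis using False by (simp only: if_False)
    qed
    \<comment> \<open>Equal contributions add up to the multiplicity of the letter, a positive
      integer and hence nonzero in characteristic 0.\<close>
    have "coef (derw False (deltag a b) u) w0 = (\<Sum>i<length u. if i \<in> ?I then c * q else 0)"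
      unfolding derw_sum coef_sum by (intro sum.cong refl val) simp
    also have "\<dots> = (\<Sum>i\<in>?I. c * q)"
      by (rule sum.mono_neutral_cong_right) auto
    also have "\<dots> = of_nat (card ?I) * (c * q)" by simp
    finally show ?thesis using c q cardI \<open>count_list u ?g > 0\<close> by simp
  qed
  moreover have "coef (delta a b y) w0 = (\<Sum>v\<in>supp (coef y). coef y v * coef (derw False (deltag a b) v) w0)"
    by (simp add: der_def lin_def)
  moreover have "(\<Sum>v\<in>supp (coef y). coef y v * coef (derw False (deltag a b) v) w0) =
      (\<Sum>v\<in>{u}. coef y v * coef (derw False (deltag a b) v) w0)"
    by (rule sum.mono_neutral_right[OF finite_supp_coef])
      (use u calculation(1) in \<open>auto simp: supp_def\<close>)
  ultimately show False using inv[OF ab(1-3)] u by simp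
qed

text \<open>The slice kills or fixes each monomial, and it fixes those made of letters in columns 0
  and 1, of which \<open>u\<close> is one.\<close>

lemma coef_slice:
  assumes "\<And>k l m. (k, l, m) \<in> set u \<Longrightarrow> l \<le> 1"
  shows "coef (slice x) u = coef x u"
proof (induction x rule: sV_induct)
  case (step c v y)
  have "coef (slice (wd v)) u = coef (wd v) u"
  proof (cases "\<exists>x\<in>set v. fst (snd x) \<ge> 2")
    case True
    then obtain x where x: "x \<in> set v" "fst (snd x) \<ge> 2" by blast
    then have "slice (wd v) = 0"
      by (subst slice.hm_wd) (induction v; force simp: pig_def)
    moreover have "u \<noteq> v" using assms x by (cases x) fastforce
    ultimately show ?thesis using step(1) by (simp add: coef_wd_mono)
  next
    case False
    then have "map pig v = map gn v" by (auto simp: pig_def)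
    then have "prod_list (map pig v) = prod_list (map gn v)" by (simp only:)
    then have "slice (wd v) = wd v" by (simp only: slice.hm_wd) (simp only: wd_prod_list)
    then show ?thesis by simp
  qed
  then show ?case using step by (simp add: slice.add slice.scale)
qed simp

lemma slice_injective:
  assumes y: "y \<in> alg (pgens n)"
    and inv: "\<And>a b. a \<in> Iset n \<Longrightarrow> b \<in> Iset n \<Longrightarrow> a < b \<Longrightarrow> delta a b y = 0"
    and slice: "slice y = 0"
  shows "y = 0"
proof (rule ccontr)
  assume "y \<noteq> 0"
  then obtain u1 where u1: "coef y u1 \<noteq> 0" using sV_eqI[of y 0] by auto
  \<comment> \<open>Pairs are ordered lexicographically, so a minimum of \<open>f\<close> has least
    length and, among words of that length, least column sum.\<close>
  define f where "f v = (length v, sum_list (map (fst \<circ> snd) v))" for v :: "gen list"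
  have "finite (f ` supp (coef y))" "f ` supp (coef y) \<noteq> {}"
    using u1 by (simp, auto simp: supp_def)
  then obtain p where p: "p \<in> f ` supp (coef y)" "\<And>q. q \<in> f ` supp (coef y) \<Longrightarrow> p \<le> q"
    using Min_in Min_le by metis
  then obtain u where u': "u \<in> supp (coef y)" "p = f u" by auto
  then have u: "coef y u \<noteq> 0" by (simp add: supp_def)
  have min: "f u \<le> f v" if "coef y v \<noteq> 0" for v
    using p(2)[of "f v"] u'(2) that by (simp add: supp_def)
  have "l \<le> 1" if "(k, l, m) \<in> set u" for k l m
    using y inv u _ _ that
  proof (rule leading_word)
    fix v assume v: "coef y v \<noteq> 0"
    show "length u \<le> length v" using min[OF v] by (auto simp: f_def less_eq_prod_def)
    show "sum_list (map (fst \<circ> snd) u) \<le> sum_list (map (fst \<circ> snd) v)" if "length v = length u"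
      using min[OF v] that by (auto simp: f_def less_eq_prod_def)
  qed
  then have "coef (slice y) u = coef y u" by (rule coef_slice)
  then show False using slice u by simp
qed

section \<open>Differential polynomials in the coefficients\<close>

definition wpoly :: "(nat \<Rightarrow> sV) \<Rightarrow> (nat \<times> nat) sca \<Rightarrow> sV" where
  "wpoly w F = (\<Sum>u\<in>supp F. F u *c prod_list (map (\<lambda>(k, m). (DD ^^ m) (w k)) u))"

lemma weval_wpoly:
  assumes "\<And>k. wgen n k = coef (w k)"
  shows "weval n F = coef (wpoly w F)"
proof -
  have "sprod godd (map (\<lambda>(k, m). (vD ^^ m) (wgen n k)) u) =
      coef (prod_list (map (\<lambda>(k, m). (DD ^^ m) (w k)) u))" for u
    by (subst coef_prod_list[symmetric])
      (simp add: assms coef_D_pow comp_def case_prod_unfold)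
  then show ?thesis by (simp add: weval_def slin_def wpoly_def fun_eq_iff)
qed

definition wsym_gen :: "nat \<times> nat \<Rightarrow> gen" where "wsym_gen = (\<lambda>(k, m). (k, 1, m))"

lemma inj_wsym_gen: "inj wsym_gen"
  by (auto simp: wsym_gen_def inj_def)

lemma count_list_map_inj: "inj f \<Longrightarrow> count_list (map f u) (f x) = count_list u x"
  by (induction u) (auto simp: inj_eq)

text \<open>The parity p(k) + p(1) + 1 + m of the letter agrees with k + m, since p(1) = 0 and p(k)
  + 1 has the parity of k; the lexicographic order of (k, m) is that of (k, 1, m).\<close>

lemma monom_wsym_gen: "monom (map wsym_gen u) \<longleftrightarrow> is_mono wodd u"
proof -
  have "wsym_gen x \<le> wsym_gen y \<longleftrightarrow> x \<le> y" for x y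
    by (cases x; cases y) (auto simp: wsym_gen_def less_eq_prod_def)
  then have "sorted (map wsym_gen u) \<longleftrightarrow> sorted u"
    by (simp add: sorted_map)
  moreover have odd: "godd (wsym_gen x) = wodd x" for x
    by (cases x) (auto simp: wsym_gen_def godd_def wodd_def pp_def)
  moreover have "(\<forall>x. godd x \<longrightarrow> count_list (map wsym_gen u) x \<le> 1) \<longleftrightarrow>
      (\<forall>x. wodd x \<longrightarrow> count_list u x \<le> 1)" (is "?L \<longleftrightarrow> ?R")
  proof
    assume ?L
    then show ?R using odd count_list_map_inj[OF inj_wsym_gen, of u] by metis
  next
    assume R: ?R
    show ?L
    proof (intro allI impI)
      fix x assume "godd x"
      show "count_list (map wsym_gen u) x \<le> 1"
      proof (cases "x \<in> range wsym_gen")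
        case True
        then show ?thesis using R odd count_list_map_inj[OF inj_wsym_gen, of u] \<open>godd x\<close> by force
      next
        case False
        then have "x \<notin> set (map wsym_gen u)" by auto
        then show ?thesis by (metis count_list_0_iff zero_le)
      qed
    qed
  qed
  ultimately show ?thesis by (simp add: is_mono_def)
qed

text \<open>The total sign with which a monomial in the symbols w_k^(m) appears on the slice, where
  w_k becomes (-1)^p(k) bar e_k1.\<close>

definition ssign :: "(nat \<times> nat) list \<Rightarrow> complex" where
  "ssign u = (\<Prod>(k, m)\<leftarrow>u. (-1) ^ pp k)"

lemma ssign_square: "ssign u * ssign u = 1"
proof (induction u)
  case (Cons x u)
  have "ssign (x # u) * ssign (x # u) = ((-1) ^ pp (fst x) * (-1) ^ pp (fst x)) * (ssign u * ssign u)"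
    by (simp add: ssign_def case_prod_beta mult_ac)
  then show ?case using Cons by (simp flip: power_mult_distrib)
qed (simp add: ssign_def)

text \<open>On the slice each w_k^(m) is a signed letter, so distinct monomials go to distinct
  monomials. This yields both freeness and the inverse of evaluation.\<close>

lemma slice_wpoly:
  assumes w: "\<And>k. k \<in> Iset n \<Longrightarrow> slice (w k) = (-1) ^ pp k *c gn (k, 1, 0)"
    and F: "valid (wsyms n) wodd F" and u: "is_mono wodd u"
  shows "coef (slice (wpoly w F)) (map wsym_gen u) = F u * ssign u"
proof -
  have "slice (prod_list (map (\<lambda>(k, m). (DD ^^ m) (w k)) v)) = ssign v *c wd (map wsym_gen v)"
    if "set v \<subseteq> wsyms n" for v
    using that
  proof (induction v)
    case (Cons x v)
    obtain k m where x: "x = (k, m)" by (cases x)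
    have "slice ((DD ^^ m) (w k)) = (-1) ^ pp k *c gn (k, 1, m)"
      using Cons.prems by (simp add: x wsyms_def slice_D_pow w D_pow_linear D_pow_gn)
    then show ?case using Cons
      by (simp add: x slice.hm_mult wd_Cons wsym_gen_def ssign_def)
  qed (simp add: ssign_def)
  then have "slice (wpoly w F) = (\<Sum>v\<in>supp F. (F v * ssign v) *c wd (map wsym_gen v))"
    using F unfolding wpoly_def slice.sum slice.scale
    by (intro sum.cong refl) (simp add: valid_def)
  then have "coef (slice (wpoly w F)) (map wsym_gen u) =
      (\<Sum>v\<in>supp F. F v * ssign v * coef (wd (map wsym_gen v)) (map wsym_gen u))"
    by simp
  also have "\<dots> = (\<Sum>v\<in>supp F. if v = u then F u * ssign u else 0)"
  proof (rule sum.cong[OF refl])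
    fix v assume "v \<in> supp F"
    then have "monom (map wsym_gen v)" using F by (simp add: valid_def monom_wsym_gen)
    moreover have "map wsym_gen u = map wsym_gen v \<longleftrightarrow> v = u"
      using inj_wsym_gen by (auto simp: inj_map_eq_map)
    ultimately show "F v * ssign v * coef (wd (map wsym_gen v)) (map wsym_gen u) =
        (if v = u then F u * ssign u else 0)"
      by (simp add: coef_wd_mono)
  qed
  also have "\<dots> = F u * ssign u"
    using F by (auto simp: valid_def supp_def)
  finally show ?thesis .
qed

theorem mainTheorem3:
  fixes n :: nat
  assumes "n \<ge> 1"
  shows "(\<forall>k\<in>Iset n. wgen n k \<in> Walg n) \<and>
         Walg n = {weval n F | F. valid (wsyms n) wodd F} \<and>
         (\<forall>F. valid (wsyms n) wodd F \<and> weval n F = szero \<longrightarrow> F = szero)"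
proof -
  obtain w where w: "\<And>k. wgen n k = coef (w k)" "\<And>k. w k \<in> alg (pgens n)"
    "\<And>a b k. 1 \<le> a \<Longrightarrow> a < b \<Longrightarrow> b \<in> Iset n \<Longrightarrow> k \<in> Iset n \<Longrightarrow> delta a b (w k) = 0"
    "\<And>k. k \<in> Iset n \<Longrightarrow> slice (w k) = (-1) ^ pp k *c gn (k, 1, 0)"
    by (rule wgen_properties[of n]) (rule that)
  define W where "W = {x \<in> alg (pgens n). \<forall>a\<in>Iset n. \<forall>b\<in>Iset n. a < b \<longrightarrow> delta a b x = 0}"
  have Walg: "Walg n = coef ` W" by (simp add: Walg_iff W_def)
  have wW: "w k \<in> W" if "k \<in> Iset n" for k
    using w(2,3) that by (auto simp: W_def Iset_def)
  have W_one: "1 \<in> W" by (simp add: W_def alg_one)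
  have W_mult: "x * y \<in> W" if "x \<in> W" "y \<in> W" for x y
    using that by (simp add: W_def alg_mult delta_mult)
  have W_D: "(DD ^^ m) x \<in> W" if "x \<in> W" for m x
    using that by (simp add: W_def D_pow_alg dgen_pgens delta_D_pow D_pow_linear)
  have W_diff: "x - y \<in> W" if "x \<in> W" "y \<in> W" for x y
    using that by (simp add: W_def alg_diff delta.diff)
  have W_sum: "(\<Sum>u\<in>S. c u *c f u) \<in> W" if "\<And>u. u \<in> S \<Longrightarrow> f u \<in> W" for S c and f :: "(nat \<times> nat) list \<Rightarrow> sV"
    using that by (auto simp: W_def delta.sum delta.scale intro!: alg_sum alg_closed)
  have ev: "weval n F = coef (wpoly w F)" for F by (rule weval_wpoly) (rule w(1))
  have evW: "wpoly w F \<in> W" if F: "valid (wsyms n) wodd F" for F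
    unfolding wpoly_def
  proof (rule W_sum)
    fix u assume "u \<in> supp F"
    then have "set u \<subseteq> wsyms n" using F by (simp add: valid_def)
    then show "prod_list (map (\<lambda>(k, m). (DD ^^ m) (w k)) u) \<in> W"
      by (induction u) (auto simp: W_one wsyms_def intro!: W_mult W_D wW)
  qed
  have free: "F = szero" if F: "valid (wsyms n) wodd F" and 0: "weval n F = szero" for F
  proof
    fix u
    have "coef (wpoly w F) = coef 0" using 0 by (simp add: ev raw)
    then have "wpoly w F = 0" by (simp add: coef_inject)
    then have "F u * ssign u = 0" if "is_mono wodd u"
      using slice_wpoly[OF w(4) F that] by simp
    then have "F u = 0" if "is_mono wodd u" using that ssign_square[of u] by auto
    moreover have "F u = 0" if "\<not> is_mono wodd u" using F that by (auto simp: valid_def supp_def)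
    ultimately show "F u = szero u" by (auto simp: szero_def)
  qed
  have "\<exists>F. valid (wsyms n) wodd F \<and> y = wpoly w F" if y: "y \<in> W" for y
  proof -
    let ?S = "{(k, l, m). k \<in> Iset n \<and> l = (1::nat)} :: gen set"
    have ys: "slice y \<in> alg ?S"
      by (rule slice.hm_alg[of _ "pgens n"])
        (use y in \<open>auto simp: W_def pig_def pgens_def alg_closed Iset_def intro!: alg_gn\<close>)
    \<comment> \<open>The only candidate: its coefficients are read from the slice of y, and
      multiplying by \<open>ssign\<close> undoes the sign since it squares to 1.\<close>
    define F where "F u = (if is_mono wodd u then ssign u * coef (slice y) (map wsym_gen u) else 0)" for u
    have F: "valid (wsyms n) wodd F"
      unfolding valid_def
    proof (intro conjI ballI)
      have "supp F \<subseteq> map wsym_gen -` supp (coef (slice y))"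
        by (auto simp: supp_def F_def split: if_splits)
      moreover have "inj (map wsym_gen)" using inj_wsym_gen by (simp add: inj_mapI)
      then have "finite (map wsym_gen -` supp (coef (slice y)))"
        by (intro finite_vimageI) simp
      ultimately show "finite (supp F)" by (rule finite_subset)
      fix u assume u: "u \<in> supp F"
      then show "is_mono wodd u" by (auto simp: supp_def F_def split: if_splits)
      have "coef (slice y) (map wsym_gen u) \<noteq> 0"
        using u by (auto simp: supp_def F_def split: if_splits)
      then have "set (map wsym_gen u) \<subseteq> ?S"
        using ys unfolding alg_def by blast
      then show "set u \<subseteq> wsyms n" by (auto simp: wsyms_def wsym_gen_def)
    qed
    have FW: "wpoly w F \<in> W" by (rule evW) fact
    have Fs: "slice (wpoly w F) \<in> alg ?S"
      by (rule slice.hm_alg[of _ "pgens n"])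
        (use FW in \<open>auto simp: W_def pig_def pgens_def alg_closed Iset_def intro!: alg_gn\<close>)
    have "slice (wpoly w F) = slice y"
    proof (rule sV_eqI)
      fix v assume v: "monom v"
      show "coef (slice (wpoly w F)) v = coef (slice y) v"
      proof (cases "set v \<subseteq> ?S")
        case True
        define u where "u = map (\<lambda>(k, l, m). (k, m)) v"
        have vu: "v = map wsym_gen u"
          using True by (auto simp: u_def wsym_gen_def intro!: map_idI[symmetric])
        then have m: "is_mono wodd u" using v monom_wsym_gen by simp
        have "coef (slice (wpoly w F)) v = (ssign u * ssign u) * coef (slice y) v"
          using slice_wpoly[OF w(4) F m] m vu by (simp add: F_def)
        then show ?thesis by (simp add: ssign_square)
      next
        case False
        then have "coef (slice (wpoly w F)) v = 0" "coef (slice y) v = 0"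
          using ys Fs unfolding alg_def by blast+
        then show ?thesis by simp
      qed
    qed
    then have 1: "slice (y - wpoly w F) = 0" by (simp add: slice.diff)
    have 2: "y - wpoly w F \<in> W" by (rule W_diff[OF y FW])
    have 3: "y - wpoly w F \<in> alg (pgens n)" 
      using CollectD[OF 2[unfolded W_def]] by simp
    have 4: "\<And>a b. a \<in> Iset n \<Longrightarrow> b \<in> Iset n \<Longrightarrow> a < b \<Longrightarrow> delta a b (y - wpoly w F) = 0"
      using CollectD[OF 2[unfolded W_def]] by simp
    \<comment> \<open>Both elements are invariants with the same slice, and restriction to the slice
      is injective on invariants.\<close>
    have "y - wpoly w F = 0" by (rule slice_injective[OF 3 4 1])
    then show ?thesis using F by auto
  qed
  then have "W = {wpoly w F | F. valid (wsyms n) wodd F}" using evW by blast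
  then have "Walg n = {weval n F | F. valid (wsyms n) wodd F}" unfolding Walg ev by blast
  moreover have "\<forall>k\<in>Iset n. wgen n k \<in> Walg n" unfolding Walg w(1) using wW by blast
  ultimately show ?thesis using free by blast
qed

end
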